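(* Let $A=(U,m,\omega)$ be a minimal symplectic $A_\infty$-algebra whose symplectic form is even and has order zero, let $c_A$ be its characteristic class and let $Z_A:\mathcal G_{\bullet\bullet}\to\mathbb C$ be its partition function. Then $$\langle\langle c_A,\Gamma\rangle\rangle=Z_A(\Gamma)\qquad\text{for every oriented ribbon graph }\Gamma,$$ i.e. the composite of $A\mapsto c_A$ with the map $x\mapsto\langle\langle x,-\rangle\rangle$ from relative Chevalley-Eilenberg chains to $\operatorname{Hom}(\mathcal G_{\bullet\bullet},\mathbb C)$ equals $A\mapsto Z_A$.
   Context: **Super conventions.** All vector spaces are $\mathbb Z/2$-graded over $\mathbb C$, $|x|$ is parity, the Koszul sign rule is used, $\Pi V$ is the parity reversion, "Lie algebra" means Lie superalgebra. $S_n$ acts on the left of $V^{\otimes n}$ by permuting factors with Koszul signs (the factor in place $i$ is moved to place $\sigma(i)$). $z_n\in S_n$ is the cycle $(n\ n-1\ldots 2\ 1)$, $Z_n=\langle z_n\rangle$, $N_n=1+z_n+\ldots+z_n^{n-1}$, and $N$ acts as $N_n$ on tensors of length $n$, giving a map $N:(V^{\otimes n})_{Z_n}\to V^{\otimes n}$ from coinvariants. $V=\mathbb C^{2n|m}$ has even basis vectors $p_i,q_i$ ($1\le i\le n$) and odd basis vectors $x_1,\ldots,x_m$, and carries the even (super) skew-symmetric form with $\langle p_i,q_j\rangle=\langle x_i,x_j\rangle=\delta_{ij}$ and $\langle x_i,p_j\rangle=\langle x_i,q_j\rangle=\langle p_i,p_j\rangle=\langle q_i,q_j\rangle=0$. **Relative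 Chevalley-Eilenberg chains.** $\mathfrak h_{2n|m}=\bigoplus_{i\ge0}(V^{\otimes i})_{Z_i}$ is a Lie algebra with bracket, for $a=a_1\cdots a_k$, $b=b_1\cdots b_l$, $$\{a,b\}=\sum_{i,j}(-1)^p\langle a_i,b_j\rangle(z_{k-1}^{i-1}\cdot a_1\ldots\hat{a_i}\ldots a_k)(z_{l-1}^{j-1}\cdot b_1\ldots\hat{b_j}\ldots b_l),$$ $p=|a_i|(|a_{i+1}|+\ldots+|a_k|+|b_1|+\ldots+|b_{j-1}|)$. $\mathfrak g_{2n|m}=\bigoplus_{i\ge2}(V^{\otimes i})_{Z_i}$, $\tilde{\mathfrak g}_{2n|m}=\bigoplus_{i\ge3}(V^{\otimes i})_{Z_i}$, and $(V^{\otimes2})_{Z_2}\cong\mathfrak{osp}_{2n|m}$ (linear symplectic vector fields) acts on $\tilde{\mathfrak g}_{2n|m}$ by the bracket. $C_\bullet(\mathfrak g_{2n|m},\mathfrak{osp}_{2n|m})$ is the space of $\mathfrak{osp}_{2n|m}$-coinvariants of $\Lambda_\bullet(\tilde{\mathfrak g}_{2n|m})=T(\tilde{\mathfrak g}_{2n|m})/(g\otimes h=-(-1)^{|g||h|}h\otimes g)$; $C_{\bullet\bullet}(\mathfrak g,\mathfrak{osp})=\varinjlim_{n,m}C_\bullet(\mathfrak g_{2n|m},\mathfrak{osp}_{2n|m})$, bigraded by exterior power and half the number of tensor letters; its completion is $\prod_{i,j}C_{ij}(\mathfrak g,\mathfrak{osp})$. **Graphs.** A graph $\Gamma$ is a finite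 set of half-edges with a partition into vertices, each of cardinality (valency) $\ge3$, and a partition into two-element edges. A ribbon structure is a cyclic ordering of the half-edges at each vertex. An orientation is a linear ordering of the vertices and of the two half-edges in each edge, modulo changes of total sign $+1$ (sign of the vertex permutation times $-1$ per reversed edge). $\operatorname{Aut}(\Gamma)$ is the group of bijections of half-edges preserving vertices, edges, ribbon structure and orientation. A fully ordered graph carries linear orders on the vertices, on each edge and on the half-edges at each vertex; it has type $(k_1,\ldots,k_r)$ if its $i$th vertex has valency $k_i$; it represents an oriented ribbon graph. Numbering the half-edges $1,\ldots,2k$ vertex by vertex, its edges form an oriented chord diagram $c_\Gamma=(i_1,j_1),\ldots,(i_k,j_k)$. $\mathcal G_{\bullet\bullet}$ is the $\mathbb C$-vector space generated by isomorphism classes of oriented ribbon graphs modulo $(\Gamma,-\sigma)=-(\Gamma,\sigma)$, bigraded by numbers of vertices and edges. Oriented ribbon graphs admitting an orientation-reversing ribbon automorphism are zero in $\mathcal G_{\bullet\bullet}$. **Feynman amplitudes and the pairing.** For an oriented chord diagram $c=(i_1,j_1),\ldots,(i_k,j_k)$ let $\sigma_c\in S_{2k}$ be $i_r\mapsto2r-1$, $j_r\mapsto2r$. With $\kappa(y_1\otimes\cdots\otimes y_{2k})=\langle y_1,y_2\rangle\cdots\langle y_{2k-1},y_{2k}\rangle$, put $\beta_c(x)=\kappa(\sigma_c\cdot x)$. For a fully ordered graph $\tilde\Gamma$ of type $(k_1,\ldots,k_r)$, $\tilde F_{\tilde\Gamma}$ equals $\beta_{c_{\tilde\Gamma}}$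 on $V^{\otimes k_1}\otimes\ldots\otimes V^{\otimes k_r}$ and $0$ on all other summands of $T(T^+(V))$, $T^+(V)=\bigoplus_{i\ge1}V^{\otimes i}$. For an oriented ribbon graph $\Gamma$ represented by $\tilde\Gamma$, $$F_\Gamma(g_1\wedge\ldots\wedge g_s)=\tilde F_{\tilde\Gamma}\Big(\sum_{\sigma\in S_s}\operatorname{sgn}(\sigma)\,\sigma\cdot[(N g_1)\otimes\ldots\otimes(N g_s)]\Big),\qquad\langle\langle x,\Gamma\rangle\rangle=\frac{F_\Gamma(x)}{|\operatorname{Aut}(\Gamma)|},$$ where $\sigma$ permutes the $s$ blocks with Koszul signs. This is extended to infinite sums of chains (for given $\Gamma$ only finitely many bidegrees contribute). **Formal noncommutative geometry.** For finite dimensional $W$, $\Omega^\bullet(W)$ is the free unital associative superalgebra on $w\in W$ and symbols $dw$ ($|dw|=|w|+1$), with odd derivation $d$, $d(w)=dw$, $d(dw)=0$; $DR^\bullet(W)=\Omega^\bullet(W)/[\Omega^\bullet(W),\Omega^\bullet(W)]$; $DR^n(W)$ is the $n$-fold parity reversion of the space of $n$-forms; the order of $x_0dx_1\cdots dx_n$ is total tensor length minus $n$. $\widehat T(W)=\prod_iW^{\otimes i}$ and $\widehat{DR}^\bullet(W)$ are the $I$-adic completions; $\widehat{DR}^0(W)=\prod_i(W^{\otimes i})_{Z_i}$. Vector fields are continuous derivations $\xi$ of $\widehat T(W)$; $L_\xi,i_\xi$ are induced by derivations of forms with $L_\xi(x)=\xi(x)$, $L_\xi(dx)=(-1)^{|\xi|}d(\xi(x))$,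 $i_\xi(x)=0$, $i_\xi(dx)=\xi(x)$. Algebra maps $\phi$ induce $\phi^*$ on forms. $\Theta:\prod_{k\ge1}W^{\otimes k}\to\widehat{DR}^1(W)$, $\Theta(x\otimes y)=dx\cdot y$ ($x\in W$), is an isomorphism. A symplectic form is a closed $\omega\in\widehat{DR}^2(W)$ with $\xi\mapsto i_\xi\omega$ bijective onto $\widehat{DR}^1(W)$; $\xi$ is symplectic if $L_\xi\omega=0$. **Symplectic $A_\infty$-algebras.** A symplectic $A_\infty$-algebra is $A=(U,m,\omega)$, $U$ finite dimensional, $\omega\in\widehat{DR}^2(\Pi U^* )$ symplectic, $m$ an odd symplectic vector field on $\widehat T(\Pi U^* )$ vanishing at zero (no constant terms) with $m^2=0$. It is minimal if the linear part $m_1$ of $m$ is zero. Its Hamiltonian is the $h\in\prod_{i\ge2}((\Pi U^* )^{\otimes i})_{Z_i}$ with $dh=i_m(\omega)$. **Characteristic class.** For minimal $A$ with $\omega$ even of order zero, choose a linear isomorphism $\phi:\Pi U^*\to\mathbb C^{2n|k}$ with $\phi^*(\omega)=\sum dp_idq_i+\frac12\sum dx_idx_i$, let $h'=\phi^*(h)$ (a formal element of $\tilde{\mathfrak g}_{2n|k}$) and put $c_A=\exp(h')=\sum_{i\ge0}\frac1{i!}h'\wedge\ldots\wedge h'$ in the completion of $C_{\bullet\bullet}(\mathfrak g,\mathfrak{osp})$; it is independent of $\phi$. **Partition function.** For such $A$, $\omega$ corresponds to a nondegenerate skew-symmetric form $\langle-,-\rangle$ on $\Pi U$ via the isomorphism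 $\Upsilon$ from closed 2-forms to the commutator space $[T(\Pi U^* ),T(\Pi U^* )]$ determined by $\Upsilon(d\Theta(y))=(1-z)y$, $z$ acting as $z_k$ on length $k$ tensors. The inverse form $\langle-,-\rangle^{-1}$ on $\Pi U^*$ is defined by requiring that $\Pi U\xrightarrow{x\mapsto\langle x,-\rangle}\Pi U^*\xrightarrow{y\mapsto\langle y,-\rangle^{-1}}\Pi U^{**}$ be the canonical identification. Let $m_{k}:(\Pi U)^{\otimes k}\to\Pi U$ be the components of $m$, and $h_k\in(\Pi U^* )^{\otimes k}$ the tensor $h_k(x_1,\ldots,x_k)=\langle m_{k-1}(x_1,\ldots,x_{k-1}),x_k\rangle$; it is cyclically invariant and odd, and sign conventions are such that $\sum_{k\ge3}h_k=\Theta^{-1}(i_m(\omega))$. For an oriented ribbon graph $\Gamma$ represented by a fully ordered $\tilde\Gamma$ of type $(k_1,\ldots,k_r)$ with $2k$ half-edges, $$Z_A(\Gamma)=\frac{\kappa^A\big(\sigma_{c_{\tilde\Gamma}}\cdot(h_{k_1}\otimes\ldots\otimes h_{k_r})\big)}{|\operatorname{Aut}(\Gamma)|},\qquad\kappa^A(y_1\otimes\cdots\otimes y_{2k})=\langle y_1,y_2\rangle^{-1}\cdots\langle y_{2k-1},y_{2k}\rangle^{-1},$$ which is independent of $\tilde\Gamma$. *)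

theory Defs
  imports
    Complex_Main
    "HOL-Library.FuncSet"
    "HOL-Library.Disjoint_Sets"
    "HOL-Combinatorics.Permutations"
    "HOL-Combinatorics.Orbits"
begin

text \<open>
  A finite dimensional super vector space is given by a homogeneous basis: a finite set \<open>S\<close> of
  letters and a parity \<open>p :: 'c \<Rightarrow> bool\<close> (\<open>True\<close> = odd).  An element of the completed tensor
  algebra, the product of all tensor powers, is the function assigning to each word in the
  letters its coefficient.  Quotient spaces are represented by sets of cosets.
\<close>

section \<open>Tensors and Koszul signs\<close>

type_synonym 'c tensor = "'c list \<Rightarrow> complex"

definition single :: "'a \<Rightarrow> 'a \<Rightarrow> complex" where
  "single x = (\<lambda>y. if y = x then 1 else 0)"

definition psign :: "bool \<Rightarrow> complex" where
  "psign b = (if b then - 1 else 1)"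

definition cspan :: "('a \<Rightarrow> complex) set \<Rightarrow> ('a \<Rightarrow> complex) set" where
  "cspan G = {f. \<exists>t r. finite t \<and> t \<subseteq> G \<and> f = (\<lambda>x. \<Sum>g\<in>t. r g * g x)}"

definition wpar :: "('c \<Rightarrow> bool) \<Rightarrow> 'c list \<Rightarrow> bool" where
  "wpar p w = odd (length (filter p w))"

definition tensors :: "'c set \<Rightarrow> 'c tensor set" where
  "tensors S = {f. \<forall>u. f u \<noteq> 0 \<longrightarrow> u \<in> lists S}"

definition tmult :: "'c tensor \<Rightarrow> 'c tensor \<Rightarrow> 'c tensor" where
  "tmult f g u = (\<Sum>i\<le>length u. f (take i u) * g (drop i u))"

definition parity_aut :: "('c \<Rightarrow> bool) \<Rightarrow> bool \<Rightarrow> 'c tensor \<Rightarrow> 'c tensor" where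
  "parity_aut p q f u = psign (q \<and> wpar p u) * f u"

definition koszul :: "('c \<Rightarrow> bool) \<Rightarrow> (nat \<Rightarrow> nat) \<Rightarrow> 'c list \<Rightarrow> complex" where
  "koszul p \<sigma> v = (\<Prod>(i, j)\<in>{(i, j). i < j \<and> j < length v \<and> \<sigma> i > \<sigma> j}.
      psign (p (v ! i) \<and> p (v ! j)))"

text \<open>Left action of a permutation \<open>\<sigma>\<close> of the places \<open>{..<n}\<close> on tensors of length \<open>n\<close>.  The word
  \<open>v = permute_list \<sigma> u\<close> has \<open>v ! i = u ! \<sigma> i\<close>, so moving the factor in place \<open>i\<close> of \<open>v\<close> to place
  \<open>\<sigma> i\<close> gives \<open>u\<close>.\<close>

definition act :: "('c \<Rightarrow> bool) \<Rightarrow> (nat \<Rightarrow> nat) \<Rightarrow> 'c tensor \<Rightarrow> 'c tensor" where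
  "act p \<sigma> f u = koszul p \<sigma> (permute_list \<sigma> u) * f (permute_list \<sigma> u)"

text \<open>The cycle \<open>(n n-1 \<dots> 2 1)\<close>, with places numbered from \<open>0\<close>.\<close>

definition zperm :: "nat \<Rightarrow> nat \<Rightarrow> nat" where
  "zperm n i = (if i < n then (if i = 0 then n - 1 else i - 1) else i)"

definition Ncyc :: "('c \<Rightarrow> bool) \<Rightarrow> 'c tensor \<Rightarrow> 'c tensor" where
  "Ncyc p f u = (\<Sum>r<length u. act p (zperm (length u) ^^ r) f u)"

definition one_minus_z :: "('c \<Rightarrow> bool) \<Rightarrow> 'c tensor \<Rightarrow> 'c tensor" where
  "one_minus_z p f u = f u - act p (zperm (length u)) f u"

text \<open>The sign relating the tensor \<open>w\<^sub>1 \<otimes> \<dots> \<otimes> w\<^sub>k\<close> of dual basis vectors and its value on the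
  corresponding basis vectors \<open>e\<^sub>1, \<dots>, e\<^sub>k\<close>: each \<open>w\<^sub>j\<close> is moved past \<open>e\<^sub>i\<close> for \<open>i < j\<close>.\<close>

definition evsign :: "('c \<Rightarrow> bool) \<Rightarrow> 'c list \<Rightarrow> complex" where
  "evsign p v = (\<Prod>(i, j)\<in>{(i, j). i < j \<and> j < length v}. psign (p (v ! i) \<and> p (v ! j)))"

text \<open>The algebra map induced by the even linear map \<open>c \<mapsto> \<Sum>d. M c d \<cdot> d\<close>.\<close>

definition alg_map :: "'c set \<Rightarrow> ('c \<Rightarrow> 'd \<Rightarrow> complex) \<Rightarrow> 'c tensor \<Rightarrow> 'd tensor" where
  "alg_map S M f v = (\<Sum>u\<in>{u \<in> lists S. length u = length v}.
      f u * (\<Prod>i<length v. M (u ! i) (v ! i)))"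

text \<open>The quotient by the closure of the commutator subspace: an element is in the closure iff
  each of its homogeneous components is a finite combination of commutators of words.\<close>

definition commutators :: "('c \<Rightarrow> bool) \<Rightarrow> 'c set \<Rightarrow> nat \<Rightarrow> 'c tensor set" where
  "commutators p S n =
    {(\<lambda>w. single (u @ v) w - psign (wpar p u \<and> wpar p v) * single (v @ u) w) | u v.
       u \<in> lists S \<and> v \<in> lists S \<and> length (u @ v) = n}"

definition comm_closure :: "('c \<Rightarrow> bool) \<Rightarrow> 'c set \<Rightarrow> 'c tensor set" where
  "comm_closure p S =
    {f. \<forall>n. (\<lambda>w. if length w = n then f w else 0) \<in> cspan (commutators p S n)}"

text \<open>The class of \<open>f\<close> in the product over \<open>i\<close> of the \<open>Z\<^sub>i\<close>-coinvariants of \<open>W\<^sup>\<otimes>\<^sup>i\<close>, i.e. in the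
  completed space of noncommutative 0-forms.\<close>

definition cyc_class :: "('c \<Rightarrow> bool) \<Rightarrow> 'c set \<Rightarrow> 'c tensor \<Rightarrow> 'c tensor set" where
  "cyc_class p S f = {g \<in> tensors S. (\<lambda>w. g w - f w) \<in> comm_closure p S}"


section \<open>Formal noncommutative geometry\<close>

text \<open>The letter \<open>Inl w\<close> is the generator \<open>w\<close>, and \<open>Inr w\<close> is \<open>dw\<close>.\<close>

type_synonym 'b form = "('b + 'b) tensor"

definition fpar :: "('b \<Rightarrow> bool) \<Rightarrow> 'b + 'b \<Rightarrow> bool" where
  "fpar p = case_sum p (\<lambda>b. \<not> p b)"

definition forms :: "'b set \<Rightarrow> nat \<Rightarrow> 'b form set" where
  "forms S n =
    {f \<in> tensors (S <+> S). \<forall>u. f u \<noteq> 0 \<longrightarrow> length (filter (\<lambda>c. \<not> isl c) u) = n}"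

definition dr_class :: "('b \<Rightarrow> bool) \<Rightarrow> 'b set \<Rightarrow> nat \<Rightarrow> 'b form \<Rightarrow> 'b form set" where
  "dr_class p S n f = {g \<in> forms S n. (\<lambda>w. g w - f w) \<in> comm_closure (fpar p) (S <+> S)}"

definition DR :: "('b \<Rightarrow> bool) \<Rightarrow> 'b set \<Rightarrow> nat \<Rightarrow> 'b form set set" where
  "DR p S n = dr_class p S n ` forms S n"

definition emb :: "'b tensor \<Rightarrow> 'b form" where
  "emb f u = (if list_all isl u then f (map projl u) else 0)"

text \<open>The continuous super derivation with prescribed values \<open>Y c\<close> on the letters \<open>c\<close>; the part of
  \<open>Y c\<close> on the word \<open>v\<close> contributes with parity \<open>|c| + |v|\<close>.\<close>

definition derivation_ext ::
    "('c \<Rightarrow> bool) \<Rightarrow> 'c set \<Rightarrow> ('c \<Rightarrow> 'c tensor) \<Rightarrow> 'c tensor \<Rightarrow> 'c tensor" where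
  "derivation_ext p S Y f u = (\<Sum>i\<le>length u. \<Sum>j\<in>{i..length u}. \<Sum>c\<in>S.
      (let v = take (j - i) (drop i u) in
        psign ((p c \<noteq> wpar p v) \<and> wpar p (take i u)) * Y c v * f (take i u @ [c] @ drop j u)))"

definition dform :: "('b \<Rightarrow> bool) \<Rightarrow> 'b set \<Rightarrow> 'b form \<Rightarrow> 'b form" where
  "dform p S = derivation_ext (fpar p) (S <+> S)
     (case_sum (\<lambda>b. single [Inr b]) (\<lambda>b u. 0))"

definition super_derivation ::
    "('b \<Rightarrow> bool) \<Rightarrow> 'b set \<Rightarrow> bool \<Rightarrow> ('b tensor \<Rightarrow> 'b tensor) \<Rightarrow> bool" where
  "super_derivation p S q \<xi> \<longleftrightarrow>
     (\<forall>f\<in>tensors S. \<xi> f \<in> tensors S) \<and>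
     (\<forall>f\<in>tensors S. \<forall>g\<in>tensors S. \<xi> (\<lambda>u. f u + g u) = (\<lambda>u. \<xi> f u + \<xi> g u)) \<and>
     (\<forall>a. \<forall>f\<in>tensors S. \<xi> (\<lambda>u. a * f u) = (\<lambda>u. a * \<xi> f u)) \<and>
     (\<forall>f\<in>tensors S. \<xi> (parity_aut p True f) = (\<lambda>u. psign q * parity_aut p True (\<xi> f) u)) \<and>
     (\<forall>f\<in>tensors S. \<forall>g\<in>tensors S.
        \<xi> (tmult f g) = (\<lambda>u. tmult (\<xi> f) g u + tmult (parity_aut p q f) (\<xi> g) u)) \<and>
     (\<forall>n. \<exists>k. \<forall>f\<in>tensors S. (\<forall>u. length u < k \<longrightarrow> f u = 0) \<longrightarrow>
        (\<forall>u. length u < n \<longrightarrow> \<xi> f u = 0))"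

text \<open>Not necessarily homogeneous vector fields.  Extensionality makes equality of vector fields
  equality of functions.\<close>

definition vector_fields ::
    "('b \<Rightarrow> bool) \<Rightarrow> 'b set \<Rightarrow> ('b tensor \<Rightarrow> 'b tensor) set" where
  "vector_fields p S = {\<xi> \<in> extensional (tensors S).
     \<exists>\<xi>0 \<xi>1. super_derivation p S False \<xi>0 \<and> super_derivation p S True \<xi>1 \<and>
       (\<forall>f\<in>tensors S. \<xi> f = (\<lambda>u. \<xi>0 f u + \<xi>1 f u))}"

definition contraction ::
    "('b \<Rightarrow> bool) \<Rightarrow> 'b set \<Rightarrow> ('b tensor \<Rightarrow> 'b tensor) \<Rightarrow> 'b form \<Rightarrow> 'b form" where
  "contraction p S \<xi> = derivation_ext (fpar p) (S <+> S)
     (case_sum (\<lambda>b u. 0) (\<lambda>b. emb (\<xi> (single [b]))))"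

definition lie_derivative ::
    "('b \<Rightarrow> bool) \<Rightarrow> 'b set \<Rightarrow> bool \<Rightarrow> ('b tensor \<Rightarrow> 'b tensor) \<Rightarrow> 'b form \<Rightarrow> 'b form" where
  "lie_derivative p S q \<xi> = derivation_ext (fpar p) (S <+> S)
     (case_sum (\<lambda>b. emb (\<xi> (single [b])))
               (\<lambda>b u. psign q * dform p S (emb (\<xi> (single [b]))) u))"

text \<open>The map between quotient spaces induced by a map \<open>T\<close> of representatives, with classes in
  the target given by \<open>cls\<close>: all \<open>cls (T f)\<close> with \<open>f \<in> C\<close> coincide.\<close>

definition on_classes :: "('y \<Rightarrow> 'z set) \<Rightarrow> ('x \<Rightarrow> 'y) \<Rightarrow> 'x set \<Rightarrow> 'z set" where
  "on_classes cls T C = (\<Union>f\<in>C. cls (T f))"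

definition Theta :: "'b tensor \<Rightarrow> 'b form" where
  "Theta f u = (case u of [] \<Rightarrow> 0 | c # v \<Rightarrow>
     if \<not> isl c \<and> list_all isl v then f (projr c # map projl v) else 0)"

definition closed_form :: "('b \<Rightarrow> bool) \<Rightarrow> 'b set \<Rightarrow> nat \<Rightarrow> 'b form set \<Rightarrow> bool" where
  "closed_form p S n \<omega> \<longleftrightarrow>
     on_classes (dr_class p S (Suc n)) (dform p S) \<omega> = dr_class p S (Suc n) (\<lambda>u. 0)"

definition symplectic_form :: "('b \<Rightarrow> bool) \<Rightarrow> 'b set \<Rightarrow> 'b form set \<Rightarrow> bool" where
  "symplectic_form p S \<omega> \<longleftrightarrow> \<omega> \<in> DR p S 2 \<and> closed_form p S 2 \<omega> \<and>
     bij_betw (\<lambda>\<xi>. on_classes (dr_class p S 1) (contraction p S \<xi>) \<omega>)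
       (vector_fields p S) (DR p S 1)"

definition even_form :: "('b \<Rightarrow> bool) \<Rightarrow> 'b form set \<Rightarrow> bool" where
  "even_form p \<omega> \<longleftrightarrow> (\<exists>f\<in>\<omega>. \<forall>u. f u \<noteq> 0 \<longrightarrow> \<not> wpar (fpar p) u)"

text \<open>The order of an \<open>n\<close>-form is its tensor length minus \<open>n\<close>.\<close>

definition order_zero :: "nat \<Rightarrow> 'b form set \<Rightarrow> bool" where
  "order_zero n \<omega> \<longleftrightarrow> (\<exists>f\<in>\<omega>. \<forall>u. f u \<noteq> 0 \<longrightarrow> length u = n)"

text \<open>The isomorphism \<open>\<Upsilon>\<close> from closed 2-forms, determined by \<open>\<Upsilon> (d (\<Theta> y)) = (1 - z) y\<close>.\<close>

definition Upsilon :: "('b \<Rightarrow> bool) \<Rightarrow> 'b set \<Rightarrow> 'b form set \<Rightarrow> 'b tensor" where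
  "Upsilon p S \<omega> = one_minus_z p (SOME y. y \<in> tensors S \<and> y [] = 0 \<and>
     dr_class p S 2 (dform p S (Theta y)) = \<omega>)"


section \<open>Symplectic A-infinity algebras\<close>

text \<open>\<open>basis A\<close> is a homogeneous basis \<open>(e\<^sub>b)\<close> of \<open>U\<close> with parity \<open>upar A\<close>.  The corresponding bases
  of \<open>\<Pi>U\<close> and \<open>\<Pi>U\<^sup>*\<close>, which are dual to each other, have the opposite parity \<open>wparity A\<close>.\<close>

record 'b ainf =
  basis :: "'b set"
  upar :: "'b \<Rightarrow> bool"
  mfield :: "'b tensor \<Rightarrow> 'b tensor"
  omega :: "'b form set"

definition wparity :: "'b ainf \<Rightarrow> 'b \<Rightarrow> bool" where
  "wparity A b = (\<not> upar A b)"

definition symplectic_ainf :: "'b ainf \<Rightarrow> bool" where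
  "symplectic_ainf A \<longleftrightarrow> (let p = wparity A; S = basis A; m = mfield A; \<omega> = omega A in
     finite S \<and> symplectic_form p S \<omega> \<and>
     m \<in> extensional (tensors S) \<and> super_derivation p S True m \<and>
     on_classes (dr_class p S 2) (lie_derivative p S True m) \<omega> = dr_class p S 2 (\<lambda>u. 0) \<and>
     (\<forall>b\<in>S. m (single [b]) [] = 0) \<and>
     (\<forall>f\<in>tensors S. m (m f) = (\<lambda>u. 0)))"

definition minimal_ainf :: "'b ainf \<Rightarrow> bool" where
  "minimal_ainf A \<longleftrightarrow> (\<forall>b\<in>basis A. \<forall>c\<in>basis A. mfield A (single [b]) [c] = 0)"

text \<open>\<open>h\<close> is the class of a formal sum of cyclic words of length at least 2.\<close>

definition is_hamiltonian :: "'b ainf \<Rightarrow> 'b tensor set \<Rightarrow> bool" where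
  "is_hamiltonian A h \<longleftrightarrow> (let p = wparity A; S = basis A in
     (\<exists>f\<in>tensors S. (\<forall>u. length u < 2 \<longrightarrow> f u = 0) \<and> h = cyc_class p S f) \<and>
     on_classes (dr_class p S 1) (\<lambda>f. dform p S (emb f)) h =
     on_classes (dr_class p S 1) (contraction p S (mfield A)) (omega A))"

text \<open>The form on \<open>\<Pi>U\<close>: the value of the tensor \<open>\<Upsilon> \<omega>\<close> on \<open>e\<^sub>a, e\<^sub>b\<close>.\<close>

definition bform :: "'b ainf \<Rightarrow> 'b \<Rightarrow> 'b \<Rightarrow> complex" where
  "bform A a b = evsign (wparity A) [a, b] * Upsilon (wparity A) (basis A) (omega A) [a, b]"

text \<open>The inverse form on \<open>\<Pi>U\<^sup>*\<close>.  The sign is that of the canonical identification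
  \<open>x \<mapsto> (f \<mapsto> (-1)\<^bsup>|x||f|\<^esup> f x)\<close> of \<open>\<Pi>U\<close> with its double dual.\<close>

definition inv_bform :: "'b ainf \<Rightarrow> 'b \<Rightarrow> 'b \<Rightarrow> complex" where
  "inv_bform A = (THE g. (\<forall>a b. g a b \<noteq> 0 \<longrightarrow> a \<in> basis A \<and> b \<in> basis A) \<and>
     (\<forall>a\<in>basis A. \<forall>c\<in>basis A. (\<Sum>b\<in>basis A. bform A a b * g b c) =
        (if a = c then psign (wparity A a) else 0)))"

text \<open>The coefficient of \<open>e\<^sub>b\<close> in \<open>m\<^sub>k (e\<^sub>u)\<close> for a word \<open>u\<close> of length \<open>k\<close>: the vector field is dual to
  the maps \<open>m\<^sub>k\<close> in the sense that \<open>m f = (-1)\<^bsup>|m||f|\<^esup> \<Sum>k. f \<circ> m\<^sub>k\<close>.\<close>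

definition m_component :: "'b ainf \<Rightarrow> 'b list \<Rightarrow> 'b \<Rightarrow> complex" where
  "m_component A u b =
     psign (wparity A b) * evsign (wparity A) u * mfield A (single [b]) u"

definition h_value :: "'b ainf \<Rightarrow> 'b list \<Rightarrow> complex" where
  "h_value A u = (\<Sum>b\<in>basis A. m_component A (butlast u) b * bform A b (last u))"

definition h_tensor :: "'b ainf \<Rightarrow> nat \<Rightarrow> 'b tensor" where
  "h_tensor A k u =
     (if length u = k \<and> u \<in> lists (basis A) then evsign (wparity A) u * h_value A u else 0)"


section \<open>Ribbon graphs\<close>

text \<open>The cyclic orderings are given by the successor permutation \<open>next_he\<close> of the half-edges.  The
  data for an orientation are an ordering of the vertices and a set of ordered pairs containing
  each edge in exactly one of its two directions; an orientation is an equivalence class.\<close>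

type_synonym 'h ordering = "'h set list \<times> ('h \<times> 'h) set"

record 'h graph =
  half_edges :: "'h set"
  verts :: "'h set set"
  edges :: "'h set set"
  next_he :: "'h \<Rightarrow> 'h"
  orient :: "'h ordering set"

definition ribbon_graph :: "'h graph \<Rightarrow> bool" where
  "ribbon_graph \<Gamma> \<longleftrightarrow> finite (half_edges \<Gamma>) \<and>
     partition_on (half_edges \<Gamma>) (verts \<Gamma>) \<and> (\<forall>v\<in>verts \<Gamma>. card v \<ge> 3) \<and>
     partition_on (half_edges \<Gamma>) (edges \<Gamma>) \<and> (\<forall>e\<in>edges \<Gamma>. card e = 2) \<and>
     next_he \<Gamma> permutes half_edges \<Gamma> \<and> (\<forall>v\<in>verts \<Gamma>. cyclic_on (next_he \<Gamma>) v)"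

definition orderings :: "'h graph \<Rightarrow> 'h ordering set" where
  "orderings \<Gamma> = {(vs, es). distinct vs \<and> set vs = verts \<Gamma> \<and>
     (\<forall>(a, b)\<in>es. {a, b} \<in> edges \<Gamma>) \<and> (\<forall>e\<in>edges \<Gamma>. \<exists>!x. x \<in> es \<and> {fst x, snd x} = e)}"

definition orient_rel :: "'h graph \<Rightarrow> ('h ordering \<times> 'h ordering) set" where
  "orient_rel \<Gamma> = {((vs, es), (vs', es')).
     (vs, es) \<in> orderings \<Gamma> \<and> (vs', es') \<in> orderings \<Gamma> \<and>
     (\<exists>\<pi>. \<pi> permutes {..<length vs} \<and> vs' = permute_list \<pi> vs \<and>
        sign \<pi> * (- 1) ^ card (es - es') = 1)}"

definition oriented_ribbon_graph :: "'h graph \<Rightarrow> bool" where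
  "oriented_ribbon_graph \<Gamma> \<longleftrightarrow> ribbon_graph \<Gamma> \<and> orient \<Gamma> \<in> orderings \<Gamma> // orient_rel \<Gamma>"

definition graph_iso :: "('h \<Rightarrow> 'h) \<Rightarrow> 'h graph \<Rightarrow> 'h graph \<Rightarrow> bool" where
  "graph_iso f \<Gamma> \<Gamma>' \<longleftrightarrow> bij_betw f (half_edges \<Gamma>) (half_edges \<Gamma>') \<and>
     (\<lambda>v. f ` v) ` verts \<Gamma> = verts \<Gamma>' \<and> (\<lambda>e. f ` e) ` edges \<Gamma> = edges \<Gamma>' \<and>
     (\<forall>x\<in>half_edges \<Gamma>. f (next_he \<Gamma> x) = next_he \<Gamma>' (f x)) \<and>
     (\<lambda>(vs, es). (map (\<lambda>v. f ` v) vs, map_prod f f ` es)) ` orient \<Gamma> = orient \<Gamma>'"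

definition Aut :: "'h graph \<Rightarrow> ('h \<Rightarrow> 'h) set" where
  "Aut \<Gamma> = {f. f permutes half_edges \<Gamma> \<and> graph_iso f \<Gamma> \<Gamma>}"

text \<open>A fully ordered graph: the half-edges listed vertex by vertex, and the directed edges.\<close>

type_synonym 'h ordered_graph = "'h list list \<times> ('h \<times> 'h) set"

definition represents :: "'h ordered_graph \<Rightarrow> 'h graph \<Rightarrow> bool" where
  "represents \<G> \<Gamma> \<longleftrightarrow> (case \<G> of (vss, es) \<Rightarrow>
     distinct (concat vss) \<and> set (concat vss) = half_edges \<Gamma> \<and>
     (\<forall>hs\<in>set vss. \<forall>i<length hs. next_he \<Gamma> (hs ! i) = hs ! (Suc i mod length hs)) \<and>
     (map set vss, es) \<in> orient \<Gamma>)"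

definition representative :: "'h graph \<Rightarrow> 'h ordered_graph" where
  "representative \<Gamma> = (SOME \<G>. represents \<G> \<Gamma>)"

definition graph_type :: "'h ordered_graph \<Rightarrow> nat list" where
  "graph_type \<G> = map length (fst \<G>)"

text \<open>The chords \<open>(i\<^sub>1, j\<^sub>1), \<dots>, (i\<^sub>k, j\<^sub>k)\<close>, with half-edges numbered from \<open>0\<close>, are enumerated by
  increasing \<open>i\<^sub>r\<close>; the enumeration is immaterial because the forms are even.\<close>

definition chord_diagram :: "'h ordered_graph \<Rightarrow> (nat \<times> nat) list" where
  "chord_diagram \<G> = (let hs = concat (fst \<G>) in
     [(i, THE j. j < length hs \<and> (hs ! i, hs ! j) \<in> snd \<G>).
        i \<leftarrow> [0..<length hs], hs ! i \<in> fst ` snd \<G>])"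

definition chord_perm :: "(nat \<times> nat) list \<Rightarrow> nat \<Rightarrow> nat" where
  "chord_perm c x = (let l = concat (map (\<lambda>(i, j). [i, j]) c) in
     if x \<in> set l then (THE q. q < length l \<and> l ! q = x) else x)"

fun pair_prod :: "('c \<Rightarrow> 'c \<Rightarrow> complex) \<Rightarrow> 'c list \<Rightarrow> complex" where
  "pair_prod g (x # y # u) = g x y * pair_prod g u"
| "pair_prod g u = 1"

text \<open>For tensors of even length with finitely many non-zero coefficients.\<close>

definition kappa :: "('c \<Rightarrow> 'c \<Rightarrow> complex) \<Rightarrow> 'c tensor \<Rightarrow> complex" where
  "kappa g f = (\<Sum>u | f u \<noteq> 0. f u * pair_prod g u)"

text \<open>The graph space: finite formal combinations of oriented ribbon graphs modulo isomorphism and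
  \<open>(\<Gamma>, -\<sigma>) = -(\<Gamma>, \<sigma>)\<close>, together with the linear functional induced by a function on oriented
  ribbon graphs which respects these relations.\<close>

definition graph_chains :: "('h graph \<Rightarrow> complex) set" where
  "graph_chains = {g. finite {\<Gamma>. g \<Gamma> \<noteq> 0} \<and> (\<forall>\<Gamma>. g \<Gamma> \<noteq> 0 \<longrightarrow> oriented_ribbon_graph \<Gamma>)}"

definition graph_relations :: "('h graph \<Rightarrow> complex) set" where
  "graph_relations =
    {(\<lambda>\<Delta>. single \<Gamma> \<Delta> - single \<Gamma>' \<Delta>) | \<Gamma> \<Gamma>'.
       oriented_ribbon_graph \<Gamma> \<and> oriented_ribbon_graph \<Gamma>' \<and> (\<exists>f. graph_iso f \<Gamma> \<Gamma>')} \<union>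
    {(\<lambda>\<Delta>. single \<Gamma> \<Delta> + single (\<Gamma>\<lparr>orient := \<sigma>\<rparr>) \<Delta>) | \<Gamma> \<sigma>.
       oriented_ribbon_graph \<Gamma> \<and> oriented_ribbon_graph (\<Gamma>\<lparr>orient := \<sigma>\<rparr>) \<and> \<sigma> \<noteq> orient \<Gamma>}"

definition graph_class :: "('h graph \<Rightarrow> complex) \<Rightarrow> ('h graph \<Rightarrow> complex) set" where
  "graph_class g = {g' \<in> graph_chains. (\<lambda>\<Gamma>. g' \<Gamma> - g \<Gamma>) \<in> cspan graph_relations}"

definition graph_space :: "('h graph \<Rightarrow> complex) set set" where
  "graph_space = graph_class ` graph_chains"

definition graph_functional :: "('h graph \<Rightarrow> complex) \<Rightarrow> ('h graph \<Rightarrow> complex) set \<Rightarrow> complex" where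
  "graph_functional F C = (let g = (SOME g. g \<in> C) in \<Sum>\<Gamma> | g \<Gamma> \<noteq> 0. g \<Gamma> * F \<Gamma>)"


section \<open>Relative Chevalley-Eilenberg chains\<close>

text \<open>The basis of the union over \<open>n, m\<close> of the spaces \<open>\<complex>\<^bsup>2n|m\<^esup>\<close>; \<open>letters n m\<close> is that of
  \<open>\<complex>\<^bsup>2n|m\<^esup>\<close>.\<close>

datatype letter = P nat | Q nat | X nat

definition letters :: "nat \<Rightarrow> nat \<Rightarrow> letter set" where
  "letters n m = P ` {..<n} \<union> Q ` {..<n} \<union> X ` {..<m}"

definition lpar :: "letter \<Rightarrow> bool" where
  "lpar c = (case c of X _ \<Rightarrow> True | _ \<Rightarrow> False)"

fun lform :: "letter \<Rightarrow> letter \<Rightarrow> complex" where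
  "lform (P i) (Q j) = (if i = j then 1 else 0)"
| "lform (Q i) (P j) = (if i = j then - 1 else 0)"
| "lform (X i) (X j) = (if i = j then 1 else 0)"
| "lform _ _ = 0"

text \<open>A tensor representing \<open>{a, b}\<close> in the coinvariants; the places \<open>i\<close>, \<open>j\<close> count from \<open>0\<close>.\<close>

definition bracket :: "letter list \<Rightarrow> letter list \<Rightarrow> letter tensor" where
  "bracket a b u = (\<Sum>i<length a. \<Sum>j<length b.
     psign (lpar (a ! i) \<and> wpar lpar (drop (Suc i) a @ take j b)) * lform (a ! i) (b ! j) *
     tmult (act lpar (zperm (length a - 1) ^^ i) (single (take i a @ drop (Suc i) a)))
           (act lpar (zperm (length b - 1) ^^ j) (single (take j b @ drop (Suc j) b))) u)"

text \<open>A word of words \<open>[w\<^sub>1, \<dots>, w\<^sub>i]\<close> stands for \<open>w\<^sub>1 \<otimes> \<dots> \<otimes> w\<^sub>i\<close> in the tensor algebra of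
  the tensor algebra, where \<open>w\<^sub>r\<close> has parity \<open>wpar lpar w\<^sub>r\<close>.\<close>

type_synonym chain = "letter list list \<Rightarrow> complex"

definition chain_words :: "nat \<Rightarrow> nat \<Rightarrow> nat \<Rightarrow> nat \<Rightarrow> letter list list set" where
  "chain_words n m i l = {ws. length ws = i \<and> sum_list (map length ws) = l \<and>
     (\<forall>w\<in>set ws. length w \<ge> 3 \<and> w \<in> lists (letters n m))}"

text \<open>\<open>w\<^sub>1 \<otimes> \<dots> \<otimes> f \<otimes> \<dots> \<otimes> w\<^sub>i\<close> with the tensor \<open>f\<close> in place of \<open>w\<^sub>r\<close>.\<close>

definition in_slot :: "letter list list \<Rightarrow> nat \<Rightarrow> letter tensor \<Rightarrow> chain" where
  "in_slot ws r f vs = (if vs[r := ws ! r] = ws then f (vs ! r) else 0)"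

definition cyclic_relations :: "nat \<Rightarrow> nat \<Rightarrow> nat \<Rightarrow> nat \<Rightarrow> chain set" where
  "cyclic_relations n m i l = {in_slot ws r (one_minus_z lpar (single (ws ! r))) | ws r.
     ws \<in> chain_words n m i l \<and> r < i}"

definition exterior_relations :: "nat \<Rightarrow> nat \<Rightarrow> nat \<Rightarrow> nat \<Rightarrow> chain set" where
  "exterior_relations n m i l =
    {(\<lambda>vs. single ws vs + psign (wpar lpar (ws ! r) \<and> wpar lpar (ws ! Suc r)) *
         single (ws[r := ws ! Suc r, Suc r := ws ! r]) vs) | ws r.
       ws \<in> chain_words n m i l \<and> Suc r < i}"

text \<open>The action on \<open>w\<^sub>1 \<otimes> \<dots> \<otimes> w\<^sub>i\<close> of the element of \<open>osp\<close> given by a word \<open>q\<close> of length 2.\<close>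

definition osp_action :: "letter list \<Rightarrow> letter list list \<Rightarrow> chain" where
  "osp_action q ws vs = (\<Sum>r<length ws.
     psign (wpar lpar q \<and> wpar lpar (concat (take r ws))) *
     in_slot ws r (bracket q (ws ! r)) vs)"

definition osp_relations :: "nat \<Rightarrow> nat \<Rightarrow> nat \<Rightarrow> nat \<Rightarrow> chain set" where
  "osp_relations n m i l = {osp_action q ws | q ws.
     length q = 2 \<and> q \<in> lists (letters n m) \<and> ws \<in> chain_words n m i l}"

text \<open>The space \<open>C\<^sub>i\<^sub>j\<close> with \<open>j = l / 2\<close>.  At level \<open>(n, m)\<close> it is the quotient of the span of
  \<open>chain_words n m i l\<close> by the cyclic, exterior and \<open>osp\<close>-relations.  The transition maps of the
  direct system are induced by the inclusions of letters, so the direct limit is the union of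
  the spaces of representatives modulo the union of the spaces of relations.\<close>

definition chains :: "nat \<Rightarrow> nat \<Rightarrow> chain set" where
  "chains i l = {x. \<exists>n m. \<forall>ws. x ws \<noteq> 0 \<longrightarrow> ws \<in> chain_words n m i l}"

definition chain_relations :: "nat \<Rightarrow> nat \<Rightarrow> chain set" where
  "chain_relations i l = (\<Union>n m. cspan (cyclic_relations n m i l \<union>
     exterior_relations n m i l \<union> osp_relations n m i l))"

definition chain_class :: "nat \<Rightarrow> nat \<Rightarrow> chain \<Rightarrow> chain set" where
  "chain_class i l x = {y \<in> chains i l. (\<lambda>ws. y ws - x ws) \<in> chain_relations i l}"

definition CE_space :: "nat \<Rightarrow> nat \<Rightarrow> chain set set" where
  "CE_space i l = chain_class i l ` chains i l"

text \<open>An element of the completion, the product of all \<open>CE_space i l\<close>.\<close>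

type_synonym completed_chain = "nat \<Rightarrow> nat \<Rightarrow> chain set"


section \<open>Feynman amplitudes, characteristic class and partition function\<close>

fun Nblocks :: "('c \<Rightarrow> bool) \<Rightarrow> ('c list list \<Rightarrow> complex) \<Rightarrow> 'c list list \<Rightarrow> complex" where
  "Nblocks p x [] = x []"
| "Nblocks p x (w # ws) = Ncyc p (\<lambda>v. Nblocks p (\<lambda>vs. x (v # vs)) ws) w"

definition antisym :: "chain \<Rightarrow> chain" where
  "antisym x ws = (\<Sum>\<sigma> | \<sigma> permutes {..<length ws}. of_int (sign \<sigma>) * act (wpar lpar) \<sigma> x ws)"

fun split_word :: "nat list \<Rightarrow> 'c list \<Rightarrow> 'c list list" where
  "split_word [] u = []"
| "split_word (k # ks) u = take k u # split_word ks (drop k u)"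

text \<open>The component of type \<open>(k\<^sub>1, \<dots>, k\<^sub>r)\<close>, as a tensor of length \<open>k\<^sub>1 + \<dots> + k\<^sub>r\<close>.\<close>

definition type_part :: "nat list \<Rightarrow> chain \<Rightarrow> letter tensor" where
  "type_part ks x u = (if length u = sum_list ks then x (split_word ks u) else 0)"

definition beta :: "(nat \<times> nat) list \<Rightarrow> letter tensor \<Rightarrow> complex" where
  "beta c f = kappa lform (act lpar (chord_perm c) f)"

definition amplitude_ordered :: "'h ordered_graph \<Rightarrow> chain \<Rightarrow> complex" where
  "amplitude_ordered \<G> x = beta (chord_diagram \<G>) (type_part (graph_type \<G>) x)"

definition amplitude :: "'h graph \<Rightarrow> chain \<Rightarrow> complex" where
  "amplitude \<Gamma> x = amplitude_ordered (representative \<Gamma>) (antisym (Nblocks lpar x))"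

definition amplitude_class :: "'h graph \<Rightarrow> chain set \<Rightarrow> complex" where
  "amplitude_class \<Gamma> C = amplitude \<Gamma> (SOME x. x \<in> C)"

definition pairing :: "completed_chain \<Rightarrow> 'h graph \<Rightarrow> complex" where
  "pairing c \<Gamma> = (\<Sum>(i, l) | amplitude_class \<Gamma> (c i l) \<noteq> 0. amplitude_class \<Gamma> (c i l)) /
     of_nat (card (Aut \<Gamma>))"

definition canonical_form :: "nat \<Rightarrow> nat \<Rightarrow> letter form" where
  "canonical_form n k u = (\<Sum>i<n. single [Inr (P i), Inr (Q i)] u) +
     (\<Sum>i<k. single [Inr (X i), Inr (X i)] u) / 2"

definition linear_iso ::
    "('c \<Rightarrow> bool) \<Rightarrow> 'c set \<Rightarrow> ('d \<Rightarrow> bool) \<Rightarrow> 'd set \<Rightarrow> ('c \<Rightarrow> 'd \<Rightarrow> complex) \<Rightarrow> bool" where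
  "linear_iso p S p' S' \<phi> \<longleftrightarrow>
     (\<forall>c d. \<phi> c d \<noteq> 0 \<longrightarrow> c \<in> S \<and> d \<in> S' \<and> p c = p' d) \<and>
     bij_betw (\<lambda>f d. \<Sum>c\<in>S. f c * \<phi> c d)
       {f. \<forall>c. f c \<noteq> 0 \<longrightarrow> c \<in> S} {f. \<forall>d. f d \<noteq> 0 \<longrightarrow> d \<in> S'}"

definition form_matrix :: "('c \<Rightarrow> 'd \<Rightarrow> complex) \<Rightarrow> 'c + 'c \<Rightarrow> 'd + 'd \<Rightarrow> complex" where
  "form_matrix \<phi> x y = (case (x, y) of
     (Inl c, Inl d) \<Rightarrow> \<phi> c d | (Inr c, Inr d) \<Rightarrow> \<phi> c d | _ \<Rightarrow> 0)"

text \<open>\<open>\<phi>\<close> is an even linear isomorphism from \<open>\<Pi>U\<^sup>*\<close> to \<open>\<complex>\<^bsup>2n|k\<^esup>\<close> taking \<open>\<omega>\<close> to the canonical form.\<close>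

definition darboux_chart :: "'b ainf \<Rightarrow> nat \<Rightarrow> nat \<Rightarrow> ('b \<Rightarrow> letter \<Rightarrow> complex) \<Rightarrow> bool" where
  "darboux_chart A n k \<phi> \<longleftrightarrow> linear_iso (wparity A) (basis A) lpar (letters n k) \<phi> \<and>
     on_classes (dr_class lpar (letters n k) 2)
       (alg_map (basis A <+> basis A) (form_matrix \<phi>)) (omega A) =
     dr_class lpar (letters n k) 2 (canonical_form n k)"

text \<open>The component of exterior degree \<open>i\<close> and tensor length \<open>l\<close> of \<open>\<Sum>i. 1 / i! h \<and> \<dots> \<and> h\<close>.\<close>

definition exp_part :: "letter tensor \<Rightarrow> nat \<Rightarrow> nat \<Rightarrow> chain" where
  "exp_part h i l ws = (if length ws = i \<and> sum_list (map length ws) = l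
     then prod_list (map h ws) / fact i else 0)"

text \<open>\<open>c\<close> is the characteristic class \<open>c\<^sub>A\<close>, computed from some chart \<open>\<phi>\<close> and from some
  representative \<open>h'\<close>, without terms of length less than 3, of the class \<open>\<phi>\<^sup>*(h)\<close> of the transformed
  Hamiltonian.\<close>

definition characteristic_class :: "'b ainf \<Rightarrow> completed_chain \<Rightarrow> bool" where
  "characteristic_class A c \<longleftrightarrow> (\<exists>n k \<phi> h h'.
     darboux_chart A n k \<phi> \<and> is_hamiltonian A h \<and>
     h' \<in> tensors (letters n k) \<and> (\<forall>u. length u < 3 \<longrightarrow> h' u = 0) \<and>
     cyc_class lpar (letters n k) h' =
       on_classes (cyc_class lpar (letters n k)) (alg_map (basis A) \<phi>) h \<and>
     c = (\<lambda>i l. chain_class i l (exp_part h' i l)))"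

definition partition_function :: "'b ainf \<Rightarrow> 'h graph \<Rightarrow> complex" where
  "partition_function A \<Gamma> = (let \<G> = representative \<Gamma> in
     kappa (inv_bform A) (act (wparity A) (chord_perm (chord_diagram \<G>))
       (foldr tmult (map (h_tensor A) (graph_type \<G>)) (single []))) /
     of_nat (card (Aut \<Gamma>)))"

end

theory Submission
  imports Defs
begin

text \<open>
  Both sides contract a product of tensors along the chords of the graph, but in different
  coordinates.  The partition function contracts the cyclically invariant tensors \<open>h\<^sub>k\<close> with the
  inverse of the symplectic form.  The amplitude of the characteristic class contracts cyclic sums
  \<open>N h'\<close> of the Hamiltonian \<open>h'\<close> in Darboux coordinates with the standard form.

  The bridge is the cyclic sum \<open>N\<close>.  It kills commutators (\<open>Ncyc_comm_closure\<close>), so it can be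
  evaluated on classes of forms of every degree: on 1-forms its value at the words \<open>dx \<cdot> y\<close> is the
  inverse of \<open>\<Theta>\<close>, and on a quadratic 2-form it is the Gram matrix of the form.  In this way the
  equation \<open>dh = i\<^sub>m \<omega>\<close> turns into \<open>N h = \<Sum>k. h\<^sub>k\<close> (\<open>hamiltonian_tensor\<close>), and the statement that a
  chart \<open>\<phi>\<close> takes \<open>\<omega>\<close> to the canonical form turns into a matrix identity \<open>L = \<phi>\<^sup>T G \<phi>\<close>.  Inverting it
  shows that the inverse form is \<open>\<phi> L \<phi>\<^sup>T\<close> (\<open>inverse_pulled_back_form\<close>, \<open>inv_bform_chart\<close>).  A
  parity preserving linear map commutes with permutations of tensor factors (\<open>act_alg_map\<close>), hence
  contracting \<open>\<phi>\<close> of a tensor with the standard form is contracting the tensor with the inverse form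
  (\<open>kappa_alg_map\<close>).

  In the exponential, \<open>N h'\<close> is odd.  Therefore the Koszul sign of a permutation of \<open>r\<close> blocks
  \<open>N h'\<close> cancels its signature, and the antisymmetrisation consists of \<open>r!\<close> equal terms, which
  cancel the coefficient \<open>1 / r!\<close>.  Only the component with one factor per vertex and one letter per
  half-edge meets the graph (\<open>chord_amplitude_exp_part\<close>).

  Finally the amplitude has to be computed from an arbitrary representative of a class of
  relative chains, so it must vanish on all relations (\<open>chord_amplitude_on_relation\<close>).  Cyclic sums
  kill the cyclic relations and antisymmetrisation kills the exterior relations.  For the
  \<open>osp\<close>-relations, the bracket with a quadratic word agrees, up to cyclic rotation, with the super
  derivation extending a linear map \<open>X\<close> of the letters (\<open>Ncyc_bracket\<close>).  Super derivations commute
  with permutations of tensor factors (\<open>act_der\<close>), and this applies twice: to words of letters,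
  which gives the cyclic sums, and to words of words, which gives the antisymmetrisation.  So the
  derivation can be moved to the contraction, which it annihilates because \<open>X\<close> preserves the
  form (\<open>lform_invariant\<close>, \<open>der_pair_prod\<close>).
\<close>

section \<open>Koszul signs\<close>

lemma psign_sq [simp]: "psign b * psign b = 1"
  by (simp add: psign_def)

lemma psign_sq_left [simp]: "psign b * (psign b * x) = x"
  by (simp add: psign_def)

lemma psign_False [simp]: "psign False = 1"
  by (simp add: psign_def)

lemma wpar_Nil [simp]: "wpar p [] = False"
  by (simp add: wpar_def)

lemma wpar_Cons [simp]: "wpar p (c # w) = (p c \<noteq> wpar p w)"
  by (simp add: wpar_def)

lemma wpar_append [simp]: "wpar p (u @ v) = (wpar p u \<noteq> wpar p v)"
  by (simp add: wpar_def)

text \<open>A permutation permutes the unordered pairs of places; \<open>min\<close> and \<open>max\<close> restore the order of the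
  two places.\<close>

lemma prod_pairs_permute:
  fixes F :: "nat \<Rightarrow> nat \<Rightarrow> complex"
  assumes s: "\<sigma> permutes {..<n}" and F: "\<And>i j. F i j = F j i"
  shows "(\<Prod>(i, j)\<in>{(i, j). i < j \<and> j < n}. F (\<sigma> i) (\<sigma> j)) =
         (\<Prod>(i, j)\<in>{(i, j). i < j \<and> j < n}. F i j)"
proof -
  let ?h = "\<lambda>\<pi> (i, j). (min (\<pi> i) (\<pi> j), max (\<pi> i) (\<pi> j))"
  have inj: "\<sigma> i = \<sigma> j \<longleftrightarrow> i = j" for i j
    using permutes_inj[OF s] by (auto dest: injD)
  have inj': "inv \<sigma> i = inv \<sigma> j \<longleftrightarrow> i = j" for i j
    using permutes_inj[OF permutes_inv[OF s]] by (auto dest: injD)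
  have lt: "\<sigma> i < n \<longleftrightarrow> i < n" for i using permutes_in_image[OF s, of i] by simp
  have lt': "inv \<sigma> i < n \<longleftrightarrow> i < n" for i
    using permutes_in_image[OF permutes_inv[OF s], of i] by simp
  have i1: "\<sigma> (inv \<sigma> i) = i" "inv \<sigma> (\<sigma> i) = i" for i
    using permutes_inverses[OF s] by auto
  have st: "\<sigma> i < \<sigma> j" if "i < j" "\<sigma> i \<le> \<sigma> j" for i j
    using that inj[of i j] by linarith
  have st': "inv \<sigma> i < inv \<sigma> j" if "i < j" "inv \<sigma> i \<le> inv \<sigma> j" for i j
    using that inj'[of i j] by linarith
  show ?thesis
    by (rule prod.reindex_bij_witness[where i = "?h (inv \<sigma>)" and j = "?h \<sigma>"])
      (clarsimp simp: min_def max_def i1 lt lt' st st' not_le F; fail)+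
qed

lemma koszul_alt:
  "koszul p \<sigma> v = (\<Prod>(i, j)\<in>{(i, j). i < j \<and> j < length v}.
     if \<sigma> i > \<sigma> j then psign (p (v ! i) \<and> p (v ! j)) else 1)"
proof -
  have fin: "finite {(i, j). i < j \<and> j < length v}"
    by (rule finite_subset[of _ "{..<length v} \<times> {..<length v}"]) auto
  show ?thesis unfolding koszul_def
    by (rule prod.mono_neutral_cong_left[OF fin]) (auto split: if_splits)
qed

text \<open>A pair of places is inverted by \<open>\<sigma> \<circ> \<tau>\<close> iff it is inverted by exactly one of \<open>\<tau>\<close> and, after
  \<open>\<tau>\<close>, by \<open>\<sigma>\<close>; a pair inverted by both contributes a square.  This is what makes \<open>act\<close> an action.\<close>

lemma koszul_compose:
  assumes s: "\<sigma> permutes {..<length v}" and t: "\<tau> permutes {..<length v}"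
  shows "koszul p (\<sigma> \<circ> \<tau>) (permute_list \<tau> v) =
    koszul p \<sigma> v * koszul p \<tau> (permute_list \<tau> v)"
proof -
  define F where "F i j = (if (i < j \<and> \<sigma> i > \<sigma> j) \<or> (j < i \<and> \<sigma> j > \<sigma> i)
    then psign (p (v ! i) \<and> p (v ! j)) else 1)" for i j
  let ?P = "{(i, j). i < j \<and> j < length v}"
  have "koszul p \<sigma> v = (\<Prod>(i, j)\<in>?P. F i j)"
    unfolding koszul_alt F_def by (intro prod.cong) auto
  also have "\<dots> = (\<Prod>(i, j)\<in>?P. F (\<tau> i) (\<tau> j))"
    by (rule prod_pairs_permute[OF t, symmetric]) (auto simp: F_def conj_commute)
  finally have 1: "koszul p \<sigma> v = (\<Prod>(i, j)\<in>?P. F (\<tau> i) (\<tau> j))" .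
  have inj: "\<sigma> i = \<sigma> j \<longleftrightarrow> i = j" "\<tau> i = \<tau> j \<longleftrightarrow> i = j" for i j
    using permutes_inj[OF s] permutes_inj[OF t] by (auto dest: injD)
  show ?thesis
    unfolding 1 unfolding koszul_alt prod.distrib[symmetric] length_permute_list
    by (rule prod.cong) (auto simp: F_def permute_list_nth[OF t] inj not_less_iff_gr_or_eq)
qed

lemma act_compose:
  assumes "\<sigma> permutes {..<length u}" "\<tau> permutes {..<length u}"
  shows "act p \<sigma> (act p \<tau> f) u = act p (\<sigma> \<circ> \<tau>) f u"
  using koszul_compose[of \<sigma> "permute_list \<sigma> u" \<tau> p] assms
  by (simp add: act_def permute_list_compose)

lemma koszul_id: "koszul p id v = 1"
  unfolding koszul_alt by (rule prod.neutral) auto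

lemma koszul_cong_par:
  assumes "\<And>i. i < length v \<Longrightarrow> p (v ! i) = p' (w ! i)" "length v = length w"
  shows "koszul p \<sigma> v = koszul p' \<sigma> w"
  unfolding koszul_alt assms(2)[symmetric] by (rule prod.cong) (auto simp: assms)

lemma wpar_alt: "wpar p w = odd (card {i. i < length w \<and> p (w ! i)})"
  by (simp add: wpar_def length_filter_conv_card)

text \<open>On odd letters the Koszul sign is a homomorphism to the signs.  All transpositions are
  conjugate, so its value at the adjacent transposition of the places 0 and 1 determines it.\<close>

lemma koszul_all_odd:
  assumes s: "\<sigma> permutes {..<length v}" and odd: "\<And>c. c \<in> set v \<Longrightarrow> p c"
  shows "koszul p \<sigma> v = of_int (sign \<sigma>)"
proof -
  define n where "n = length v"
  define k where "k \<sigma> = koszul (\<lambda>_. True) \<sigma> (replicate n ())" for \<sigma>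
  have k: "koszul p \<sigma> v = k \<sigma>" for \<sigma>
    unfolding k_def by (rule koszul_cong_par) (auto simp: n_def odd)
  have comp: "k (\<sigma> \<circ> \<tau>) = k \<sigma> * k \<tau>" if "\<sigma> permutes {..<n}" "\<tau> permutes {..<n}" for \<sigma> \<tau>
  proof -
    have "permute_list \<tau> (replicate n ()) = replicate n ()"
      by (rule nth_equalityI) auto
    then show ?thesis
      using koszul_compose[of \<sigma> "replicate n ()" \<tau> "\<lambda>_. True"] that unfolding k_def by simp
  qed
  have id: "k id = 1" by (simp add: k_def koszul_id)
  have adj: "k (transpose 0 1) = -1" if "1 < n"
  proof -
    have "{(i, j). i < j \<and> j < n \<and> transpose 0 1 j < (transpose 0 1 i :: nat)} = {(0, 1)}"
    proof (intro equalityI subsetI)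
      fix x assume "x \<in> {(i, j). i < j \<and> j < n \<and> transpose 0 1 j < (transpose 0 1 i :: nat)}"
      then obtain i j where x: "x = (i, j)" "i < j" "transpose 0 1 j < (transpose 0 1 i :: nat)" by auto
      then show "x \<in> {(0, 1)}"
        by (cases "i = 0"; cases "i = 1"; cases "j = 1") (simp_all add: transpose_def)
    qed (use that in auto)
    then show ?thesis by (simp add: k_def koszul_def psign_def)
  qed
  have tr: "k (transpose a b) = -1" if ab: "a < n" "b < n" "a \<noteq> b" for a b
  proof -
    have n: "1 < n" using ab by linarith
    \<comment> \<open>a permutation conjugating \<open>(0 1)\<close> to \<open>(a b)\<close>\<close>
    obtain \<pi> where pi: "\<pi> permutes {..<n}" "\<pi> 0 = a" "\<pi> 1 = b"
    proof -
      define \<rho> where "\<rho> = transpose (transpose 0 a 1) b \<circ> transpose 0 a"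
      have "transpose 0 a 1 < n" using n ab by (auto simp: transpose_def)
      then have "\<rho> permutes {..<n}" unfolding \<rho>_def
        using n ab by (intro permutes_compose permutes_swap_id) auto
      moreover have "\<rho> 0 = a" "\<rho> 1 = b" using ab by (auto simp: \<rho>_def transpose_def)
      ultimately show ?thesis using that by blast
    qed
    have ip: "inv \<pi> permutes {..<n}" using pi(1) by (rule permutes_inv)
    have t01: "transpose 0 1 permutes {..<n}" using n by (intro permutes_swap_id) auto
    have inj: "\<pi> x = \<pi> y \<longleftrightarrow> x = y" for x y
      using permutes_inj[OF pi(1)] by (auto dest: injD)
    have "transpose a b (\<pi> y) = \<pi> (transpose 0 1 y)" for y
      using pi(2,3) inj[of y 0] inj[of y 1] by (cases "y = 0"; cases "y = 1") (auto simp: transpose_def)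
    then have "transpose a b \<circ> \<pi> = \<pi> \<circ> transpose 0 1" by auto
    then have "transpose a b \<circ> (\<pi> \<circ> inv \<pi>) = \<pi> \<circ> transpose 0 1 \<circ> inv \<pi>"
      by (simp add: comp_assoc[symmetric])
    then have "transpose a b = (\<pi> \<circ> transpose 0 1) \<circ> inv \<pi>"
      using permutes_inv_o(1)[OF pi(1)] by simp
    then have "k (transpose a b) = k \<pi> * k (transpose 0 1) * k (inv \<pi>)"
      using comp[OF permutes_compose[OF t01 pi(1)] ip] comp[OF pi(1) t01] by simp
    moreover have "k \<pi> * k (inv \<pi>) = 1"
      using comp[OF pi(1) ip] id permutes_inv_o(1)[OF pi(1)] by simp
    ultimately show ?thesis using adj[OF n] by (simp add: mult.commute mult.left_commute)
  qed
  have "k \<sigma> = of_int (sign \<sigma>)" if "\<sigma> permutes {..<n}" for \<sigma>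
  proof -
    have fin: "finite {..<n}" by simp
    from that fin show ?thesis
    proof (induction rule: permutes_induct)
      case id then show ?case by (simp add: \<open>k id = 1\<close> id_def[symmetric])
    next
      case (swap a b q)
      have q: "q permutes {..<n}" using swap by auto
      have t: "transpose a b permutes {..<n}" using swap by (intro permutes_swap_id) auto
      have "permutation q" "permutation (transpose a b)"
        using q t permutation_permutes finite_lessThan by blast+
      then have "sign (transpose a b \<circ> q) = - sign q"
        using swap by (simp add: sign_compose sign_swap_id)
      then have "k (transpose a b \<circ> q) = of_int (sign (transpose a b \<circ> q))"
        using swap comp[OF t q] tr[of a b] by simp
      then show ?case by (simp add: o_def)
    qed
  qed
  then show ?thesis using k s unfolding n_def by simp
qed

section \<open>Cyclic rotations\<close>

lemma psign_wpar_prod: "(\<Prod>j<length y. psign (b \<and> p (y ! j))) = psign (b \<and> wpar p y)"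
proof (induction y)
  case (Cons c y)
  then show ?case
    by (simp add: prod.lessThan_Suc_shift psign_def del: prod.lessThan_Suc)
qed simp

lemma psign_wpar_prod_pairs:
  "(\<Prod>i<length x. \<Prod>j<length y. psign (p (x ! i) \<and> p (y ! j))) = psign (wpar p x \<and> wpar p y)"
proof -
  have "(\<Prod>i<length x. psign (wpar p y \<and> p (x ! i))) = psign (wpar p y \<and> wpar p x)"
    by (rule psign_wpar_prod)
  then show ?thesis by (simp add: psign_wpar_prod conj_commute)
qed

lemma zperm_permutes: "zperm n permutes {..<n}"
proof (rule bij_imp_permutes)
  show "bij_betw (zperm n) {..<n} {..<n}"
    by (rule bij_betwI[where g = "\<lambda>i. Suc i mod n"]) (auto simp: zperm_def mod_Suc split: if_splits)
qed (auto simp: zperm_def)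

lemma zperm_funpow_permutes: "(zperm n ^^ r) permutes {..<n}"
proof (induction r)
  case (Suc r)
  show ?case unfolding funpow.simps by (rule permutes_compose[OF Suc zperm_permutes])
qed (simp add: permutes_id id_def[symmetric])

lemma zperm_funpow: "i < n \<Longrightarrow> r \<le> n \<Longrightarrow> (zperm n ^^ r) i = (i + (n - r)) mod n"
proof (induction r)
  case (Suc r)
  then have 1: "(zperm n ^^ r) i = (i + (n - r)) mod n" by simp
  have 2: "i + (n - r) = Suc (i + (n - Suc r))" using Suc.prems by linarith
  have n: "n > 0" using Suc.prems by simp
  have "zperm n (Suc x mod n) = x mod n" for x
    using n mod_less_divisor[OF n, of x] by (auto simp: zperm_def mod_Suc)
  then show ?case using 1 unfolding 2 by simp
qed simp

lemma permute_list_zperm: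
  assumes "r \<le> length u"
  shows "permute_list (zperm (length u) ^^ r) u = drop (length u - r) u @ take (length u - r) u"
proof (rule nth_equalityI)
  fix i assume "i < length (permute_list (zperm (length u) ^^ r) u)"
  then have i: "i < length u" by simp
  have "permute_list (zperm (length u) ^^ r) u ! i = u ! ((i + (length u - r)) mod length u)"
    using i assms zperm_funpow_permutes by (subst permute_list_nth) (auto simp: zperm_funpow)
  also have "\<dots> = (drop (length u - r) u @ take (length u - r) u) ! i"
    using i assms by (cases "i < r") (auto simp: nth_append mod_if add.commute)
  finally show "permute_list (zperm (length u) ^^ r) u ! i =
      (drop (length u - r) u @ take (length u - r) u) ! i" .
qed auto

text \<open>The inverted pairs of a rotation are those with one place in each of the two blocks that it
  exchanges.\<close>

lemma koszul_zperm:
  "koszul p (zperm (length (x @ y)) ^^ length x) (x @ y) = psign (wpar p x \<and> wpar p y)"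
proof -
  let ?n = "length (x @ y)" and ?r = "length x"
  have z: "(zperm ?n ^^ ?r) i = (if i < ?r then i + length y else i - ?r)" if "i < ?n" for i
    using that by (subst zperm_funpow) (auto simp: mod_if)
  have "{(i, j). i < j \<and> j < ?n \<and> (zperm ?n ^^ ?r) i > (zperm ?n ^^ ?r) j} =
      (\<lambda>(i, j). (i, j + ?r)) ` ({..<length x} \<times> {..<length y})" (is "?A = ?f ` ?B")
  proof (intro equalityI subsetI)
    fix a assume "a \<in> ?A"
    then obtain i j where a: "a = (i, j)" "i < j" "j < ?n"
      "(zperm ?n ^^ ?r) i > (zperm ?n ^^ ?r) j" by auto
    then have "i < ?r" "\<not> j < ?r" using z[of i] z[of j] by (auto split: if_splits)
    then show "a \<in> ?f ` ?B" using a by (intro image_eqI[of _ _ "(i, j - ?r)"]) auto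
  next
    fix a assume "a \<in> ?f ` ?B"
    then obtain i j where "a = (i, j + ?r)" "i < ?r" "j < length y" by auto
    then show "a \<in> ?A" using z[of i] z[of "j + ?r"] by simp
  qed
  moreover have "inj_on ?f ?B" by (auto simp: inj_on_def)
  ultimately have "koszul p (zperm ?n ^^ ?r) (x @ y) =
      (\<Prod>(i, j)\<in>?B. psign (p ((x @ y) ! i) \<and> p ((x @ y) ! (j + ?r))))"
    unfolding koszul_def by (simp add: prod.reindex case_prod_unfold)
  also have "\<dots> = (\<Prod>(i, j)\<in>?B. psign (p (x ! i) \<and> p (y ! j)))"
    by (rule prod.cong) (auto simp: nth_append)
  finally show ?thesis
    by (simp add: prod.cartesian_product[symmetric] psign_wpar_prod_pairs)
qed

lemma act_zperm:
  assumes "s \<le> length u"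
  shows "act p (zperm (length u) ^^ (length u - s)) f u =
    psign (wpar p (take s u) \<and> wpar p (drop s u)) * f (drop s u @ take s u)"
proof -
  have "length (drop s u @ take s u) = length u" "length (drop s u) = length u - s"
    using assms by auto
  then show ?thesis
    using koszul_zperm[of p "drop s u" "take s u"] assms
    by (simp add: act_def permute_list_zperm conj_commute)
qed

text \<open>The form of the cyclic sum used for all computations below: it runs over the ways to cut the
  word in two and exchange the pieces.\<close>

lemma Ncyc_rotations:
  "Ncyc p f u = (\<Sum>s<length u. psign (wpar p (take s u) \<and> wpar p (drop s u)) *
     f (drop s u @ take s u))"
proof -
  let ?n = "length u"
  let ?g = "\<lambda>s. psign (wpar p (take s u) \<and> wpar p (drop s u)) * f (drop s u @ take s u)"
  have "Ncyc p f u = (\<Sum>r<?n. ?g (?n - r))"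
    unfolding Ncyc_def
  proof (rule sum.cong)
    fix r assume "r \<in> {..<?n}"
    then show "act p (zperm ?n ^^ r) f u = ?g (?n - r)"
      using act_zperm[of "?n - r" u p f] by simp
  qed simp
  also have "\<dots> = (\<Sum>s\<in>{1..?n}. ?g s)"
    by (rule sum.reindex_bij_witness[where i = "\<lambda>s. ?n - s" and j = "\<lambda>r. ?n - r"]) auto
  also have "\<dots> = (\<Sum>s<?n. ?g s)"
    by (rule sum.reindex_bij_witness[where i = "\<lambda>s. if s = 0 then ?n else s"
          and j = "\<lambda>s. if s = ?n then 0 else s"]) (auto split: if_splits)
  finally show ?thesis .
qed

text \<open>The generator of the cyclic groups acting on all tensor lengths at once.\<close>

definition rotate_act :: "('c \<Rightarrow> bool) \<Rightarrow> 'c tensor \<Rightarrow> 'c tensor" where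
  "rotate_act p f u = act p (zperm (length u)) f u"

lemma rotate_act_funpow: "(rotate_act p ^^ r) f u = act p (zperm (length u) ^^ r) f u"
proof (induction r arbitrary: u)
  case 0
  then show ?case by (simp add: act_def id_def[symmetric] koszul_id)
next
  case (Suc r)
  have "(rotate_act p ^^ Suc r) f u = act p (zperm (length u)) ((rotate_act p ^^ r) f) u"
    by (simp add: rotate_act_def)
  also have "\<dots> = act p (zperm (length u)) (act p (zperm (length u) ^^ r) f) u"
    by (simp add: act_def Suc)
  also have "\<dots> = act p (zperm (length u) \<circ> zperm (length u) ^^ r) f u"
    by (rule act_compose) (simp_all add: zperm_permutes zperm_funpow_permutes)
  finally show ?case by (simp only: funpow.simps)
qed

lemma Ncyc_funpow: "Ncyc p f u = (\<Sum>r<length u. (rotate_act p ^^ r) f u)"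
  by (simp add: Ncyc_def rotate_act_funpow)

lemma rotate_act_funpow_length: "(rotate_act p ^^ length u) f u = f u"
  using act_zperm[of 0 u p f] by (simp add: rotate_act_funpow)

lemma sum_shift_cyclic:
  fixes g :: "nat \<Rightarrow> complex"
  assumes "g n = g 0"
  shows "(\<Sum>r<n. g (Suc r)) = (\<Sum>r<n. g r)"
proof (cases n)
  case (Suc m)
  have "(\<Sum>r<n. g (Suc r)) + g 0 = (\<Sum>r<n. g r) + g n"
    using sum.lessThan_Suc_shift[of g n] by (simp add: add.commute)
  then show ?thesis using assms by simp
qed simp

lemma Ncyc_rotate_act: "Ncyc p (rotate_act p f) = Ncyc p f"
proof
  fix u
  have "(\<Sum>r<length u. (rotate_act p ^^ r) (rotate_act p f) u) = (\<Sum>r<length u. (rotate_act p ^^ Suc r) f u)"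
    by (simp only: funpow_Suc_right o_def)
  also have "\<dots> = (\<Sum>r<length u. (rotate_act p ^^ r) f u)"
    by (rule sum_shift_cyclic) (simp add: rotate_act_funpow_length)
  finally show "Ncyc p (rotate_act p f) u = Ncyc p f u" by (simp add: Ncyc_funpow)
qed

lemma Ncyc_rotate_act_funpow: "Ncyc p ((rotate_act p ^^ r) f) = Ncyc p f"
  by (induction r) (auto simp: Ncyc_rotate_act)

lemma Ncyc_linear:
  "Ncyc p (\<lambda>u. \<Sum>i\<in>I. a i * f i u) u = (\<Sum>i\<in>I. a i * Ncyc p (f i) u)"
proof -
  have "(\<Sum>s<length u. psign (wpar p (take s u) \<and> wpar p (drop s u)) *
      (\<Sum>i\<in>I. a i * f i (drop s u @ take s u))) =
    (\<Sum>s<length u. \<Sum>i\<in>I. a i * (psign (wpar p (take s u) \<and> wpar p (drop s u)) *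
      f i (drop s u @ take s u)))"
    by (simp add: sum_distrib_left mult_ac)
  then show ?thesis
    unfolding Ncyc_rotations by (subst (asm) sum.swap) (simp add: sum_distrib_left)
qed

lemma Ncyc_diff: "Ncyc p (\<lambda>u. f u - g u) u = Ncyc p f u - Ncyc p g u"
  by (simp add: Ncyc_rotations right_diff_distrib sum_subtractf)

lemma Ncyc_cong_length:
  "(\<And>v. length v = length u \<Longrightarrow> f v = g v) \<Longrightarrow> Ncyc p f u = Ncyc p g u"
  unfolding Ncyc_rotations by (intro sum.cong) auto

lemma Ncyc_one_minus_z: "Ncyc p (one_minus_z p f) = (\<lambda>u. 0)"
proof
  fix u
  have "one_minus_z p f = (\<lambda>u. f u - rotate_act p f u)" by (auto simp: one_minus_z_def rotate_act_def)
  then show "Ncyc p (one_minus_z p f) u = 0" by (simp add: Ncyc_diff Ncyc_rotate_act)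
qed

lemma rotate_act_Ncyc: "rotate_act p (Ncyc p f) = Ncyc p f"
proof
  fix u
  have "rotate_act p (Ncyc p f) u = (\<Sum>r<length u. rotate_act p ((rotate_act p ^^ r) f) u)"
    by (simp add: rotate_act_def act_def Ncyc_funpow sum_distrib_left)
  also have "\<dots> = (\<Sum>r<length u. (rotate_act p ^^ r) f u)"
    using sum_shift_cyclic[of "\<lambda>r. (rotate_act p ^^ r) f u" "length u"] by (simp add: rotate_act_funpow_length)
  finally show "rotate_act p (Ncyc p f) u = Ncyc p f u" by (simp add: Ncyc_funpow)
qed

lemma Ncyc_rotate:
  "Ncyc p f (v @ u) = psign (wpar p u \<and> wpar p v) * Ncyc p f (u @ v)"
proof -
  have "(rotate_act p ^^ r) (Ncyc p f) = Ncyc p f" for r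
    by (induction r) (auto simp: rotate_act_Ncyc)
  then have "Ncyc p f (v @ u) = (rotate_act p ^^ length u) (Ncyc p f) (v @ u)" by simp
  also have "\<dots> = psign (wpar p u \<and> wpar p v) * Ncyc p f (u @ v)"
    unfolding rotate_act_funpow using act_zperm[of "length v" "v @ u" p "Ncyc p f"]
    by (simp add: conj_commute)
  finally show ?thesis .
qed

text \<open>Up to its Koszul sign, \<open>v @ u\<close> is a rotation of \<open>u @ v\<close>, and the cyclic sum does not
  distinguish rotations.\<close>

lemma Ncyc_commutator:
  assumes "x \<in> commutators p S n"
  shows "Ncyc p x = (\<lambda>w. 0)"
proof
  fix w
  obtain u v where x: "x = (\<lambda>w. single (u @ v) w - psign (wpar p u \<and> wpar p v) * single (v @ u) w)"
    using assms by (auto simp: commutators_def)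
  have "psign (wpar p u \<and> wpar p v) * single (v @ u) w = (rotate_act p ^^ length u) (single (u @ v)) w"
    for w
  proof (cases "length w = length (u @ v)")
    case True
    have l: "length w - length v = length u" "length v \<le> length w" using True by auto
    have "drop (length v) w @ take (length v) w = u @ v \<longleftrightarrow> w = v @ u"
      using l by (metis append_eq_conv_conj append_take_drop_id length_drop append_eq_append_conv)
    then show ?thesis
      using act_zperm[of "length v" w p "single (u @ v)"] l
      by (auto simp: rotate_act_funpow single_def conj_commute)
  next
    case False
    then have "permute_list (zperm (length w) ^^ length u) w \<noteq> u @ v" "w \<noteq> v @ u"
      by (metis length_permute_list, auto)
    then show ?thesis by (simp add: rotate_act_funpow act_def single_def)
  qed
  then show "Ncyc p x w = 0" unfolding x by (simp add: Ncyc_diff Ncyc_rotate_act_funpow)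
qed

lemma Ncyc_comm_closure:
  assumes "x \<in> comm_closure p S"
  shows "Ncyc p x u = 0"
proof -
  define y where "y w = (if length w = length u then x w else 0)" for w
  have "y \<in> cspan (commutators p S (length u))"
    using assms unfolding y_def[abs_def] by (auto simp: comm_closure_def)
  then obtain t r where t: "finite t" "t \<subseteq> commutators p S (length u)"
    "y = (\<lambda>w. \<Sum>g\<in>t. r g * g w)" by (auto simp: cspan_def)
  have "Ncyc p x u = Ncyc p y u" by (rule Ncyc_cong_length) (simp add: y_def)
  also have "\<dots> = (\<Sum>g\<in>t. r g * Ncyc p g u)" unfolding t(3) by (rule Ncyc_linear)
  also have "\<dots> = 0" using t(2) by (intro sum.neutral) (auto simp: Ncyc_commutator)
  finally show ?thesis .
qed

text \<open>So the cyclic sum is a well defined map on classes of tensors or forms modulo commutators.\<close>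

lemma Ncyc_class_cong:
  assumes "(\<lambda>w. g w - f w) \<in> comm_closure p S"
  shows "Ncyc p g = Ncyc p f"
  using Ncyc_comm_closure[OF assms] by (auto simp: Ncyc_diff)

lemma Ncyc_parity:
  "Ncyc p (\<lambda>w. h (wpar p w) * f w) u = h (wpar p u) * Ncyc p f u"
proof -
  have "wpar p (drop s u @ take s u) = wpar p u" for s
    using wpar_append[of p "take s u" "drop s u"] by auto
  then show ?thesis by (simp add: Ncyc_rotations sum_distrib_left mult_ac)
qed

section \<open>Super derivations and permutations\<close>

definition linear_op :: "(('a \<Rightarrow> complex) \<Rightarrow> 'b \<Rightarrow> complex) \<Rightarrow> bool" where
  "linear_op T \<longleftrightarrow> (\<forall>f g d. T (\<lambda>c. f c + g c) d = T f d + T g d) \<and>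
     (\<forall>a f d. T (\<lambda>c. a * f c) d = a * T f d)"

text \<open>Homogeneity of parity \<open>q\<close>, phrased through the functions of the parity: restricting the input to
  one parity restricts the output to the shifted parity.\<close>

definition shifts_parity ::
  "('c \<Rightarrow> bool) \<Rightarrow> bool \<Rightarrow> (('c \<Rightarrow> complex) \<Rightarrow> 'c \<Rightarrow> complex) \<Rightarrow> bool" where
  "shifts_parity p q T \<longleftrightarrow> (\<forall>h f d. T (\<lambda>c. h (p c) * f c) d = h (p d \<noteq> q) * T f d)"

text \<open>The action of a linear map \<open>T\<close> of parity \<open>q\<close> on tensors as a super derivation.  The alphabet is
  arbitrary, since the construction is iterated: words in letters are themselves the letters of
  words of words, and then \<open>T\<close> is a super derivation of the inner words.\<close>

definition der ::
  "('c \<Rightarrow> bool) \<Rightarrow> bool \<Rightarrow> (('c \<Rightarrow> complex) \<Rightarrow> 'c \<Rightarrow> complex) \<Rightarrow> 'c tensor \<Rightarrow> 'c tensor" where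
  "der p q T f u = (\<Sum>j<length u. psign (q \<and> wpar p (take j u)) * T (\<lambda>c. f (u[j := c])) (u ! j))"

lemma linear_op_add: "linear_op T \<Longrightarrow> T (\<lambda>c. f c + g c) d = T f d + T g d"
  by (simp add: linear_op_def)

lemma linear_op_scale: "linear_op T \<Longrightarrow> T (\<lambda>c. a * f c) d = a * T f d"
  by (simp add: linear_op_def)

lemma linear_op_sum:
  assumes "linear_op T"
  shows "T (\<lambda>c. \<Sum>i\<in>I. a i * F i c) d = (\<Sum>i\<in>I. a i * T (F i) d)"
proof -
  have 0: "T (\<lambda>c. 0) d = 0" using linear_op_scale[OF assms, of 0 "\<lambda>c. 0" d] by simp
  show ?thesis
    by (induction I rule: infinite_finite_induct)
      (simp_all add: 0 linear_op_add[OF assms] linear_op_scale[OF assms])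
qed

lemma linear_op_Ncyc: "linear_op (Ncyc p)"
  by (simp add: linear_op_def Ncyc_rotations algebra_simps sum.distrib sum_distrib_left)

lemma linear_op_der: "linear_op T \<Longrightarrow> linear_op (der p q T)"
  by (simp add: linear_op_def der_def algebra_simps sum.distrib sum_distrib_left)

text \<open>Operators in different variables commute: a cyclic sum is a finite linear combination of
  evaluations.\<close>

lemma Ncyc_swap:
  assumes "linear_op T"
  shows "Ncyc p (\<lambda>v. T (g v) d) u = T (\<lambda>w. Ncyc p (\<lambda>v. g v w) u) d"
  unfolding Ncyc_rotations by (rule linear_op_sum[OF assms, symmetric])

lemma linear_op_Nblocks: "linear_op (Nblocks p)"
proof -
  have "Nblocks p (\<lambda>c. f c + g c) d = Nblocks p f d + Nblocks p g d" for f g d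
    by (induction d arbitrary: f g) (simp_all add: linear_op_add[OF linear_op_Ncyc])
  moreover have "Nblocks p (\<lambda>c. a * f c) d = a * Nblocks p f d" for a f d
    by (induction d arbitrary: f) (simp_all add: linear_op_scale[OF linear_op_Ncyc])
  ultimately show ?thesis by (simp add: linear_op_def)
qed

lemma Nblocks_swap:
  assumes "linear_op T"
  shows "Nblocks p (\<lambda>vs. T (g vs) d) us = T (\<lambda>w. Nblocks p (\<lambda>vs. g vs w) us) d"
  by (induction us arbitrary: g) (simp_all add: Ncyc_swap[OF assms])

lemma der_Nil [simp]: "der p q T f [] = 0"
  by (simp add: der_def)

lemma psign_and_xor: "psign (q \<and> (a = (\<not> b))) = psign (q \<and> a) * psign (q \<and> b)"
  by (simp add: psign_def)

lemma der_Cons: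
  "der p q T f (c # w) = T (\<lambda>d. f (d # w)) c + psign (q \<and> p c) * der p q T (\<lambda>v. f (c # v)) w"
  by (simp add: der_def sum.lessThan_Suc_shift sum_distrib_left psign_and_xor mult.assoc
      del: sum.lessThan_Suc)

lemma der_append:
  "der p q T f (a @ b) =
    der p q T (\<lambda>v. f (v @ b)) a + psign (q \<and> wpar p a) * der p q T (\<lambda>v. f (a @ v)) b"
  by (induction a arbitrary: f) (auto simp: der_Cons psign_def algebra_simps)

lemma der_cong_length:
  "(\<And>v. length v = length u \<Longrightarrow> f v = g v) \<Longrightarrow> der p q T f u = der p q T g u"
  by (simp add: der_def)

lemma wpar_update:
  "j < length u \<Longrightarrow> wpar p (u[j := c]) = (wpar p u \<noteq> (p (u ! j) \<noteq> p c))"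
proof -
  assume j: "j < length u"
  have "wpar p u = wpar p (take j u @ u ! j # drop (Suc j) u)"
    using id_take_nth_drop[OF j] by simp
  then show ?thesis
    using upd_conv_take_nth_drop[OF j, of c] by auto
qed

lemma shifts_parity_der:
  assumes "shifts_parity p q T"
  shows "shifts_parity (wpar p) q (der p q T)"
  unfolding shifts_parity_def
proof (intro allI)
  fix h :: "bool \<Rightarrow> complex" and f d
  have "T (\<lambda>c. h (wpar p (d[j := c])) * f (d[j := c])) (d ! j) =
      h (wpar p d \<noteq> q) * T (\<lambda>c. f (d[j := c])) (d ! j)" if "j < length d" for j
  proof -
    let ?h = "\<lambda>b. h (wpar p d \<noteq> (p (d ! j) \<noteq> b))"
    have "(\<lambda>c. h (wpar p (d[j := c])) * f (d[j := c])) = (\<lambda>c. ?h (p c) * f (d[j := c]))"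
      using that by (simp add: wpar_update)
    then have "T (\<lambda>c. h (wpar p (d[j := c])) * f (d[j := c])) (d ! j) =
        ?h (p (d ! j) \<noteq> q) * T (\<lambda>c. f (d[j := c])) (d ! j)"
      using assms[unfolded shifts_parity_def, rule_format, of ?h "\<lambda>c. f (d[j := c])" "d ! j"] by simp
    moreover have "(wpar p d \<noteq> (p (d ! j) \<noteq> (p (d ! j) \<noteq> q))) = (wpar p d \<noteq> q)" by auto
    ultimately show ?thesis by simp
  qed
  then show "der p q T (\<lambda>c. h (wpar p c) * f c) d = h (wpar p d \<noteq> q) * der p q T f d"
    by (simp add: der_def sum_distrib_left mult_ac)
qed

lemma psign_wpar_take:
  assumes "j \<le> length v"
  shows "psign (wpar p (take j v)) = (\<Prod>i<length v. if i < j then psign (p (v ! i)) else 1)"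
proof -
  have "psign (wpar p (take j v)) = (\<Prod>i<j. psign (p (v ! i)))"
    using psign_wpar_prod[of True p "take j v"] assms by (simp add: min_absorb2)
  also have "\<dots> = (\<Prod>i<length v. if i < j then psign (p (v ! i)) else 1)"
    using assms by (intro prod.mono_neutral_cong_left) auto
  finally show ?thesis .
qed

lemma koszul_double:
  "koszul p \<sigma> v = (\<Prod>i<length v. \<Prod>k<length v.
     if i < k \<and> \<sigma> k < \<sigma> i then psign (p (v ! i) \<and> p (v ! k)) else 1)"
  unfolding koszul_def prod.cartesian_product
  by (rule prod.mono_neutral_cong_left) (auto split: if_splits)

text \<open>Changing the parity of one letter changes the Koszul sign by the letters that exchange their
  order with it.\<close>

lemma koszul_flip:
  assumes j: "j < length b"
  shows "koszul id \<sigma> (b[j := \<not> b ! j]) = koszul id \<sigma> b *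
    (\<Prod>i<length b. if (i < j \<and> \<sigma> j < \<sigma> i) \<or> (j < i \<and> \<sigma> i < \<sigma> j) then psign (b ! i) else 1)"
proof -
  let ?n = "length b"
  let ?E1 = "\<lambda>i. if i < j \<and> \<sigma> j < \<sigma> i then psign (b ! i) else 1"
  let ?E2 = "\<lambda>k. if j < k \<and> \<sigma> k < \<sigma> j then psign (b ! k) else 1"
  have "koszul id \<sigma> (b[j := \<not> b ! j]) = (\<Prod>i<?n. \<Prod>k<?n.
      (if i < k \<and> \<sigma> k < \<sigma> i then psign (b ! i \<and> b ! k) else 1) *
      (if k = j then ?E1 i else 1) * (if i = j then ?E2 k else 1))"
    unfolding koszul_double length_list_update
    by (intro prod.cong refl) (auto simp: nth_list_update psign_def)
  also have "\<dots> = koszul id \<sigma> b * (\<Prod>i<?n. \<Prod>k<?n. if k = j then ?E1 i else 1) *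
      (\<Prod>k<?n. \<Prod>i<?n. if i = j then ?E2 k else 1)"
  proof -
    have "(\<Prod>i<?n. \<Prod>k<?n. if i = j then ?E2 k else 1) = (\<Prod>k<?n. \<Prod>i<?n. if i = j then ?E2 k else 1)"
      by (rule prod.swap)
    then show ?thesis unfolding koszul_double prod.distrib id_apply by (simp only:)
  qed
  also have "\<dots> = koszul id \<sigma> b * (\<Prod>i<?n. ?E1 i) * (\<Prod>k<?n. ?E2 k)"
    using j by simp
  also have "\<dots> = koszul id \<sigma> b * (\<Prod>i<?n. ?E1 i * ?E2 i)"
    by (simp add: prod.distrib)
  also have "(\<Prod>i<?n. ?E1 i * ?E2 i) = (\<Prod>i<?n. if (i < j \<and> \<sigma> j < \<sigma> i) \<or>
      (j < i \<and> \<sigma> i < \<sigma> j) then psign (b ! i) else 1)"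
    by (intro prod.cong) auto
  finally show ?thesis .
qed

text \<open>The sign that the derivation collects before reaching a letter is the parity of the letters to
  the left of it.  Moving the letters by \<open>\<sigma>\<close> changes the set of these letters exactly by those that
  exchange their order with it, and \<open>koszul_flip\<close> gives the same correction.\<close>

lemma act_der:
  assumes T: "shifts_parity p q T" and s: "\<sigma> permutes {..<length u}"
  shows "act p \<sigma> (der p q T f) u = der p q T (act p \<sigma> f) u"
proof -
  define n where "n = length u"
  define v where "v = permute_list \<sigma> u"
  have lv: "length v = n" by (simp add: v_def n_def)
  have vn: "v ! i = u ! \<sigma> i" if "i < n" for i
    using that s by (simp add: v_def permute_list_nth n_def)
  have sn: "\<sigma> i < n \<longleftrightarrow> i < n" for i using permutes_in_image[OF s, of i] by (simp add: n_def)
  have inj: "\<sigma> i = \<sigma> j \<longleftrightarrow> i = j" for i j using permutes_inj[OF s] by (auto dest: injD)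
  have step: "psign (q \<and> wpar p (take (\<sigma> j) u)) * T (\<lambda>c. act p \<sigma> f (u[\<sigma> j := c])) (u ! \<sigma> j) =
      koszul p \<sigma> v * (psign (q \<and> wpar p (take j v)) * T (\<lambda>c. f (v[j := c])) (v ! j))"
    if j: "j < n" for j
  proof -
    \<comment> \<open>the Koszul sign as a function of the parity \<open>b\<close> of the differentiated letter\<close>
    define h where "h b = koszul id \<sigma> ((map p v)[j := b])" for b
    have hk: "h (p c) = koszul p \<sigma> (v[j := c])" for c
      unfolding h_def map_update[symmetric] by (rule koszul_cong_par) auto
    have perm: "permute_list \<sigma> (u[\<sigma> j := c]) = v[j := c]" for c
    proof (rule nth_equalityI)
      fix i assume "i < length (permute_list \<sigma> (u[\<sigma> j := c]))"
      then have i: "i < n" by (simp add: n_def)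
      then show "permute_list \<sigma> (u[\<sigma> j := c]) ! i = v[j := c] ! i"
        using s j sn[of i] sn[of j] lv inj[of j i]
        by (simp add: permute_list_nth n_def nth_list_update vn)
    qed (simp add: lv n_def)
    have "T (\<lambda>c. act p \<sigma> f (u[\<sigma> j := c])) (v ! j) = T (\<lambda>c. h (p c) * f (v[j := c])) (v ! j)"
      by (simp add: act_def perm hk)
    also have "\<dots> = h (p (v ! j) \<noteq> q) * T (\<lambda>c. f (v[j := c])) (v ! j)"
      by (rule T[unfolded shifts_parity_def, rule_format])
    finally have 1: "T (\<lambda>c. act p \<sigma> f (u[\<sigma> j := c])) (u ! \<sigma> j) =
        h (p (v ! j) \<noteq> q) * T (\<lambda>c. f (v[j := c])) (v ! j)" using j by (simp add: vn)
    have h0: "h (p (v ! j)) = koszul p \<sigma> v" by (simp add: hk)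
    have 2: "psign (q \<and> wpar p (take (\<sigma> j) u)) * h (p (v ! j) \<noteq> q) =
        koszul p \<sigma> v * psign (q \<and> wpar p (take j v))"
    proof (cases q)
      case True
      let ?I = "\<lambda>i. if (i < j \<and> \<sigma> j < \<sigma> i) \<or> (j < i \<and> \<sigma> i < \<sigma> j) then psign (p (v ! i)) else 1"
      let ?A = "\<lambda>i. if \<sigma> i < \<sigma> j then psign (p (v ! i)) else 1"
      let ?B = "\<lambda>i. if i < j then psign (p (v ! i)) else 1"
      have "koszul id \<sigma> (map p v) = koszul p \<sigma> v" by (rule koszul_cong_par) auto
      moreover have "(\<Prod>i<n. if (i < j \<and> \<sigma> j < \<sigma> i) \<or> (j < i \<and> \<sigma> i < \<sigma> j)
          then psign (map p v ! i) else 1) = (\<Prod>i<n. ?I i)"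
        by (intro prod.cong refl) (simp add: lv)
      ultimately have hf: "h (\<not> p (v ! j)) = koszul p \<sigma> v * (\<Prod>i<n. ?I i)"
        using koszul_flip[of j "map p v" \<sigma>] j lv by (simp add: h_def)
      have "psign (wpar p (take (\<sigma> j) u)) = (\<Prod>i<n. if i < \<sigma> j then psign (p (u ! i)) else 1)"
        using psign_wpar_take[of "\<sigma> j" u p] sn[of j] j by (simp add: n_def)
      also have "\<dots> = (\<Prod>i<n. if \<sigma> i < \<sigma> j then psign (p (u ! \<sigma> i)) else 1)"
        using s by (subst prod.permute[of \<sigma>]) (auto simp: n_def o_def)
      finally have A: "psign (wpar p (take (\<sigma> j) u)) = (\<Prod>i<n. ?A i)"
        using vn by (auto intro: prod.cong)
      have B: "psign (wpar p (take j v)) = (\<Prod>i<n. ?B i)"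
        using psign_wpar_take[of j v p] j lv by simp
      have "(\<Prod>i<n. ?A i) * (\<Prod>i<n. ?I i) = (\<Prod>i<n. ?B i)"
        unfolding prod.distrib[symmetric]
      proof (intro prod.cong refl)
        fix i assume "i \<in> {..<n}"
        then show "?A i * ?I i = ?B i"
          using inj[of i j] by (cases i j rule: linorder_cases) auto
      qed
      then show ?thesis using True A B hf by (simp add: mult_ac)
    qed (simp add: h0)
    show ?thesis unfolding 1 using 2 by (metis mult.assoc)
  qed
  have "der p q T (act p \<sigma> f) u = (\<Sum>j<n. psign (q \<and> wpar p (take (\<sigma> j) u)) *
      T (\<lambda>c. act p \<sigma> f (u[\<sigma> j := c])) (u ! \<sigma> j))"
    unfolding der_def n_def[symmetric]
    using s by (subst sum.permute[of \<sigma>]) (auto simp: n_def o_def)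
  also have "\<dots> = koszul p \<sigma> v * der p q T f v"
    by (simp add: der_def lv sum_distrib_left step)
  finally show ?thesis by (simp add: act_def v_def)
qed

lemma Ncyc_der:
  assumes "shifts_parity p q T" "linear_op T"
  shows "Ncyc p (der p q T f) u = der p q T (Ncyc p f) u"
proof -
  have "Ncyc p (der p q T f) u = (\<Sum>r<length u. 1 * der p q T (act p (zperm (length u) ^^ r) f) u)"
    unfolding Ncyc_def by (simp add: act_der[OF assms(1)] zperm_funpow_permutes)
  also have "\<dots> = der p q T (\<lambda>v. \<Sum>r<length u. 1 * act p (zperm (length u) ^^ r) f v) u"
    by (rule linear_op_sum[OF linear_op_der[OF assms(2)], symmetric])
  also have "\<dots> = der p q T (Ncyc p f) u"
    by (rule der_cong_length) (simp add: Ncyc_def)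
  finally show ?thesis .
qed

text \<open>Derivations of words of words commute with the cyclic sum in each block, by \<open>Ncyc_der\<close> in the
  block that is differentiated and by parity preservation in the blocks that are passed.\<close>

lemma Nblocks_der:
  assumes T: "shifts_parity p q T" "linear_op T"
  shows "Nblocks p (der (wpar p) q (der p q T) x) ws = der (wpar p) q (der p q T) (Nblocks p x) ws"
proof (induction ws arbitrary: x)
  case (Cons w ws)
  let ?D = "der p q T" and ?DD = "der (wpar p) q (der p q T)"
  have lD: "linear_op ?D" and lDD: "linear_op ?DD" using T by (auto intro: linear_op_der)
  have "Nblocks p (?DD x) (w # ws) =
    Ncyc p (\<lambda>v. Nblocks p (\<lambda>vs. ?D (\<lambda>v'. x (v' # vs)) v) ws +
      psign (q \<and> wpar p v) * Nblocks p (?DD (\<lambda>vs'. x (v # vs'))) ws) w"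
    by (simp add: der_Cons linear_op_add[OF linear_op_Nblocks] linear_op_scale[OF linear_op_Nblocks])
  also have "\<dots> = Ncyc p (\<lambda>v. ?D (\<lambda>v'. Nblocks p (\<lambda>vs. x (v' # vs)) ws) v +
      psign (q \<and> wpar p v) * ?DD (Nblocks p (\<lambda>vs'. x (v # vs'))) ws) w"
    using Nblocks_swap[OF lD, of p "\<lambda>vs v'. x (v' # vs)"] by (simp add: Cons.IH)
  also have "\<dots> = ?D (Ncyc p (\<lambda>v'. Nblocks p (\<lambda>vs. x (v' # vs)) ws)) w +
      psign (q \<and> wpar p w) * Ncyc p (\<lambda>v. ?DD (Nblocks p (\<lambda>vs'. x (v # vs'))) ws) w"
    using Ncyc_parity[of p "\<lambda>b. psign (q \<and> b)"]
    by (simp add: linear_op_add[OF linear_op_Ncyc] Ncyc_der[OF T])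
  also have "\<dots> = ?DD (Nblocks p x) (w # ws)"
    by (simp add: der_Cons Ncyc_swap[OF lDD])
  finally show ?case .
qed simp

lemma antisym_der:
  assumes "shifts_parity lpar q T" "linear_op T"
  shows "antisym (der (wpar lpar) q (der lpar q T) x) ws = der (wpar lpar) q (der lpar q T) (antisym x) ws"
proof -
  let ?DD = "der (wpar lpar) q (der lpar q T)"
  let ?S = "{\<sigma>. \<sigma> permutes {..<length ws}}"
  have "antisym (?DD x) ws = (\<Sum>\<sigma>\<in>?S. of_int (sign \<sigma>) * ?DD (act (wpar lpar) \<sigma> x) ws)"
    unfolding antisym_def using assms by (simp add: act_der shifts_parity_der)
  also have "\<dots> = ?DD (\<lambda>ws'. \<Sum>\<sigma>\<in>?S. of_int (sign \<sigma>) * act (wpar lpar) \<sigma> x ws') ws"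
    by (rule linear_op_sum[symmetric]) (intro linear_op_der assms)
  also have "\<dots> = ?DD (antisym x) ws"
    by (rule der_cong_length) (simp add: antisym_def)
  finally show ?thesis .
qed

lemma der_split_word:
  assumes "length u = sum_list ks"
  shows "der p q T (\<lambda>v. x (split_word ks v)) u = der (wpar p) q (der p q T) x (split_word ks u)"
  using assms
proof (induction ks arbitrary: u x)
  case (Cons k ks)
  define a b where "a = take k u" and "b = drop k u"
  have u: "u = a @ b" and la: "length a = k" and lb: "length b = sum_list ks"
    using Cons.prems by (auto simp: a_def b_def)
  have "der p q T (\<lambda>v. x (split_word (k # ks) v)) u =
    der p q T (\<lambda>v. x (v # split_word ks b)) a +
    psign (q \<and> wpar p a) * der p q T (\<lambda>v. x (a # split_word ks v)) b"
    unfolding u der_append using la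
    by (intro arg_cong2[of _ _ _ _ "(+)"] arg_cong2[of _ _ _ _ "(*)"] der_cong_length) auto
  then show ?case using Cons.IH[OF lb, of "\<lambda>vs. x (a # vs)"] la by (simp add: der_Cons u)
qed simp

lemma der_type_part:
  assumes "linear_op T"
  shows "der lpar q T (type_part ks x) u = type_part ks (der (wpar lpar) q (der lpar q T) x) u"
proof (cases "length u = sum_list ks")
  case True
  have "der lpar q T (type_part ks x) u = der lpar q T (\<lambda>v. x (split_word ks v)) u"
    by (rule der_cong_length) (simp add: type_part_def True)
  then show ?thesis using der_split_word[OF True] by (simp add: type_part_def True)
next
  case False
  have "der lpar q T (type_part ks x) u = der lpar q T (\<lambda>v. 0 * type_part ks x v) u"
    by (rule der_cong_length) (simp add: type_part_def False)
  also have "\<dots> = 0" by (subst linear_op_scale[OF linear_op_der[OF assms]]) simp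
  finally show ?thesis by (simp add: type_part_def False)
qed

section \<open>Amplitudes as functionals on chains\<close>

lemma Ncyc_nonzero:
  assumes "Ncyc p f u \<noteq> 0"
  shows "\<exists>v. f v \<noteq> 0 \<and> mset v = mset u"
proof -
  obtain s where "f (drop s u @ take s u) \<noteq> 0"
    using assms unfolding Ncyc_rotations by (metis (lifting) mult_zero_right sum.neutral)
  moreover have "mset (drop s u @ take s u) = mset u"
    by (metis append_take_drop_id mset_append union_commute)
  ultimately show ?thesis by blast
qed

lemma Nblocks_nonzero:
  assumes "Nblocks p x ws \<noteq> 0"
  shows "\<exists>vs. x vs \<noteq> 0 \<and> list_all2 (\<lambda>v w. mset v = mset w) vs ws"
  using assms
proof (induction ws arbitrary: x)
  case (Cons w ws)
  then obtain v where v: "Nblocks p (\<lambda>vs. x (v # vs)) ws \<noteq> 0" "mset v = mset w"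
    using Ncyc_nonzero by fastforce
  show ?case using Cons.IH[OF v(1)] v(2) by auto
qed auto

lemma antisym_nonzero:
  assumes "antisym x ws \<noteq> 0"
  shows "\<exists>\<sigma>. \<sigma> permutes {..<length ws} \<and> x (permute_list \<sigma> ws) \<noteq> 0"
  using assms unfolding antisym_def act_def
  by (metis (lifting) mem_Collect_eq mult_zero_right sum.neutral)

lemma concat_split_word: "length u = sum_list ks \<Longrightarrow> concat (split_word ks u) = u"
  by (induction ks arbitrary: u) auto

lemma length_split_word [simp]: "length (split_word ks u) = length ks"
  by (induction ks arbitrary: u) auto

lemma map_length_split_word: "length u = sum_list ks \<Longrightarrow> map length (split_word ks u) = ks"
  by (induction ks arbitrary: u) auto

text \<open>The index set of finite sums; unlike \<open>lists S\<close> it is finite.\<close>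

definition words :: "'c set \<Rightarrow> nat \<Rightarrow> 'c list set" where
  "words S n = {u. set u \<subseteq> S \<and> length u = n}"

lemma finite_words [simp]: "finite S \<Longrightarrow> finite (words S n)"
  by (simp add: words_def finite_lists_length_eq)

lemma finite_letters [simp]: "finite (letters n m)"
  by (simp add: letters_def)

lemma letters_mono: "n \<le> n' \<Longrightarrow> m \<le> m' \<Longrightarrow> letters n m \<subseteq> letters n' m'"
  by (auto simp: letters_def)

lemma kappa_finite:
  assumes "finite T" "\<And>u. f u \<noteq> 0 \<Longrightarrow> u \<in> T"
  shows "kappa g f = (\<Sum>u\<in>T. f u * pair_prod g u)"
  unfolding kappa_def by (rule sum.mono_neutral_left) (use assms in auto)

text \<open>The amplitude as a function of the valencies and of the permutation given by the chords.\<close>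

definition chord_amplitude :: "nat list \<Rightarrow> (nat \<Rightarrow> nat) \<Rightarrow> chain \<Rightarrow> complex" where
  "chord_amplitude ks \<sigma> x = kappa lform (act lpar \<sigma> (type_part ks (antisym (Nblocks lpar x))))"

text \<open>The contraction \<open>kappa\<close> sums over the support of its argument and is therefore additive only
  where the supports are finite.  Summing over a fixed finite set \<open>W\<close> of words instead gives a
  functional that is linear on all functions.\<close>

definition chord_amplitude_on :: "letter list set \<Rightarrow> nat list \<Rightarrow> (nat \<Rightarrow> nat) \<Rightarrow> chain \<Rightarrow> complex" where
  "chord_amplitude_on W ks \<sigma> x =
     (\<Sum>u\<in>W. act lpar \<sigma> (type_part ks (antisym (Nblocks lpar x))) u * pair_prod lform u)"

text \<open>The cyclic sums, the antisymmetrisation and the permutation only rearrange letters, so a chain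
  with letters in \<open>S\<close> is contracted over words in \<open>S\<close>.\<close>

lemma chord_amplitude_eq_on:
  assumes s: "\<sigma> permutes {..<sum_list ks}" and S: "finite S"
    and x: "\<And>ws. x ws \<noteq> 0 \<Longrightarrow> set (concat ws) \<subseteq> S"
  shows "chord_amplitude ks \<sigma> x = chord_amplitude_on (words S (sum_list ks)) ks \<sigma> x"
  unfolding chord_amplitude_def chord_amplitude_on_def
proof (rule kappa_finite)
  show "finite (words S (sum_list ks))" using S by simp
  fix u assume u: "act lpar \<sigma> (type_part ks (antisym (Nblocks lpar x))) u \<noteq> 0"
  define v where "v = permute_list \<sigma> u"
  have lv: "length v = sum_list ks" and a: "antisym (Nblocks lpar x) (split_word ks v) \<noteq> 0"
    using u by (auto simp: act_def type_part_def v_def split: if_splits)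
  have lu: "length u = sum_list ks" using lv by (simp add: v_def)
  have su: "set v = set u" using s lu unfolding v_def by simp
  obtain \<tau> where t: "\<tau> permutes {..<length (split_word ks v)}"
    "Nblocks lpar x (permute_list \<tau> (split_word ks v)) \<noteq> 0"
    using antisym_nonzero[OF a] by blast
  obtain ws where ws: "x ws \<noteq> 0"
    "list_all2 (\<lambda>v w. mset v = mset w) ws (permute_list \<tau> (split_word ks v))"
    using Nblocks_nonzero[OF t(2)] by blast
  have "list_all2 (\<lambda>v w. set v = set w) ws (permute_list \<tau> (split_word ks v))"
    using ws(2) by (rule list_all2_mono) (rule mset_eq_setD)
  then have "map set ws = map set (permute_list \<tau> (split_word ks v))"
    by (simp add: list_all2_conv_all_nth list_eq_iff_nth_eq)
  then have "set (map set ws) = set (map set (permute_list \<tau> (split_word ks v)))" by simp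
  then have "set ` set ws = set ` set (split_word ks v)"
    using t(1) by simp
  then have "set (concat ws) = set (concat (split_word ks v))" by auto
  then show "u \<in> words S (sum_list ks)"
    using x[OF ws(1)] concat_split_word[OF lv] su lu by (auto simp: words_def)
qed

lemma antisym_sum: "antisym (\<lambda>ws. \<Sum>i\<in>I. a i * x i ws) ws = (\<Sum>i\<in>I. a i * antisym (x i) ws)"
proof -
  have "antisym (\<lambda>ws. \<Sum>i\<in>I. a i * x i ws) ws =
    (\<Sum>\<sigma> | \<sigma> permutes {..<length ws}. \<Sum>i\<in>I. a i * (of_int (sign \<sigma>) * act (wpar lpar) \<sigma> (x i) ws))"
    by (simp add: antisym_def act_def sum_distrib_left mult_ac)
  then show ?thesis by (subst (asm) sum.swap) (simp add: antisym_def sum_distrib_left)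
qed

lemma chord_amplitude_on_sum: "chord_amplitude_on W ks \<sigma> (\<lambda>ws. \<Sum>i\<in>I. a i * x i ws) = (\<Sum>i\<in>I. a i * chord_amplitude_on W ks \<sigma> (x i))"
proof -
  have N: "Nblocks lpar (\<lambda>ws. \<Sum>i\<in>I. a i * x i ws) = (\<lambda>ws. \<Sum>i\<in>I. a i * Nblocks lpar (x i) ws)"
    by (rule ext, rule linear_op_sum[OF linear_op_Nblocks])
  have "chord_amplitude_on W ks \<sigma> (\<lambda>ws. \<Sum>i\<in>I. a i * x i ws) =
    (\<Sum>u\<in>W. \<Sum>i\<in>I. a i * (act lpar \<sigma> (type_part ks (antisym (Nblocks lpar (x i)))) u * pair_prod lform u))"
    unfolding chord_amplitude_on_def N
    by (rule sum.cong) (auto simp: act_def type_part_def antisym_sum sum_distrib_left sum_distrib_right mult_ac)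
  then show ?thesis by (subst (asm) sum.swap) (simp add: chord_amplitude_on_def sum_distrib_left)
qed

lemma chord_amplitude_on_cong: "Nblocks lpar x = Nblocks lpar y \<Longrightarrow> chord_amplitude_on W ks \<sigma> x = chord_amplitude_on W ks \<sigma> y"
  by (simp add: chord_amplitude_on_def)

section \<open>The cyclic relations\<close>

lemma in_slot_0: "in_slot (w # ws) 0 f (v # vs) = f v * single ws vs"
  by (simp add: in_slot_def single_def)

lemma in_slot_Suc: "in_slot (w # ws) (Suc r) f (v # vs) = single w v * in_slot ws r f vs"
  by (simp add: in_slot_def single_def)

lemma Nblocks_in_slot:
  assumes "r < length ws" "Ncyc p f = (\<lambda>u. 0)"
  shows "Nblocks p (in_slot ws r f) us = 0"
  using assms(1)
proof (induction ws arbitrary: r us)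
  case (Cons w ws)
  show ?case
  proof (cases us)
    case Nil
    then show ?thesis by (simp add: in_slot_def)
  next
    case us: (Cons u us')
    show ?thesis
    proof (cases r)
      case 0
      have "Nblocks p (in_slot (w # ws) r f) us = Ncyc p (\<lambda>v. Nblocks p (single ws) us' * f v) u"
        by (simp add: us 0 in_slot_0 linear_op_scale[OF linear_op_Nblocks] mult.commute)
      also have "\<dots> = 0" by (simp add: linear_op_scale[OF linear_op_Ncyc] assms(2))
      finally show ?thesis .
    next
      case (Suc r')
      then have "r' < length ws" using Cons.prems by simp
      then have "Nblocks p (in_slot (w # ws) r f) us = Ncyc p (\<lambda>v. 0) u"
        by (simp add: us Suc in_slot_Suc linear_op_scale[OF linear_op_Nblocks] Cons.IH)
      then show ?thesis by (simp add: Ncyc_rotations)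
    qed
  qed
qed simp

section \<open>The exterior relations\<close>

text \<open>The action of the transposition of two adjacent blocks (\<open>act_transpose\<close>), spelled out so that
  recursion on the list of blocks applies.\<close>

definition swap_blocks :: "('c \<Rightarrow> bool) \<Rightarrow> nat \<Rightarrow> ('c list \<Rightarrow> complex) \<Rightarrow> 'c list \<Rightarrow> complex" where
  "swap_blocks p r x vs = psign (p (vs ! r) \<and> p (vs ! Suc r)) * x (vs[r := vs ! Suc r, Suc r := vs ! r])"

lemma act_transpose:
  assumes "Suc r < length vs"
  shows "act p (transpose r (Suc r)) x vs = swap_blocks p r x vs"
proof -
  let ?t = "transpose r (Suc r)"
  have t: "?t permutes {..<length vs}" using assms by (intro permutes_swap_id) auto
  have 1: "permute_list ?t vs = vs[r := vs ! Suc r, Suc r := vs ! r]"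
    using assms by (intro nth_equalityI)
      (auto simp: permute_list_nth[OF t] nth_list_update transpose_def)
  have "{(i, j). i < j \<and> j < length vs \<and> ?t j < ?t i} = {(r, Suc r)}"
  proof (intro equalityI subsetI)
    fix y assume "y \<in> {(i, j). i < j \<and> j < length vs \<and> ?t j < ?t i}"
    then obtain i j where y: "y = (i, j)" "i < j" "?t j < ?t i" by auto
    then show "y \<in> {(r, Suc r)}"
      by (cases "i = r"; cases "i = Suc r"; cases "j = r"; cases "j = Suc r")
        (simp_all add: transpose_def)
  qed (use assms in auto)
  then have "koszul p ?t (permute_list ?t vs) = psign (p (vs ! r) \<and> p (vs ! Suc r))"
    using assms by (simp add: koszul_def 1 nth_list_update conj_commute)
  then show ?thesis by (simp add: act_def swap_blocks_def 1)
qed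

lemma Nblocks_swap_blocks:
  assumes "Suc r < length vs"
  shows "Nblocks p (swap_blocks (wpar p) r x) vs = swap_blocks (wpar p) r (Nblocks p x) vs"
  using assms
proof (induction r arbitrary: vs x)
  case 0
  then obtain a b t where vs: "vs = a # b # t"
    by (metis Suc_length_conv Suc_less_eq2 length_Cons list.exhaust list.size(3) not_less0)
  have "Nblocks p (swap_blocks (wpar p) 0 x) vs =
    Ncyc p (\<lambda>v. Ncyc p (\<lambda>w. psign (wpar p v \<and> wpar p w) * Nblocks p (\<lambda>t. x (w # v # t)) t) b) a"
    by (simp add: vs swap_blocks_def linear_op_scale[OF linear_op_Nblocks])
  also have "\<dots> = Ncyc p (\<lambda>v. psign (wpar p v \<and> wpar p b) *
      Ncyc p (\<lambda>w. Nblocks p (\<lambda>t. x (w # v # t)) t) b) a"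
    using Ncyc_parity[of p "\<lambda>c. psign (wpar p _ \<and> c)"] by simp
  also have "\<dots> = psign (wpar p a \<and> wpar p b) *
      Ncyc p (\<lambda>v. Ncyc p (\<lambda>w. Nblocks p (\<lambda>t. x (w # v # t)) t) b) a"
    using Ncyc_parity[of p "\<lambda>c. psign (c \<and> wpar p b)"] by simp
  also have "\<dots> = swap_blocks (wpar p) 0 (Nblocks p x) vs"
    using Ncyc_swap[OF linear_op_Ncyc[of p], where g = "\<lambda>v w. Nblocks p (\<lambda>t. x (w # v # t)) t" and d = b and u = a and p = p]
    by (simp add: vs swap_blocks_def)
  finally show ?case .
next
  case (Suc r)
  then obtain a t where vs: "vs = a # t" by (cases vs) auto
  have "(\<lambda>us. swap_blocks (wpar p) (Suc r) x (v # us)) = swap_blocks (wpar p) r (\<lambda>us. x (v # us))" for v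
    by (rule ext) (simp add: swap_blocks_def)
  then have "Nblocks p (swap_blocks (wpar p) (Suc r) x) vs =
      Ncyc p (\<lambda>v. swap_blocks (wpar p) r (Nblocks p (\<lambda>us. x (v # us))) t) a"
    using Suc by (simp add: vs)
  then show ?case by (simp add: vs swap_blocks_def linear_op_scale[OF linear_op_Ncyc])
qed

text \<open>Reindexing by \<open>\<sigma> \<mapsto> \<sigma> \<circ> (r r+1)\<close> reverses the signature.\<close>

lemma antisym_swap_blocks:
  assumes "Suc r < length vs"
  shows "antisym (swap_blocks (wpar lpar) r y) vs = - antisym y vs"
proof -
  let ?t = "transpose r (Suc r)" and ?P = "{\<sigma>. \<sigma> permutes {..<length vs}}"
  have t: "?t permutes {..<length vs}" using assms by (intro permutes_swap_id) auto
  have pt: "permutation \<sigma>" if "\<sigma> permutes {..<length vs}" for \<sigma>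
    using that permutation_permutes by blast
  have "antisym (swap_blocks (wpar lpar) r y) vs =
      (\<Sum>\<sigma>\<in>?P. of_int (sign \<sigma>) * act (wpar lpar) \<sigma> (act (wpar lpar) ?t y) vs)"
    unfolding antisym_def using assms by (simp add: act_def[of _ "_ :: nat \<Rightarrow> nat" "act _ _ _"]
        act_def[of _ _ "swap_blocks _ _ _"] act_transpose)
  also have "\<dots> = (\<Sum>\<sigma>\<in>?P. of_int (sign \<sigma>) * act (wpar lpar) (\<sigma> \<circ> ?t) y vs)"
    using t by (intro sum.cong) (auto simp: act_compose)
  also have "\<dots> = (\<Sum>\<sigma>\<in>?P. - (of_int (sign \<sigma>) * act (wpar lpar) \<sigma> y vs))"
  proof (rule sum.reindex_bij_witness[where i = "\<lambda>\<sigma>. \<sigma> \<circ> ?t" and j = "\<lambda>\<sigma>. \<sigma> \<circ> ?t"])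
    fix \<sigma> assume "\<sigma> \<in> ?P"
    then show "- (of_int (sign (\<sigma> \<circ> ?t)) * act (wpar lpar) (\<sigma> \<circ> ?t) y vs) =
        of_int (sign \<sigma>) * act (wpar lpar) (\<sigma> \<circ> ?t) y vs"
      using pt t by (simp add: sign_compose sign_swap_id)
  qed (use t in \<open>auto simp: comp_assoc intro: permutes_compose\<close>)
  finally show ?thesis by (simp add: antisym_def sum_negf)
qed

lemma antisym_exterior:
  assumes ws: "Suc r < length ws"
  defines "e \<equiv> (\<lambda>vs. single ws vs + psign (wpar lpar (ws ! r) \<and> wpar lpar (ws ! Suc r)) *
         single (ws[r := ws ! Suc r, Suc r := ws ! r]) vs)"
  shows "antisym (Nblocks lpar e) vs = 0"
proof (cases "length vs = length ws")
  case True
  have e: "e us = single ws us + swap_blocks (wpar lpar) r (single ws) us" for us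
  proof (cases "length us = length ws")
    case True
    have "us = ws[r := ws ! Suc r, Suc r := ws ! r] \<longleftrightarrow> us[r := us ! Suc r, Suc r := us ! r] = ws"
      using True ws by (auto simp: list_eq_iff_nth_eq nth_list_update split: if_splits)
    then show ?thesis using True ws by (auto simp: e_def swap_blocks_def single_def conj_commute nth_list_update)
  next
    case False
    then have "us[r := us ! Suc r, Suc r := us ! r] \<noteq> ws" "us \<noteq> ws[r := ws ! Suc r, Suc r := ws ! r]"
      by (metis length_list_update)+
    then show ?thesis by (auto simp: e_def swap_blocks_def single_def)
  qed
  let ?y = "Nblocks lpar (single ws)"
  have "Nblocks lpar e us = ?y us + swap_blocks (wpar lpar) r ?y us" if "length us = length ws" for us
    using that ws unfolding e[abs_def]
    by (simp add: linear_op_add[OF linear_op_Nblocks] Nblocks_swap_blocks)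
  then have "antisym (Nblocks lpar e) vs = antisym (\<lambda>us. ?y us + swap_blocks (wpar lpar) r ?y us) vs"
    using True by (simp add: antisym_def act_def)
  also have "\<dots> = antisym ?y vs + antisym (swap_blocks (wpar lpar) r ?y) vs"
    by (simp add: antisym_def act_def algebra_simps sum.distrib)
  finally show ?thesis using True ws by (simp add: antisym_swap_blocks)
next
  case False
  have "e us = 0" if "length us \<noteq> length ws" for us
    using that by (auto simp: e_def single_def)
  then have "Nblocks lpar e us = 0" if "length us \<noteq> length ws" for us
    using that Nblocks_nonzero[of lpar e us] list_all2_lengthD by force
  then show ?thesis using False by (simp add: antisym_def act_def)
qed

section \<open>Invariance under \<open>osp\<close>\<close>

lemma lform_even: "lform x y \<noteq> 0 \<Longrightarrow> lpar x = lpar y"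
  by (cases x; cases y) (auto simp: lpar_def)

text \<open>The coefficient of \<open>d\<close> in \<open>X c\<close>, where \<open>X = (-1)\<^bsup>|a||b|\<^esup> \<langle>a, -\<rangle> b + \<langle>b, -\<rangle> a\<close> is the linear vector
  field with Hamiltonian \<open>a b\<close>.\<close>

definition osp_coeff :: "letter \<Rightarrow> letter \<Rightarrow> letter \<Rightarrow> letter \<Rightarrow> complex" where
  "osp_coeff a b c d = psign (lpar a \<and> lpar b) * lform a c * (if d = b then 1 else 0) +
     lform b c * (if d = a then 1 else 0)"

text \<open>The map \<open>X\<close> acting on coefficient functions, and its transpose.\<close>

definition osp_op where "osp_op S a b g d = (\<Sum>c\<in>S. osp_coeff a b c d * g c)"
definition osp_dual where "osp_dual S a b g c = (\<Sum>d\<in>S. osp_coeff a b c d * g d)"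

lemma osp_coeff_parity: "osp_coeff a b c d \<noteq> 0 \<Longrightarrow> lpar d = (lpar c \<noteq> (lpar a \<noteq> lpar b))"
proof -
  assume "osp_coeff a b c d \<noteq> 0"
  then have "(lform a c \<noteq> 0 \<and> d = b) \<or> (lform b c \<noteq> 0 \<and> d = a)"
    by (auto simp: osp_coeff_def split: if_splits)
  then show ?thesis
  proof
    assume "lform a c \<noteq> 0 \<and> d = b"
    then have "lpar a = lpar c" "d = b" using lform_even[of a c] by blast+
    then show ?thesis by blast
  next
    assume "lform b c \<noteq> 0 \<and> d = a"
    then have "lpar b = lpar c" "d = a" using lform_even[of b c] by blast+
    then show ?thesis by blast
  qed
qed

lemma linear_op_osp_op: "linear_op (osp_op S a b)"
  by (simp add: linear_op_def osp_op_def algebra_simps sum.distrib sum_distrib_left)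

lemma linear_op_osp_dual: "linear_op (osp_dual S a b)"
  by (simp add: linear_op_def osp_dual_def algebra_simps sum.distrib sum_distrib_left)

lemma shifts_parity_osp_op: "shifts_parity lpar (lpar a \<noteq> lpar b) (osp_op S a b)"
  unfolding shifts_parity_def
proof (intro allI)
  fix h :: "bool \<Rightarrow> complex" and f d
  have "osp_coeff a b c d * (h (lpar c) * f c) =
      h (lpar d \<noteq> (lpar a \<noteq> lpar b)) * (osp_coeff a b c d * f c)" for c
  proof (cases "osp_coeff a b c d = 0")
    case False
    then have "lpar c = (lpar d \<noteq> (lpar a \<noteq> lpar b))" using osp_coeff_parity by blast
    then have "(lpar d \<noteq> (lpar a \<noteq> lpar b)) = lpar c" by blast
    then show ?thesis by simp
  qed simp
  then show "osp_op S a b (\<lambda>c. h (lpar c) * f c) d =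
      h (lpar d \<noteq> (lpar a \<noteq> lpar b)) * osp_op S a b f d"
    unfolding osp_op_def sum_distrib_left by (intro sum.cong refl)
qed

lemma osp_dual_alt:
  assumes "finite S" "a \<in> S" "b \<in> S"
  shows "osp_dual S a b g c = psign (lpar a \<and> lpar b) * lform a c * g b + lform b c * g a"
proof -
  have "osp_dual S a b g c = (\<Sum>d\<in>S. (if d = b then psign (lpar a \<and> lpar b) * lform a c * g b else 0) +
      (if d = a then lform b c * g a else 0))"
    unfolding osp_dual_def by (rule sum.cong) (auto simp: osp_coeff_def algebra_simps)
  then show ?thesis using assms by (simp add: sum.distrib)
qed

text \<open>The map \<open>X\<close> belongs to \<open>osp\<close>: \<open>\<langle>X x, y\<rangle> + (-1)\<^bsup>|X||x|\<^esup> \<langle>x, X y\<rangle> = 0\<close>.\<close>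

lemma lform_invariant:
  "psign (lpar a \<and> lpar b) * lform a x * lform b y + lform b x * lform a y +
   psign ((lpar a \<noteq> lpar b) \<and> lpar x) *
     (psign (lpar a \<and> lpar b) * lform a y * lform x b + lform b y * lform x a) = 0"
  by (cases a; cases b; cases x; cases y) (auto simp: lpar_def psign_def)

text \<open>The derivation acts on one chord at a time, and a chord carries an even pair of letters.  Even
  length matters, because \<open>pair_prod\<close> ignores an unpaired last letter.\<close>

lemma der_pair_prod:
  assumes S: "finite S" "a \<in> S" "b \<in> S" and "even (length w)"
  shows "der lpar (lpar a \<noteq> lpar b) (osp_dual S a b) (pair_prod lform) w = 0"
  using assms(4)
proof (induction w rule: induct_list012)
  case (3 x y w)
  let ?D = "der lpar (lpar a \<noteq> lpar b) (osp_dual S a b)"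
  have "?D (\<lambda>v. lform x y * pair_prod lform v) w = 0"
    using 3 by (simp add: linear_op_scale[OF linear_op_der[OF linear_op_osp_dual]])
  moreover have "?D (pair_prod lform) (x # y # w) =
      osp_dual S a b (\<lambda>d. pair_prod lform (d # y # w)) x +
      psign ((lpar a \<noteq> lpar b) \<and> lpar x) *
        (osp_dual S a b (\<lambda>d. pair_prod lform (x # d # w)) y +
         psign ((lpar a \<noteq> lpar b) \<and> lpar y) * ?D (\<lambda>v. lform x y * pair_prod lform v) w)"
    by (simp add: der_Cons)
  ultimately have "?D (pair_prod lform) (x # y # w) =
     (psign (lpar a \<and> lpar b) * lform a x * lform b y + lform b x * lform a y +
       psign ((lpar a \<noteq> lpar b) \<and> lpar x) *
       (psign (lpar a \<and> lpar b) * lform a y * lform x b + lform b y * lform x a)) *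
     pair_prod lform w"
    unfolding osp_dual_alt[OF S] by (simp add: algebra_simps)
  then show ?case unfolding lform_invariant by simp
qed auto

text \<open>Exchanging the old letter and the new letter at the differentiated place moves the derivation
  to the other factor.\<close>

lemma sum_der_dual:
  assumes S: "finite S"
  shows "(\<Sum>u\<in>words S L. der lpar q (osp_op S a b) f u * g u) =
    (\<Sum>u\<in>words S L. f u * der lpar q (osp_dual S a b) g u)"
proof -
  let ?W = "words S L"
  let ?K = "osp_coeff a b"
  let ?s = "\<lambda>j u. psign (q \<and> wpar lpar (take j u))"
  have W: "u[j := c] \<in> ?W" "u ! j \<in> S" if "u \<in> ?W" "c \<in> S" "j < L" for u c j
    using that set_update_subset_insert[of u j c] by (auto simp: words_def)
  have 1: "(\<Sum>u\<in>?W. \<Sum>c\<in>S. ?s j u * (?K c (u ! j) * f (u[j := c])) * g u) =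
      (\<Sum>w\<in>?W. \<Sum>d\<in>S. f w * (?s j w * (?K (w ! j) d * g (w[j := d]))))" if j: "j < L" for j
    unfolding sum.cartesian_product
    by (rule sum.reindex_bij_witness[where i = "\<lambda>(w, d). (w[j := d], w ! j)"
          and j = "\<lambda>(u, c). (u[j := c], u ! j)"])
      (use j W in \<open>auto simp: words_def\<close>)
  have "(\<Sum>u\<in>?W. der lpar q (osp_op S a b) f u * g u) =
      (\<Sum>u\<in>?W. \<Sum>j<L. \<Sum>c\<in>S. ?s j u * (?K c (u ! j) * f (u[j := c])) * g u)"
    by (rule sum.cong) (auto simp: der_def osp_op_def words_def sum_distrib_left sum_distrib_right mult_ac)
  also have "\<dots> = (\<Sum>j<L. \<Sum>u\<in>?W. \<Sum>c\<in>S. ?s j u * (?K c (u ! j) * f (u[j := c])) * g u)"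
    by (rule sum.swap)
  also have "\<dots> = (\<Sum>j<L. \<Sum>w\<in>?W. \<Sum>d\<in>S. f w * (?s j w * (?K (w ! j) d * g (w[j := d]))))"
    using 1 by simp
  also have "\<dots> = (\<Sum>w\<in>?W. \<Sum>j<L. \<Sum>d\<in>S. f w * (?s j w * (?K (w ! j) d * g (w[j := d]))))"
    by (rule sum.swap)
  also have "\<dots> = (\<Sum>w\<in>?W. f w * der lpar q (osp_dual S a b) g w)"
    by (rule sum.cong) (auto simp: der_def osp_dual_def words_def sum_distrib_left)
  finally show ?thesis .
qed

lemma act_zperm_single:
  "act p (zperm (length (x @ y)) ^^ length x) (single (x @ y)) w =
     psign (wpar p x \<and> wpar p y) * single (y @ x) w"
proof (cases "length w = length (x @ y)")
  case True
  have l: "length w - length y = length x" "length y \<le> length w" using True by auto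
  have "drop (length y) w @ take (length y) w = x @ y \<longleftrightarrow> w = y @ x"
    using l by (metis append_eq_conv_conj append_take_drop_id length_drop append_eq_append_conv)
  then show ?thesis
    using act_zperm[of "length y" w p "single (x @ y)"] l True
    by (auto simp: single_def conj_commute)
next
  case False
  then have "permute_list (zperm (length (x @ y)) ^^ length x) w \<noteq> x @ y" "w \<noteq> y @ x"
    by (metis length_permute_list, auto)
  then show ?thesis by (simp add: act_def single_def)
qed

lemma Ncyc_single_rotate:
  "Ncyc p (single (y @ x)) u = psign (wpar p x \<and> wpar p y) * Ncyc p (single (x @ y)) u"
proof -
  let ?s = "psign (wpar p x \<and> wpar p y)"
  have "(\<lambda>w. single (x @ y) w - ?s * single (y @ x) w) \<in> commutators p UNIV (length (x @ y))"
    unfolding commutators_def by (intro CollectI exI conjI) (rule refl, simp_all)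
  then have "Ncyc p (\<lambda>w. single (x @ y) w - ?s * single (y @ x) w) u = 0"
    by (simp only: Ncyc_commutator)
  then have "Ncyc p (single (x @ y)) u = ?s * Ncyc p (single (y @ x)) u"
    by (simp add: Ncyc_diff linear_op_scale[OF linear_op_Ncyc])
  then show ?thesis by simp
qed

lemma tmult_single: "tmult (single [b]) g u = (case u of [] \<Rightarrow> 0 | c # v \<Rightarrow> if c = b then g v else 0)"
proof (cases u)
  case (Cons c v)
  have "tmult (single [b]) g u = (\<Sum>i\<in>{1}. single [b] (take i u) * g (drop i u))"
    unfolding tmult_def
    by (rule sum.mono_neutral_right) (auto simp: Cons single_def take_Cons split: nat.splits)
  then show ?thesis by (simp add: Cons single_def)
qed (simp add: tmult_def single_def)

lemma zperm_1: "zperm (Suc 0) = id"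
  by (auto simp: zperm_def)

lemma act_id: "act p id f = f"
  by (rule ext) (simp add: act_def koszul_id)

text \<open>After contracting one letter of \<open>[a, b]\<close> a single letter remains of it, on which \<open>zperm 1\<close> acts
  trivially.\<close>

lemma bracket_alt:
  "bracket [a, b] w u = (\<Sum>j<length w.
     (psign (lpar a \<and> (lpar b \<noteq> wpar lpar (take j w))) * lform a (w ! j) *
      psign (wpar lpar (take j w) \<and> wpar lpar (drop (Suc j) w))) *
        single (b # drop (Suc j) w @ take j w) u +
     (psign (lpar b \<and> wpar lpar (take j w)) * lform b (w ! j) *
      psign (wpar lpar (take j w) \<and> wpar lpar (drop (Suc j) w))) *
        single (a # drop (Suc j) w @ take j w) u)"
proof -
  have t: "tmult (single [c])
      (act lpar (zperm (length w - Suc 0) ^^ j) (single (take j w @ drop (Suc j) w))) u =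
    psign (wpar lpar (take j w) \<and> wpar lpar (drop (Suc j) w)) *
      single (c # drop (Suc j) w @ take j w) u" if "j < length w" for j c
  proof -
    have l: "length (take j w @ drop (Suc j) w) = length w - Suc 0" "length (take j w) = j"
      using that by auto
    have 2: "act lpar (zperm (length w - Suc 0) ^^ j) (single (take j w @ drop (Suc j) w)) =
      (\<lambda>v. psign (wpar lpar (take j w) \<and> wpar lpar (drop (Suc j) w)) *
        single (drop (Suc j) w @ take j w) v)"
      using act_zperm_single[of lpar "take j w" "drop (Suc j) w"] unfolding l by blast
    show ?thesis unfolding 2 tmult_single by (simp add: single_def split: list.split)
  qed
  show ?thesis
    unfolding bracket_def
    by (simp add: lessThan_Suc numeral_2_eq_2 zperm_1 act_id t sum.distrib mult_ac)
qed

lemma der_osp_single: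
  assumes S: "finite S" and w: "set w \<subseteq> S"
  shows "der lpar q (osp_op S a b) (single w) u = (\<Sum>j<length w.
     (psign (q \<and> wpar lpar (take j w)) * psign (lpar a \<and> lpar b) * lform a (w ! j)) *
        single (take j w @ b # drop (Suc j) w) u +
     (psign (q \<and> wpar lpar (take j w)) * lform b (w ! j)) *
        single (take j w @ a # drop (Suc j) w) u)"
proof (cases "length u = length w")
  case True
  have "osp_op S a b (\<lambda>c. single w (u[j := c])) (u ! j) =
      (if u[j := w ! j] = w then osp_coeff a b (w ! j) (u ! j) else 0)" if j: "j < length w" for j
  proof -
    have "osp_coeff a b c (u ! j) * (if u[j := c] = w then 1 else 0) = (if c = w ! j then
          (if u[j := w ! j] = w then osp_coeff a b (w ! j) (u ! j) else 0) else 0)" for c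
    proof (cases "c = w ! j")
      case False
      then have "u[j := c] \<noteq> w" using j True by (metis nth_list_update_eq)
      then show ?thesis using False by simp
    qed simp
    moreover have "w ! j \<in> S" using w j by auto
    ultimately have "osp_op S a b (\<lambda>c. single w (u[j := c])) (u ! j) =
        (\<Sum>c\<in>S. if c = w ! j then
          (if u[j := w ! j] = w then osp_coeff a b (w ! j) (u ! j) else 0) else 0)"
      unfolding osp_op_def single_def by (intro sum.cong refl)
    then show ?thesis using S \<open>w ! j \<in> S\<close> by simp
  qed
  then have "der lpar q (osp_op S a b) (single w) u = (\<Sum>j<length w. psign (q \<and> wpar lpar (take j u)) *
      (if u[j := w ! j] = w then osp_coeff a b (w ! j) (u ! j) else 0))"
    unfolding der_def True by (intro sum.cong) auto
  also have "\<dots> = (\<Sum>j<length w. psign (q \<and> wpar lpar (take j w)) *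
      (psign (lpar a \<and> lpar b) * lform a (w ! j) * single (w[j := b]) u +
        lform b (w ! j) * single (w[j := a]) u))"
  proof (rule sum.cong)
    fix j assume "j \<in> {..<length w}"
    then have j: "j < length w" by simp
    have tk: "take j u = take j w" if "u[j := w ! j] = w"
      using that by (metis take_update_cancel order_refl)
    have *: "u = w[j := c] \<longleftrightarrow> w = u[j := w ! j] \<and> u ! j = c" for c
      using j True by (metis list_update_overwrite list_update_id nth_list_update_eq)
    have sg: "single (w[j := c]) u = (if u[j := w ! j] = w \<and> u ! j = c then 1 else 0)" for c
      using *[of c] unfolding single_def by metis
    show "psign (q \<and> wpar lpar (take j u)) *
      (if u[j := w ! j] = w then osp_coeff a b (w ! j) (u ! j) else 0) =
      psign (q \<and> wpar lpar (take j w)) *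
      (psign (lpar a \<and> lpar b) * lform a (w ! j) * single (w[j := b]) u +
        lform b (w ! j) * single (w[j := a]) u)"
      using tk by (cases "u[j := w ! j] = w") (simp_all add: sg osp_coeff_def)
  qed simp
  finally show ?thesis
    by (simp add: upd_conv_take_nth_drop algebra_simps cong: sum.cong_simp)
next
  case False
  then have "single w (u[j := c]) = 0" for j c by (auto simp: single_def)
  then have 1: "der lpar q (osp_op S a b) (single w) u = 0" by (simp add: der_def osp_op_def)
  have "single (take j w @ c # drop (Suc j) w) u = 0" if "j < length w" for j c
  proof -
    have "length (take j w @ c # drop (Suc j) w) = length w" using that by simp
    then have "u \<noteq> take j w @ c # drop (Suc j) w" using False by metis
    then show ?thesis by (simp add: single_def)
  qed
  then show ?thesis unfolding 1 by simp
qed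


lemma linear_op_sum2:
  assumes "linear_op T"
  shows "T (\<lambda>u. \<Sum>i\<in>I. a i * f i u + b i * g i u) d = (\<Sum>i\<in>I. a i * T (f i) d + b i * T (g i) d)"
proof -
  have "T (\<lambda>u. (\<Sum>i\<in>I. a i * f i u) + (\<Sum>i\<in>I. b i * g i u)) d =
      (\<Sum>i\<in>I. a i * T (f i) d) + (\<Sum>i\<in>I. b i * T (g i) d)"
    unfolding linear_op_add[OF assms] linear_op_sum[OF assms] ..
  then show ?thesis by (simp add: sum.distrib)
qed

text \<open>The bracket puts the new letter in front and rotates the rest behind it; one more rotation
  returns the new letter to the place of the letter that it replaces.\<close>

lemma Ncyc_bracket:
  assumes S: "finite S" and w: "set w \<subseteq> S"
  shows "Ncyc lpar (bracket [a, b] w) u =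
    Ncyc lpar (der lpar (lpar a \<noteq> lpar b) (osp_op S a b) (single w)) u"
proof -
  have rot: "Ncyc lpar (single (c # drop (Suc j) w @ take j w)) u =
      psign (wpar lpar (take j w) \<and> (lpar c \<noteq> wpar lpar (drop (Suc j) w))) *
      Ncyc lpar (single (take j w @ c # drop (Suc j) w)) u" for c j
    using Ncyc_single_rotate[of lpar "c # drop (Suc j) w" "take j w" u] by simp
  show ?thesis
    unfolding bracket_alt[abs_def] der_osp_single[OF S w, abs_def]
      linear_op_sum2[OF linear_op_Ncyc] rot
    by (rule sum.cong) (auto simp: psign_def)
qed

lemma wpar_concat: "wpar p (concat vs) = wpar (wpar p) vs"
  by (induction vs) auto

lemma in_slot_length: "length vs \<noteq> length ws \<Longrightarrow> in_slot ws r f vs = 0"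
  unfolding in_slot_def by (metis length_list_update)

lemma der_blocks_single:
  assumes T: "linear_op T"
  shows "der (wpar p) q (der p q T) (single ws) vs =
    (\<Sum>r<length ws. psign (q \<and> wpar p (concat (take r ws))) *
      in_slot ws r (der p q T (single (ws ! r))) vs)"
proof (cases "length vs = length ws")
  case True
  have D0: "der p q T (\<lambda>v. 0) u = 0" for u
    using linear_op_scale[OF linear_op_der[OF T, of p q], where a = 0 and f = "\<lambda>v. 0" and d = u] by simp
  show ?thesis unfolding der_def[of "wpar p"] True
  proof (rule sum.cong)
    fix r assume "r \<in> {..<length ws}"
    then have r: "r < length ws" by simp
    show "psign (q \<and> wpar (wpar p) (take r vs)) * der p q T (\<lambda>c. single ws (vs[r := c])) (vs ! r) =
      psign (q \<and> wpar p (concat (take r ws))) * in_slot ws r (der p q T (single (ws ! r))) vs"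
    proof (cases "vs[r := ws ! r] = ws")
      case eq: True
      have "vs[r := c] = ws \<longleftrightarrow> c = ws ! r" for c
        using r True eq by (metis nth_list_update_eq)
      then have "(\<lambda>c. single ws (vs[r := c])) = single (ws ! r)"
        by (auto simp: single_def fun_eq_iff)
      moreover have "take r vs = take r ws" using eq by (metis take_update_cancel order_refl)
      ultimately show ?thesis by (simp add: in_slot_def eq wpar_concat)
    next
      case False
      then have "vs[r := c] \<noteq> ws" for c
        using r True by (metis list_update_overwrite nth_list_update_eq)
      then have "(\<lambda>c. single ws (vs[r := c])) = (\<lambda>c. 0)" by (simp add: single_def)
      then show ?thesis by (simp add: in_slot_def False D0)
    qed
  qed simp
next
  case False
  then have "vs[r := c] \<noteq> ws" for r c by (metis length_list_update)
  then have "der (wpar p) q (der p q T) (single ws) vs = der (wpar p) q (der p q T) (\<lambda>v. 0 * 0) vs"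
    by (simp add: der_def[of "wpar p"] single_def)
  also have "\<dots> = 0" by (subst linear_op_scale[OF linear_op_der[OF linear_op_der[OF T]]]) simp
  finally show ?thesis using False by (simp add: in_slot_length)
qed

lemma Nblocks_in_slot_cong:
  assumes "r < length ws" "\<And>u. Ncyc p f u = Ncyc p g u"
  shows "Nblocks p (in_slot ws r f) us = Nblocks p (in_slot ws r g) us"
proof -
  have "Ncyc p (\<lambda>u. f u + (- 1) * g u) = (\<lambda>u. 0)"
    by (rule ext) (simp add: Ncyc_diff assms(2))
  then have "Nblocks p (in_slot ws r (\<lambda>u. f u + (- 1) * g u)) us = 0"
    by (rule Nblocks_in_slot[OF assms(1)])
  moreover have "in_slot ws r (\<lambda>u. f u + (- 1) * g u) = (\<lambda>us. in_slot ws r f us + (- 1) * in_slot ws r g us)"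
    by (auto simp: in_slot_def)
  ultimately show ?thesis
    by (simp only: linear_op_add[OF linear_op_Nblocks] linear_op_scale[OF linear_op_Nblocks]) simp
qed

text \<open>After cyclic summation \<open>osp\<close> acts on chains by a super derivation of words of words.\<close>

lemma Nblocks_osp_action:
  assumes S: "finite S" and ws: "set (concat ws) \<subseteq> S"
    and q_def: "q = (lpar a \<noteq> lpar b)"
  shows "Nblocks lpar (osp_action [a, b] ws) us =
    Nblocks lpar (der (wpar lpar) q (der lpar q (osp_op S a b)) (single ws)) us"
proof -
  have "osp_action [a, b] ws = (\<lambda>vs. \<Sum>r<length ws. psign (q \<and> wpar lpar (concat (take r ws))) *
      in_slot ws r (bracket [a, b] (ws ! r)) vs)"
    by (rule ext) (simp add: osp_action_def q_def)
  then have "Nblocks lpar (osp_action [a, b] ws) us =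
      (\<Sum>r<length ws. psign (q \<and> wpar lpar (concat (take r ws))) *
        Nblocks lpar (in_slot ws r (bracket [a, b] (ws ! r))) us)"
    by (simp only: linear_op_sum[OF linear_op_Nblocks])
  also have "\<dots> = (\<Sum>r<length ws. psign (q \<and> wpar lpar (concat (take r ws))) *
        Nblocks lpar (in_slot ws r (der lpar q (osp_op S a b) (single (ws ! r)))) us)"
  proof (rule sum.cong)
    fix r assume "r \<in> {..<length ws}"
    then have r: "r < length ws" by simp
    then have "set (ws ! r) \<subseteq> S" using ws by (auto dest: nth_mem)
    then show "psign (q \<and> wpar lpar (concat (take r ws))) *
        Nblocks lpar (in_slot ws r (bracket [a, b] (ws ! r))) us =
      psign (q \<and> wpar lpar (concat (take r ws))) *
        Nblocks lpar (in_slot ws r (der lpar q (osp_op S a b) (single (ws ! r)))) us"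
      using Nblocks_in_slot_cong[OF r, of lpar "bracket [a, b] (ws ! r)"] Ncyc_bracket[OF S]
      unfolding q_def by simp
  qed simp
  finally show ?thesis
    by (simp only: der_blocks_single[OF linear_op_osp_op, abs_def] linear_op_sum[OF linear_op_Nblocks])
qed

text \<open>The derivation is moved through cyclic sums, antisymmetrisation and the chord permutation and
  then over to the contraction, which it annihilates.\<close>

lemma chord_amplitude_on_osp:
  assumes S: "finite S" "a \<in> S" "b \<in> S" and ws: "set (concat ws) \<subseteq> S"
    and s: "\<sigma> permutes {..<sum_list ks}" and ev: "even (sum_list ks)"
  shows "chord_amplitude_on (words S (sum_list ks)) ks \<sigma> (osp_action [a, b] ws) = 0"
proof -
  let ?q = "lpar a \<noteq> lpar b" and ?T = "osp_op S a b" and ?W = "words S (sum_list ks)"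
  let ?D = "der lpar ?q ?T"
  let ?DD = "der (wpar lpar) ?q ?D"
  note T = shifts_parity_osp_op[of a b S] linear_op_osp_op[of S a b]
  let ?y = "type_part ks (antisym (Nblocks lpar (single ws)))"
  have "chord_amplitude_on ?W ks \<sigma> (osp_action [a, b] ws) = chord_amplitude_on ?W ks \<sigma> (?DD (single ws))"
    by (rule chord_amplitude_on_cong) (rule ext, rule Nblocks_osp_action[OF S(1) ws refl])
  also have "\<dots> = (\<Sum>u\<in>?W. ?D (act lpar \<sigma> ?y) u * pair_prod lform u)"
    unfolding chord_amplitude_on_def
  proof (rule sum.cong)
    fix u assume u: "u \<in> ?W"
    then have su: "\<sigma> permutes {..<length u}" using s by (simp add: words_def)
    have N: "Nblocks lpar (?DD (single ws)) = ?DD (Nblocks lpar (single ws))"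
      by (rule ext, rule Nblocks_der[OF T])
    have A: "antisym (?DD (Nblocks lpar (single ws))) = ?DD (antisym (Nblocks lpar (single ws)))"
      by (rule ext, rule antisym_der[OF T])
    have "type_part ks (antisym (Nblocks lpar (?DD (single ws)))) = ?D ?y"
      unfolding N A by (rule ext, rule der_type_part[OF T(2), symmetric])
    then show "act lpar \<sigma> (type_part ks (antisym (Nblocks lpar (?DD (single ws))))) u * pair_prod lform u =
        ?D (act lpar \<sigma> ?y) u * pair_prod lform u"
      using act_der[OF T(1) su] by simp
  qed simp
  also have "\<dots> = (\<Sum>u\<in>?W. act lpar \<sigma> ?y u * der lpar ?q (osp_dual S a b) (pair_prod lform) u)"
    by (rule sum_der_dual[OF S(1)])
  also have "\<dots> = 0"
  proof (rule sum.neutral, rule ballI)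
    fix u assume "u \<in> ?W"
    then have "even (length u)" using ev by (simp add: words_def)
    then have "der lpar ?q (osp_dual S a b) (pair_prod lform) u = 0" by (rule der_pair_prod[OF S])
    then show "act lpar \<sigma> ?y u * der lpar ?q (osp_dual S a b) (pair_prod lform) u = 0"
      by (simp only: mult_zero_right)
  qed
  finally show ?thesis .
qed

lemma chord_amplitude_on_relation:
  assumes z: "z \<in> cspan (cyclic_relations n m i l \<union> exterior_relations n m i l \<union> osp_relations n m i l)"
    and S: "finite S" "letters n m \<subseteq> S"
    and s: "\<sigma> permutes {..<sum_list ks}" and ev: "even (sum_list ks)"
  shows "chord_amplitude_on (words S (sum_list ks)) ks \<sigma> z = 0"
proof -
  let ?A = "chord_amplitude_on (words S (sum_list ks)) ks \<sigma>"
  have ws: "set (concat ws) \<subseteq> S" "length ws = i" if "ws \<in> chain_words n m i l" for ws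
    using that S by (auto simp: chain_words_def)
  have rel: "?A g = 0"
    if "g \<in> cyclic_relations n m i l \<union> exterior_relations n m i l \<union> osp_relations n m i l" for g
  proof -
    consider (cyc) "g \<in> cyclic_relations n m i l" | (exterior) "g \<in> exterior_relations n m i l"
      | (osp) "g \<in> osp_relations n m i l" using \<open>g \<in> _\<close> by blast
    then show ?thesis
    proof cases
      case cyc
      then obtain ws r where g: "g = in_slot ws r (one_minus_z lpar (single (ws ! r)))"
        "ws \<in> chain_words n m i l" "r < i" by (auto simp: cyclic_relations_def)
      have "Nblocks lpar g = (\<lambda>us. 0)"
        using g ws by (auto simp: Nblocks_in_slot Ncyc_one_minus_z)
      then have "antisym (Nblocks lpar g) = (\<lambda>us. 0)" by (simp add: antisym_def act_def fun_eq_iff)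
      then show ?thesis by (simp add: chord_amplitude_on_def act_def type_part_def)
    next
      case exterior
      then obtain ws r where g: "g = (\<lambda>vs. single ws vs + psign (wpar lpar (ws ! r) \<and> wpar lpar (ws ! Suc r)) *
         single (ws[r := ws ! Suc r, Suc r := ws ! r]) vs)"
        "ws \<in> chain_words n m i l" "Suc r < i" unfolding exterior_relations_def by blast
      have "antisym (Nblocks lpar g) = (\<lambda>us. 0)"
        unfolding g(1) by (rule ext, rule antisym_exterior) (use g ws in auto)
      then show ?thesis by (simp add: chord_amplitude_on_def act_def type_part_def)
    next
      case osp
      then obtain q ws where g: "g = osp_action q ws" "length q = 2" "q \<in> lists (letters n m)"
        "ws \<in> chain_words n m i l" by (auto simp: osp_relations_def)
      obtain a b where q: "q = [a, b]" using g(2)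
        by (metis One_nat_def Suc_1 length_0_conv length_Suc_conv)
      have "a \<in> S" "b \<in> S" using g(3) S q by auto
      then show ?thesis unfolding g(1) q
        by (intro chord_amplitude_on_osp) (use S s ev ws g(4) in auto)
    qed
  qed
  obtain t r where t: "finite t"
    "t \<subseteq> cyclic_relations n m i l \<union> exterior_relations n m i l \<union> osp_relations n m i l"
    "z = (\<lambda>x. \<Sum>g\<in>t. r g * g x)" using z unfolding cspan_def by blast
  show ?thesis unfolding t(3) chord_amplitude_on_sum using t(2) rel by (intro sum.neutral) auto
qed

text \<open>The two representatives and the relation between them may live at different levels of the
  direct system; all are compared at a common level \<open>S\<close>.\<close>

lemma chord_amplitude_chain_class:
  assumes x: "x \<in> chains i l" and y: "y \<in> chain_class i l x"
    and s: "\<sigma> permutes {..<sum_list ks}" and ev: "even (sum_list ks)"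
  shows "chord_amplitude ks \<sigma> y = chord_amplitude ks \<sigma> x"
proof -
  obtain n m where x': "\<And>ws. x ws \<noteq> 0 \<Longrightarrow> ws \<in> chain_words n m i l"
    using x by (auto simp: chains_def)
  obtain n' m' where y': "\<And>ws. y ws \<noteq> 0 \<Longrightarrow> ws \<in> chain_words n' m' i l"
    using y by (auto simp: chain_class_def chains_def)
  obtain n'' m'' where z: "(\<lambda>ws. y ws - x ws) \<in> cspan (cyclic_relations n'' m'' i l \<union>
      exterior_relations n'' m'' i l \<union> osp_relations n'' m'' i l)"
    using y by (auto simp: chain_class_def chain_relations_def)
  define S where "S = letters (max n (max n' n'')) (max m (max m' m''))"
  have S: "finite S" "letters n m \<subseteq> S" "letters n' m' \<subseteq> S" "letters n'' m'' \<subseteq> S"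
    unfolding S_def by (simp_all add: letters_mono)
  have xS: "set (concat ws) \<subseteq> S" if "x ws \<noteq> 0" for ws
    using x'[OF that] S(2) by (auto simp: chain_words_def)
  have yS: "set (concat ws) \<subseteq> S" if "y ws \<noteq> 0" for ws
    using y'[OF that] S(3) by (auto simp: chain_words_def)
  let ?A = "chord_amplitude_on (words S (sum_list ks)) ks \<sigma>"
  have "?A (\<lambda>ws. \<Sum>b\<in>UNIV. (if b then 1 else - 1) * (if b then y else x) ws) = ?A y - ?A x"
    unfolding chord_amplitude_on_sum by (simp add: UNIV_bool)
  then have "?A (\<lambda>ws. y ws - x ws) = ?A y - ?A x" by (simp add: UNIV_bool)
  moreover have "?A (\<lambda>ws. y ws - x ws) = 0"
    by (rule chord_amplitude_on_relation[OF z S(1) S(4) s ev])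
  ultimately show ?thesis
    using chord_amplitude_eq_on[OF s S(1) xS] chord_amplitude_eq_on[OF s S(1) yS] by simp
qed

section \<open>Ribbon graphs and their chords\<close>

text \<open>The orbit of a point, up to its first return.\<close>

lemma cyclic_on_listing:
  assumes "cyclic_on f v"
  shows "\<exists>hs. distinct hs \<and> set hs = v \<and> (\<forall>i<length hs. f (hs ! i) = hs ! (Suc i mod length hs))"
proof -
  obtain s where s: "s \<in> v" "v = orbit f s" using assms by (auto simp: cyclic_on_def)
  then have o: "s \<in> orbit f s" by simp
  define n where "n = funpow_dist1 f s s"
  let ?hs = "map (\<lambda>i. (f ^^ i) s) [0..<n]"
  have "distinct ?hs" using inj_on_funpow_dist1[OF o] unfolding n_def[symmetric] by (simp add: distinct_map)
  moreover have "set ?hs = v" using orbit_conv_funpow_dist1[OF o] s unfolding n_def[symmetric] by simp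
  moreover have "f (?hs ! i) = ?hs ! (Suc i mod length ?hs)" if "i < length ?hs" for i
  proof (cases "Suc i = n")
    case True
    have "(f ^^ n) s = s" unfolding n_def by (rule funpow_dist1_prop[OF o])
    moreover have "f (?hs ! i) = (f ^^ Suc i) s" using that by (simp del: upt_Suc)
    moreover have "?hs ! (Suc i mod length ?hs) = s" using that True by (simp del: upt_Suc)
    ultimately show ?thesis using True by (simp del: upt_Suc funpow.simps)
  next
    case False
    then have "Suc i < n" using that by simp
    then show ?thesis by simp
  qed
  ultimately show ?thesis by blast
qed

lemma ex_represents:
  assumes G: "oriented_ribbon_graph \<Gamma>"
  shows "\<exists>\<G>. represents \<G> \<Gamma>"
proof -
  have rib: "ribbon_graph \<Gamma>" and quo: "orient \<Gamma> \<in> orderings \<Gamma> // orient_rel \<Gamma>"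
    using G by (auto simp: oriented_ribbon_graph_def)
  obtain vs es where x: "(vs, es) \<in> orderings \<Gamma>" "orient \<Gamma> = orient_rel \<Gamma> `` {(vs, es)}"
    using quo by (auto elim!: quotientE)
  have "((vs, es), (vs, es)) \<in> orient_rel \<Gamma>"
    unfolding orient_rel_def using x(1) by (auto intro!: exI[of _ id] simp: permutes_id)
  then have ori: "(vs, es) \<in> orient \<Gamma>" using x(2) by auto
  have vs: "distinct vs" "set vs = verts \<Gamma>" using x(1) by (auto simp: orderings_def)
  define P where "P v hs \<longleftrightarrow> distinct hs \<and> set hs = v \<and>
    (\<forall>i<length hs. next_he \<Gamma> (hs ! i) = hs ! (Suc i mod length hs))" for v hs
  define ls where "ls v = (SOME hs. P v hs)" for v
  have ls: "P v (ls v)" if "v \<in> verts \<Gamma>" for v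
  proof -
    have "cyclic_on (next_he \<Gamma>) v" using rib that by (auto simp: ribbon_graph_def)
    then have "\<exists>hs. P v hs" unfolding P_def by (rule cyclic_on_listing)
    then show ?thesis unfolding ls_def by (rule someI_ex)
  qed
  have part: "partition_on (half_edges \<Gamma>) (verts \<Gamma>)" using rib by (simp add: ribbon_graph_def)
  have sl: "set (ls v) = v" "distinct (ls v)" if "v \<in> verts \<Gamma>" for v
    using ls[OF that] by (auto simp: P_def)
  have ne: "ls v \<noteq> []" if "v \<in> verts \<Gamma>" for v
    using partition_onD3[OF part] sl(1)[OF that] that by auto
  have disj: "v \<inter> v' = {}" if "v \<in> verts \<Gamma>" "v' \<in> verts \<Gamma>" "v \<noteq> v'" for v v'
    using partition_onD2[OF part] that by (auto simp: disjoint_def)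
  have "distinct (concat (map ls vs))"
  proof (rule distinct_concat)
    show "distinct (map ls vs)"
      unfolding distinct_map using vs sl(1) by (metis inj_onI)
    fix ys assume "ys \<in> set (map ls vs)" then show "distinct ys" using vs sl(2) by auto
  next
    fix ys zs assume "ys \<in> set (map ls vs)" "zs \<in> set (map ls vs)" "ys \<noteq> zs"
    then obtain v v' where v: "ys = ls v" "zs = ls v'" "v \<in> verts \<Gamma>" "v' \<in> verts \<Gamma>" "v \<noteq> v'"
      using vs by auto
    then show "set ys \<inter> set zs = {}" using disj[OF v(3-5)] sl(1) by simp
  qed
  moreover have "set (concat (map ls vs)) = half_edges \<Gamma>"
    using vs sl(1) partition_onD1[OF part] by auto
  moreover have "map set (map ls vs) = vs" unfolding map_map o_def by (rule map_idI) (use vs sl(1) in auto)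
  ultimately have "represents (map ls vs, es) \<Gamma>"
    using ls vs ori by (simp add: represents_def P_def)
  then show ?thesis by blast
qed

lemma represents_representative:
  "oriented_ribbon_graph \<Gamma> \<Longrightarrow> represents (representative \<Gamma>) \<Gamma>"
  unfolding representative_def by (rule someI_ex) (rule ex_represents)

text \<open>The permutation of a chord diagram is the inverse of reading off the ends of the chords one
  after another.\<close>

lemma chord_perm_permutes:
  assumes d: "distinct (concat (map (\<lambda>(i, j). [i, j]) c))"
    and s: "set (concat (map (\<lambda>(i, j). [i, j]) c)) = {..<L}"
  shows "chord_perm c permutes {..<L} \<and> even L"
proof -
  define l where "l = concat (map (\<lambda>(i, j). [i, j]) c)"
  have l: "distinct l" "set l = {..<L}" using d s by (simp_all add: l_def)
  have len: "length l = L" using distinct_card[OF l(1)] l(2) by simp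
  have the: "(THE q. q < length l \<and> l ! q = l ! k) = k" if "k < L" for k
    using that len l(1) by (intro the_equality) (auto simp: nth_eq_iff_index_eq)
  have cp: "chord_perm c x = (if x \<in> set l then (THE q. q < length l \<and> l ! q = x) else x)" for x
    unfolding chord_perm_def l_def Let_def by (rule refl)
  have idx: "chord_perm c (l ! k) = k" if "k < L" for k
    using that the len by (simp add: cp)
  have mem: "l ! k < L" if "k < L" for k using that len l(2) nth_mem[of k l] by auto
  have surj: "\<exists>k<L. x = l ! k" if "x < L" for x
    using that len l(2) by (metis in_set_conv_nth lessThan_iff)
  have "bij_betw (chord_perm c) {..<L} {..<L}"
    by (rule bij_betwI[where g = "\<lambda>k. l ! k"]) (use idx mem surj in \<open>fastforce+\<close>)
  then have "chord_perm c permutes {..<L}"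
    by (rule bij_imp_permutes) (use l in \<open>auto simp: cp\<close>)
  moreover have "length l = 2 * length c"
    unfolding l_def by (induction c) auto
  ultimately show ?thesis using len by simp
qed

text \<open>Each half-edge lies in one directed edge, either as its source or as its target, and hence is
  an end of exactly one chord.\<close>

lemma represented_graph_chords:
  assumes G: "oriented_ribbon_graph \<Gamma>" and rep: "represents \<G> \<Gamma>"
  shows "chord_perm (chord_diagram \<G>) permutes {..<sum_list (graph_type \<G>)} \<and>
    even (sum_list (graph_type \<G>)) \<and> (\<forall>k\<in>set (graph_type \<G>). k \<ge> 3)"
proof -
  obtain vss es where \<G>: "\<G> = (vss, es)" by fastforce
  have rib: "ribbon_graph \<Gamma>" and quo: "orient \<Gamma> \<in> orderings \<Gamma> // orient_rel \<Gamma>"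
    using G by (auto simp: oriented_ribbon_graph_def)
  define hs where "hs = concat vss"
  have hs: "distinct hs" "set hs = half_edges \<Gamma>" and ori: "(map set vss, es) \<in> orient \<Gamma>"
    using rep by (auto simp: represents_def \<G> hs_def)
  have "orient \<Gamma> \<subseteq> orderings \<Gamma>" using quo by (auto elim!: quotientE simp: orient_rel_def)
  then have ord: "(map set vss, es) \<in> orderings \<Gamma>" using ori by blast
  have esE: "{a, b} \<in> edges \<Gamma>" if "(a, b) \<in> es" for a b
    using ord that by (auto simp: orderings_def)
  have exE: "\<exists>!x. x \<in> es \<and> {fst x, snd x} = e" if "e \<in> edges \<Gamma>" for e
    using ord that by (auto simp: orderings_def)
  have part: "partition_on (half_edges \<Gamma>) (edges \<Gamma>)" and card2: "\<And>e. e \<in> edges \<Gamma> \<Longrightarrow> card e = 2"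
    using rib by (auto simp: ribbon_graph_def)
  have uniq: "x = y" if "e \<in> edges \<Gamma>" "x \<in> es" "{fst x, snd x} = e" "y \<in> es" "{fst y, snd y} = e" for e x y
    using exE[OF that(1)] that(2-5) by (elim ex1E) blast
  have same: "x = y" if "x \<in> es" "y \<in> es" "h \<in> {fst x, snd x}" "h \<in> {fst y, snd y}" for x y h
  proof -
    have e: "{fst x, snd x} \<in> edges \<Gamma>" "{fst y, snd y} \<in> edges \<Gamma>" using esE that by auto
    then have eq: "{fst x, snd x} = {fst y, snd y}"
      using disjointD[OF partition_onD2[OF part] e] that(3,4) by (metis IntI empty_iff)
    show ?thesis by (rule uniq[OF e(1) that(1) refl that(2) eq[symmetric]])
  qed
  have neq: "fst x \<noteq> snd x" if "x \<in> es" for x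
  proof
    assume eq: "fst x = snd x"
    have "{fst x, snd x} \<in> edges \<Gamma>" using esE that by auto
    then show False using card2 eq by fastforce
  qed
  have sub: "fst x \<in> set hs" "snd x \<in> set hs" if "x \<in> es" for x
    using esE[of "fst x" "snd x"] that partition_onD1[OF part] hs(2) by auto
  have cover: "\<exists>x\<in>es. h \<in> {fst x, snd x}" if "h \<in> set hs" for h
  proof -
    have "h \<in> \<Union> (edges \<Gamma>)" using that partition_onD1[OF part] hs(2) by simp
    then obtain e where e: "e \<in> edges \<Gamma>" "h \<in> e" by blast
    then obtain x where "x \<in> es" "{fst x, snd x} = e" using exE[OF e(1)] by (elim ex1E) blast
    then show ?thesis using e(2) by blast
  qed
  let ?L = "length hs"
  define J where "J i = (THE j. j < ?L \<and> (hs ! i, hs ! j) \<in> es)" for i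
  define I where "I = filter (\<lambda>i. hs ! i \<in> fst ` es) [0..<?L]"
  have J: "J i < ?L \<and> (hs ! i, hs ! J i) \<in> es" if i: "i \<in> set I" for i
  proof -
    obtain b where b: "(hs ! i, b) \<in> es" using i by (auto simp: I_def)
    then obtain j where j: "j < ?L" "b = hs ! j" using sub(2) by (metis in_set_conv_nth snd_conv)
    have uq: "j' = j" if "j' < ?L \<and> (hs ! i, hs ! j') \<in> es" for j'
    proof -
      have "(hs ! i, hs ! j') = (hs ! i, b)" using same[of "(hs ! i, hs ! j')" "(hs ! i, b)" "hs ! i"] that b by simp
      then show ?thesis using j that hs(1) by (simp add: nth_eq_iff_index_eq)
    qed
    have j': "j < ?L \<and> (hs ! i, hs ! j) \<in> es" using b j by simp
    have "J i = j" unfolding J_def by (rule the_equality, rule j', rule uq)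
    then show ?thesis using j' by simp
  qed
  define c where "c = map (\<lambda>i. (i, J i)) I"
  have cd: "chord_diagram \<G> = c"
  proof -
    have "concat (map (\<lambda>i. if Q i then [F i] else []) xs) = map F (filter Q xs)" for Q F xs
      by (induction xs) auto
    then show ?thesis
      unfolding chord_diagram_def Let_def \<G> prod.sel hs_def[symmetric] c_def I_def J_def .
  qed
  have l: "concat (map (\<lambda>(i, j). [i, j]) c) = concat (map (\<lambda>i. [i, J i]) I)"
    by (simp add: c_def o_def)
  have inL: "i < ?L" if "i \<in> set I" for i using that by (auto simp: I_def)
  have idx: "i = j" if "i < ?L" "j < ?L" "hs ! i = hs ! j" for i j
    using that hs(1) by (simp add: nth_eq_iff_index_eq)
  have sameI: "i = i'" if "i \<in> set I" "i' \<in> set I" "h \<in> {i, J i}" "h \<in> {i', J i'}" for i i' h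
  proof -
    have "(hs ! i, hs ! J i) = (hs ! i', hs ! J i')"
      using same[of "(hs ! i, hs ! J i)" "(hs ! i', hs ! J i')" "hs ! h"] J that by auto
    then show ?thesis using idx inL that by auto
  qed
  have "distinct (concat (map (\<lambda>i. [i, J i]) I))"
  proof (rule distinct_concat)
    show "distinct (map (\<lambda>i. [i, J i]) I)" by (simp add: distinct_map I_def inj_on_def)
    fix ys assume "ys \<in> set (map (\<lambda>i. [i, J i]) I)"
    then obtain i where i: "i \<in> set I" "ys = [i, J i]" by auto
    have "i \<noteq> J i" using neq[of "(hs ! i, hs ! J i)"] J[OF i(1)] by auto
    then show "distinct ys" using i by simp
  next
    fix ys zs assume "ys \<in> set (map (\<lambda>i. [i, J i]) I)" "zs \<in> set (map (\<lambda>i. [i, J i]) I)" "ys \<noteq> zs"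
    then obtain i i' where i: "i \<in> set I" "ys = [i, J i]" "i' \<in> set I" "zs = [i', J i']" "i \<noteq> i'" by auto
    show "set ys \<inter> set zs = {}"
    proof (rule ccontr)
      assume "set ys \<inter> set zs \<noteq> {}"
      then obtain h where "h \<in> {i, J i}" "h \<in> {i', J i'}" using i by auto
      then show False using sameI i by blast
    qed
  qed
  moreover have "set (concat (map (\<lambda>i. [i, J i]) I)) = {..<?L}"
  proof (intro equalityI subsetI)
    fix k assume "k \<in> {..<?L}"
    then have k: "k < ?L" by simp
    then obtain x where x: "x \<in> es" "hs ! k \<in> {fst x, snd x}" using cover by (meson nth_mem)
    show "k \<in> set (concat (map (\<lambda>i. [i, J i]) I))"
    proof (cases "hs ! k = fst x")
      case True
      then have "k \<in> set I" using x k by (auto simp: I_def)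
      then show ?thesis by auto
    next
      case False
      obtain i where i: "i < ?L" "hs ! i = fst x" using sub(1)[OF x(1)] by (metis in_set_conv_nth)
      then have iI: "i \<in> set I" using x by (auto simp: I_def)
      have "(hs ! i, hs ! J i) = x"
        using same[of "(hs ! i, hs ! J i)" x "hs ! i"] J[OF iI] x i by simp
      then have "J i = k" using idx[of "J i" k] J[OF iI] k x(2) False by auto
      then show ?thesis using iI by auto
    qed
  qed (use J inL in auto)
  ultimately have "chord_perm c permutes {..<?L} \<and> even ?L"
    unfolding l[symmetric] by (rule chord_perm_permutes)
  moreover have "sum_list (graph_type \<G>) = ?L"
    by (simp add: graph_type_def \<G> hs_def length_concat)
  moreover have "k \<ge> 3" if "k \<in> set (graph_type \<G>)" for k
  proof -
    have "k \<in> length ` set vss" using that by (simp add: graph_type_def \<G>)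
    then obtain v where v: "v \<in> set vss" "k = length v" by blast
    have "set v \<in> verts \<Gamma>" using ord v by (auto simp: orderings_def)
    then have "card (set v) \<ge> 3" using rib by (auto simp: ribbon_graph_def)
    then show ?thesis using card_length[of v] v(2) by linarith
  qed
  ultimately show ?thesis unfolding cd by simp
qed

section \<open>Linear changes of letters\<close>

lemma psign_nonzero [simp]: "psign b \<noteq> 0"
  by (simp add: psign_def)

lemma words_conv_lists: "{u \<in> lists S. length u = n} = words S n"
  by (auto simp: words_def)

lemma words_0 [simp]: "words S 0 = {[]}"
  by (auto simp: words_def)

lemma sum_words_Suc: "(\<Sum>v\<in>words S (Suc n). F v) = (\<Sum>c\<in>S. \<Sum>v\<in>words S n. F (c # v))"
  unfolding sum.cartesian_product
  by (rule sum.reindex_bij_witness[where i = "\<lambda>(c, v). c # v" and j = "\<lambda>v. (hd v, tl v)"])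
    (auto simp: words_def length_Suc_conv)

lemma sum_words_add:
  "(\<Sum>u\<in>words S (k + n). F u) = (\<Sum>a\<in>words S k. \<Sum>b\<in>words S n. F (a @ b))"
  unfolding sum.cartesian_product
  by (rule sum.reindex_bij_witness[where i = "\<lambda>(a, b). a @ b" and j = "\<lambda>u. (take k u, drop k u)"])
    (auto simp: words_def dest: in_set_takeD in_set_dropD)

lemma alg_map_words:
  "alg_map S M f v = (\<Sum>u\<in>words S (length v). f u * (\<Prod>i<length v. M (u ! i) (v ! i)))"
  unfolding alg_map_def words_conv_lists ..

lemma permute_list_words:
  "\<sigma> permutes {..<n} \<Longrightarrow> u \<in> words S n \<Longrightarrow> permute_list \<sigma> u \<in> words S n"
  by (simp add: words_def)

text \<open>A parity preserving substitution of letters leaves all Koszul signs unchanged.\<close>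

lemma act_alg_map:
  assumes M: "\<And>c d. M c d \<noteq> 0 \<Longrightarrow> p c = p' d" and s: "\<sigma> permutes {..<length v}"
  shows "act p' \<sigma> (alg_map S M f) v = alg_map S M (act p \<sigma> f) v"
proof -
  let ?n = "length v" and ?v = "permute_list \<sigma> v"
  have s': "inv \<sigma> permutes {..<?n}" using s by (rule permutes_inv)
  have "act p' \<sigma> (alg_map S M f) v =
      (\<Sum>u\<in>words S ?n. koszul p' \<sigma> ?v * (f u * (\<Prod>i<?n. M (u ! i) (?v ! i))))"
    by (simp add: act_def alg_map_words sum_distrib_left)
  also have "\<dots> = (\<Sum>w\<in>words S ?n. koszul p' \<sigma> ?v *
      (f (permute_list \<sigma> w) * (\<Prod>i<?n. M (permute_list \<sigma> w ! i) (?v ! i))))"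
  proof (rule sum.reindex_bij_witness[where i = "permute_list \<sigma>" and j = "permute_list (inv \<sigma>)"])
    fix a assume a: "a \<in> words S ?n"
    then have l: "length a = ?n" by (simp add: words_def)
    show "permute_list \<sigma> (permute_list (inv \<sigma>) a) = a"
      using permute_list_compose[of \<sigma> a "inv \<sigma>"] s l permutes_inv_o[OF s]
      by (metis permute_list_compose permute_list_id s')
    show "permute_list (inv \<sigma>) (permute_list \<sigma> a) = a"
      using s l permutes_inv_o[OF s] by (metis permute_list_compose permute_list_id s')
    show "permute_list \<sigma> a \<in> words S ?n" "permute_list (inv \<sigma>) a \<in> words S ?n"
      using permute_list_words s s' a by blast+
    show "koszul p' \<sigma> ?v * (f (permute_list \<sigma> (permute_list (inv \<sigma>) a)) *
        (\<Prod>i<?n. M (permute_list \<sigma> (permute_list (inv \<sigma>) a) ! i) (?v ! i))) =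
      koszul p' \<sigma> ?v * (f a * (\<Prod>i<?n. M (a ! i) (?v ! i)))"
      unfolding \<open>permute_list \<sigma> (permute_list (inv \<sigma>) a) = a\<close> ..
  qed
  also have "\<dots> = (\<Sum>w\<in>words S ?n. act p \<sigma> f w * (\<Prod>i<?n. M (w ! i) (v ! i)))"
  proof (rule sum.cong)
    fix w assume "w \<in> words S ?n"
    then have l: "length w = ?n" by (simp add: words_def)
    have "(\<Prod>i<?n. M (permute_list \<sigma> w ! i) (?v ! i)) = (\<Prod>i<?n. M (w ! \<sigma> i) (v ! \<sigma> i))"
      using s l by (intro prod.cong refl) (simp add: permute_list_nth)
    also have "\<dots> = (\<Prod>i<?n. M (w ! i) (v ! i))"
      using s by (subst (2) prod.permute[of \<sigma>]) (auto simp: o_def)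
    finally have 1: "(\<Prod>i<?n. M (permute_list \<sigma> w ! i) (?v ! i)) = (\<Prod>i<?n. M (w ! i) (v ! i))" .
    have 2: "koszul p' \<sigma> ?v = koszul p \<sigma> (permute_list \<sigma> w)"
      if "(\<Prod>i<?n. M (permute_list \<sigma> w ! i) (?v ! i)) \<noteq> 0"
      by (rule koszul_cong_par) (use that M l in \<open>auto simp: prod_zero_iff\<close>)
    show "koszul p' \<sigma> ?v * (f (permute_list \<sigma> w) *
        (\<Prod>i<?n. M (permute_list \<sigma> w ! i) (?v ! i))) =
      act p \<sigma> f w * (\<Prod>i<?n. M (w ! i) (v ! i))"
      using 2 unfolding 1 act_def by (cases "(\<Prod>i<?n. M (w ! i) (v ! i)) = 0") auto
  qed simp
  finally show ?thesis by (simp add: alg_map_words)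
qed

lemma Ncyc_alg_map:
  assumes "\<And>c d. M c d \<noteq> 0 \<Longrightarrow> p c = p' d"
  shows "Ncyc p' (alg_map S M f) v = alg_map S M (Ncyc p f) v"
proof -
  have "Ncyc p' (alg_map S M f) v =
      (\<Sum>r<length v. alg_map S M (act p (zperm (length v) ^^ r) f) v)"
    unfolding Ncyc_def
    by (intro sum.cong refl act_alg_map zperm_funpow_permutes) (rule assms)
  also have "\<dots> = (\<Sum>u\<in>words S (length v). (\<Sum>r<length v. act p (zperm (length v) ^^ r) f u) *
      (\<Prod>i<length v. M (u ! i) (v ! i)))"
    unfolding alg_map_words sum_distrib_right by (rule sum.swap)
  also have "\<dots> = alg_map S M (Ncyc p f) v"
    unfolding alg_map_words by (rule sum.cong) (auto simp: Ncyc_def words_def)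
  finally show ?thesis .
qed

lemma prod_lessThan_add:
  fixes f :: "nat \<Rightarrow> complex"
  shows "(\<Prod>i<k + n. f i) = (\<Prod>i<k. f i) * (\<Prod>i<n. f (i + k))"
  by (induction n) (simp_all add: mult.assoc add.commute)

lemma alg_map_split_word:
  assumes "length v = sum_list ks"
  shows "alg_map S M (\<lambda>u. prod_list (map2 g ks (split_word ks u))) v =
    prod_list (map2 (\<lambda>k. alg_map S M (g k)) ks (split_word ks v))"
  using assms
proof (induction ks arbitrary: v)
  case Nil
  then show ?case by (simp add: alg_map_words)
next
  case (Cons k ks)
  define x y where "x = take k v" and "y = drop k v"
  have v: "v = x @ y" and lx: "length x = k" and ly: "length y = sum_list ks"
    using Cons.prems by (auto simp: x_def y_def)
  let ?P = "\<lambda>u. prod_list (map2 g ks (split_word ks u))"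
  have "alg_map S M (\<lambda>u. prod_list (map2 g (k # ks) (split_word (k # ks) u))) v =
    (\<Sum>a\<in>words S k. \<Sum>b\<in>words S (sum_list ks). (g k a * (\<Prod>i<k. M (a ! i) (x ! i))) *
      (?P b * (\<Prod>i<sum_list ks. M (b ! i) (y ! i))))"
    unfolding alg_map_words v length_append lx ly sum_words_add
  proof (intro sum.cong refl)
    fix a b assume "a \<in> words S k" "b \<in> words S (sum_list ks)"
    then have l: "length a = k" "length b = sum_list ks" by (auto simp: words_def)
    have "(\<Prod>i<k + sum_list ks. M ((a @ b) ! i) ((x @ y) ! i)) =
        (\<Prod>i<k. M ((a @ b) ! i) ((x @ y) ! i)) *
        (\<Prod>i<sum_list ks. M ((a @ b) ! (i + k)) ((x @ y) ! (i + k)))"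
      by (rule prod_lessThan_add)
    also have "\<dots> = (\<Prod>i<k. M (a ! i) (x ! i)) * (\<Prod>i<sum_list ks. M (b ! i) (y ! i))"
      using l lx by (intro arg_cong2[of _ _ _ _ "(*)"] prod.cong) (auto simp: nth_append)
    finally show "prod_list (map2 g (k # ks) (split_word (k # ks) (a @ b))) *
      (\<Prod>i<k + sum_list ks. M ((a @ b) ! i) ((x @ y) ! i)) =
      (g k a * (\<Prod>i<k. M (a ! i) (x ! i))) * (?P b * (\<Prod>i<sum_list ks. M (b ! i) (y ! i)))"
      using l by simp
  qed
  also have "\<dots> = alg_map S M (g k) x * alg_map S M ?P y"
    unfolding alg_map_words lx ly sum_product ..
  finally show ?case using Cons.IH[OF ly] by (simp add: v lx)
qed

section \<open>Matrices of forms\<close>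

text \<open>Matrices are functions of two indices, with the range of the summation index made explicit,
  since the index sets are subsets of a type that need not be finite.\<close>

definition mat_mult :: "'b set \<Rightarrow> ('a \<Rightarrow> 'b \<Rightarrow> complex) \<Rightarrow> ('b \<Rightarrow> 'c \<Rightarrow> complex) \<Rightarrow> 'a \<Rightarrow> 'c \<Rightarrow> complex" where
  "mat_mult S A B a c = (\<Sum>b\<in>S. A a b * B b c)"

definition mat_transpose :: "('a \<Rightarrow> 'b \<Rightarrow> complex) \<Rightarrow> 'b \<Rightarrow> 'a \<Rightarrow> complex" where
  "mat_transpose A b a = A a b"

definition diag_mat :: "'a set \<Rightarrow> ('a \<Rightarrow> complex) \<Rightarrow> 'a \<Rightarrow> 'a \<Rightarrow> complex" where
  "diag_mat S s a b = (if a = b \<and> a \<in> S then s a else 0)"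

definition supported :: "'a set \<Rightarrow> 'b set \<Rightarrow> ('a \<Rightarrow> 'b \<Rightarrow> complex) \<Rightarrow> bool" where
  "supported S T A \<longleftrightarrow> (\<forall>a b. A a b \<noteq> 0 \<longrightarrow> a \<in> S \<and> b \<in> T)"

lemma mat_mult_assoc: "mat_mult S (mat_mult T A B) C = mat_mult T A (mat_mult S B C)"
proof (intro ext)
  fix a c
  have "mat_mult S (mat_mult T A B) C a c = (\<Sum>b\<in>S. \<Sum>d\<in>T. A a d * (B d b * C b c))"
    by (simp add: mat_mult_def sum_distrib_right mult.assoc)
  also have "\<dots> = mat_mult T A (mat_mult S B C) a c"
    by (subst sum.swap) (simp add: mat_mult_def sum_distrib_left)
  finally show "mat_mult S (mat_mult T A B) C a c = mat_mult T A (mat_mult S B C) a c" .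
qed

lemma mat_mult_diag_left:
  assumes "finite S" "supported S T A"
  shows "mat_mult S (diag_mat S s) A a b = s a * A a b"
proof -
  have "mat_mult S (diag_mat S s) A a b = (\<Sum>c\<in>S. if c = a then s a * A a b else 0)"
    unfolding mat_mult_def by (rule sum.cong) (auto simp: diag_mat_def)
  then show ?thesis using assms by (auto simp: supported_def)
qed

lemma mat_mult_diag_right:
  assumes "finite T" "supported S T A"
  shows "mat_mult T A (diag_mat T s) a b = A a b * s b"
proof -
  have "mat_mult T A (diag_mat T s) a b = (\<Sum>c\<in>T. if c = b then A a b * s b else 0)"
    unfolding mat_mult_def by (rule sum.cong) (auto simp: diag_mat_def)
  then show ?thesis using assms by (auto simp: supported_def)
qed

lemma supported_mat_transpose: "supported S T A \<Longrightarrow> supported T S (mat_transpose A)"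
  by (auto simp: supported_def mat_transpose_def)

lemma supported_mat_mult:
  assumes "supported S T A" "supported T U B"
  shows "supported S U (mat_mult T A B)"
  unfolding supported_def mat_mult_def
proof (intro allI impI)
  fix a b assume "(\<Sum>c\<in>T. A a c * B c b) \<noteq> 0"
  then obtain c where "A a c * B c b \<noteq> 0" by (meson sum.neutral)
  then show "a \<in> S \<and> b \<in> U" using assms by (auto simp: supported_def)
qed

lemma mat_transpose_mult: "mat_transpose (mat_mult S A B) = mat_mult S (mat_transpose B) (mat_transpose A)"
  by (simp add: mat_transpose_def mat_mult_def fun_eq_iff mult.commute)

lemma mat_transpose_diag: "mat_transpose (diag_mat S s) = diag_mat S s"
  by (auto simp: mat_transpose_def diag_mat_def fun_eq_iff)

lemma linear_iso_inverse:
  assumes iso: "linear_iso p S p' S' \<phi>" and fin: "finite S" "finite S'"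
  shows "\<exists>\<psi>. supported S' S \<psi> \<and> mat_mult S \<psi> \<phi> = diag_mat S' (\<lambda>_. 1) \<and> mat_mult S' \<phi> \<psi> = diag_mat S (\<lambda>_. 1)"
proof -
  let ?F = "\<lambda>f d. \<Sum>c\<in>S. f c * \<phi> c d"
  let ?A = "{f. \<forall>c. f c \<noteq> 0 \<longrightarrow> c \<in> S}" and ?B = "{f. \<forall>d. f d \<noteq> 0 \<longrightarrow> d \<in> S'}"
  have bij: "bij_betw ?F ?A ?B" and sup: "supported S S' \<phi>"
    using iso by (auto simp: linear_iso_def supported_def)
  have "\<exists>f\<in>?A. ?F f = single d" if "d \<in> S'" for d
  proof -
    have "single d \<in> ?F ` ?A" using bij that by (auto simp: bij_betw_def single_def)
    then obtain f where "single d = ?F f" "f \<in> ?A" by (rule imageE)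
    then show ?thesis by (intro bexI[of _ f]) simp_all
  qed
  then have "\<forall>d\<in>S'. \<exists>f. f \<in> ?A \<and> ?F f = single d" by blast
  from bchoice[OF this] obtain \<psi>0
    where \<psi>0': "\<forall>d\<in>S'. \<psi>0 d \<in> ?A \<and> ?F (\<psi>0 d) = single d" ..
  then have \<psi>0: "\<psi>0 d \<in> ?A \<and> ?F (\<psi>0 d) = single d" if "d \<in> S'" for d using that by blast
  define \<psi> where "\<psi> d = (if d \<in> S' then \<psi>0 d else (\<lambda>_. 0))" for d
  have s\<psi>: "supported S' S \<psi>" using \<psi>0 by (auto simp: supported_def \<psi>_def split: if_splits)
  have 1: "mat_mult S \<psi> \<phi> = diag_mat S' (\<lambda>_. 1)"
  proof (intro ext)
    fix d d'
    show "mat_mult S \<psi> \<phi> d d' = diag_mat S' (\<lambda>_. 1) d d'"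
    proof (cases "d \<in> S'")
      case True
      then have "mat_mult S \<psi> \<phi> d d' = single d d'" using \<psi>0[OF True] by (simp add: mat_mult_def \<psi>_def fun_eq_iff)
      then show ?thesis using True by (auto simp: single_def diag_mat_def)
    qed (simp add: mat_mult_def \<psi>_def diag_mat_def)
  qed
  have 2: "mat_mult S' \<phi> \<psi> = diag_mat S (\<lambda>_. 1)"
  proof
    fix a
    show "mat_mult S' \<phi> \<psi> a = diag_mat S (\<lambda>_. 1) a"
    proof (rule inj_onD[OF bij_betw_imp_inj_on[OF bij]])
      have "mat_mult S (mat_mult S' \<phi> \<psi>) \<phi> = \<phi>"
        unfolding mat_mult_assoc 1 using mat_mult_diag_right[OF fin(2) sup] by (simp add: fun_eq_iff)
      moreover have "mat_mult S (diag_mat S (\<lambda>_. 1)) \<phi> = \<phi>"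
        using mat_mult_diag_left[OF fin(1) sup] by (simp add: fun_eq_iff)
      ultimately show "?F (mat_mult S' \<phi> \<psi> a) = ?F (diag_mat S (\<lambda>_. 1) a)"
        by (simp add: mat_mult_def fun_eq_iff)
      show "mat_mult S' \<phi> \<psi> a \<in> ?A" "diag_mat S (\<lambda>_. 1) a \<in> ?A"
        using supported_mat_mult[OF sup s\<psi>] by (auto simp: supported_def diag_mat_def split: if_splits)
    qed
  qed
  show ?thesis using s\<psi> 1 2 by blast
qed

text \<open>Here \<open>L\<close> is its own inverse up to the sign of the parity, by assumption \<open>LL\<close>.  Multiplying
  \<open>G g = -J\<close>, with \<open>J\<close> the diagonal matrix of parities, by \<open>\<phi>\<^sup>T\<close> and inserting \<open>\<phi> \<psi> = 1\<close> gives
  \<open>L (\<psi> g) = -\<phi>\<^sup>T J\<close>, which determines \<open>\<psi> g\<close> and thus \<open>g\<close>.  The equivalence has the shape of the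
  definite description that defines the inverse form.\<close>

lemma inverse_pulled_back_form:
  fixes \<phi> :: "'b \<Rightarrow> 'd \<Rightarrow> complex"
  assumes iso: "linear_iso p S p' S' \<phi>" and fin: "finite S" "finite S'"
    and G: "supported S S G" and L: "supported S' S' L"
    and pull: "L = mat_mult S (mat_transpose \<phi>) (mat_mult S G \<phi>)"
    and LL: "mat_mult S' L L = diag_mat S' (\<lambda>d. - psign (p' d))"
  shows "supported S S g \<and> mat_mult S G g = diag_mat S (\<lambda>a. - psign (p a)) \<longleftrightarrow>
    g = mat_mult S' \<phi> (mat_mult S' L (mat_transpose \<phi>))"
proof -
  have sup: "supported S S' \<phi>" and par: "\<And>c d. \<phi> c d \<noteq> 0 \<Longrightarrow> p c = p' d"
    using iso by (auto simp: linear_iso_def supported_def)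
  obtain \<psi> where \<psi>: "supported S' S \<psi>" "mat_mult S \<psi> \<phi> = diag_mat S' (\<lambda>_. 1)" "mat_mult S' \<phi> \<psi> = diag_mat S (\<lambda>_. 1)"
    using linear_iso_inverse[OF iso fin] by blast
  let ?t = "mat_transpose \<phi>"
  let ?g = "mat_mult S' \<phi> (mat_mult S' L ?t)"
  have st: "supported S' S ?t" using sup by (rule supported_mat_transpose)
  have idl: "mat_mult S (diag_mat S (\<lambda>_. 1)) A = A" if "supported S T A" for A :: "'b \<Rightarrow> 'x \<Rightarrow> complex" and T
    using mat_mult_diag_left[OF fin(1) that] by (simp add: fun_eq_iff)
  have idl': "mat_mult S' (diag_mat S' (\<lambda>_. 1)) A = A" if "supported S' T A" for A :: "'d \<Rightarrow> 'x \<Rightarrow> complex" and T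
    using mat_mult_diag_left[OF fin(2) that] by (simp add: fun_eq_iff)
  have idr: "mat_mult S A (diag_mat S (\<lambda>_. 1)) = A" if "supported T S A" for A :: "'x \<Rightarrow> 'b \<Rightarrow> complex" and T
    using mat_mult_diag_right[OF fin(1) that] by (simp add: fun_eq_iff)
  have L\<psi>: "mat_mult S' L \<psi> = mat_mult S ?t G"
    unfolding pull mat_mult_assoc \<psi>(3) idr[OF G] ..
  have J: "mat_mult S' (diag_mat S' (\<lambda>d. - psign (p' d))) ?t = mat_mult S ?t (diag_mat S (\<lambda>a. - psign (p a)))"
  proof (intro ext)
    fix d a
    show "mat_mult S' (diag_mat S' (\<lambda>d. - psign (p' d))) ?t d a = mat_mult S ?t (diag_mat S (\<lambda>a. - psign (p a))) d a"
      unfolding mat_mult_diag_left[OF fin(2) st] mat_mult_diag_right[OF fin(1) st] mat_transpose_def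
      using par[of a d] by (cases "\<phi> a d = 0") simp_all
  qed
  have t\<psi>: "mat_mult S' (mat_transpose \<psi>) ?t = diag_mat S (\<lambda>_. 1)"
    unfolding mat_transpose_mult[symmetric] \<psi>(3) mat_transpose_diag ..
  have sg: "supported S S ?g" by (intro supported_mat_mult[OF sup] supported_mat_mult[OF L] st)
  have sJ: "supported S S (diag_mat S (\<lambda>a. - psign (p a)))" by (auto simp: supported_def diag_mat_def)
  \<comment> \<open>the matrix \<open>?t\<close> is invertible\<close>
  have inj: "A = B" if "mat_mult S ?t A = mat_mult S ?t B" "supported S S A" "supported S S B" for A B
    using arg_cong[OF that(1), of "mat_mult S' (mat_transpose \<psi>)"]
    unfolding mat_mult_assoc[symmetric] t\<psi> idl[OF that(2)] idl[OF that(3)] .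
  have ok: "mat_mult S G ?g = diag_mat S (\<lambda>a. - psign (p a))"
  proof (rule inj)
    have "mat_mult S ?t (mat_mult S G ?g) = mat_mult S (mat_mult S' L \<psi>) ?g" unfolding L\<psi> mat_mult_assoc ..
    also have "\<dots> = mat_mult S' L (mat_mult S' (mat_mult S \<psi> \<phi>) (mat_mult S' L ?t))" unfolding mat_mult_assoc ..
    also have "\<dots> = mat_mult S' (mat_mult S' L L) ?t"
      unfolding \<psi>(2) idl'[OF supported_mat_mult[OF L st]] mat_mult_assoc ..
    finally show "mat_mult S ?t (mat_mult S G ?g) = mat_mult S ?t (diag_mat S (\<lambda>a. - psign (p a)))"
      unfolding LL J .
  qed (use supported_mat_mult[OF G sg] sJ in auto)
  have uniq: "g = ?g" if g: "supported S S g" "mat_mult S G g = diag_mat S (\<lambda>a. - psign (p a))" for g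
  proof -
    have s2: "supported S' S (mat_mult S \<psi> g)" "supported S' S (mat_mult S \<psi> ?g)"
      using supported_mat_mult[OF \<psi>(1)] g(1) sg by blast+
    have key: "mat_mult S' L (mat_mult S \<psi> A) = mat_mult S ?t (mat_mult S G A)" for A :: "'b \<Rightarrow> 'b \<Rightarrow> complex"
      unfolding mat_mult_assoc[of S S' L \<psi> A, symmetric] L\<psi> mat_mult_assoc ..
    have "mat_mult S' L (mat_mult S \<psi> g) = mat_mult S' L (mat_mult S \<psi> ?g)" unfolding key g(2) ok ..
    then have "mat_mult S' (mat_mult S' L L) (mat_mult S \<psi> g) = mat_mult S' (mat_mult S' L L) (mat_mult S \<psi> ?g)"
      unfolding mat_mult_assoc by simp
    then have "- psign (p' d) * mat_mult S \<psi> g d b = - psign (p' d) * mat_mult S \<psi> ?g d b" for d b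
      unfolding LL using mat_mult_diag_left[OF fin(2)] s2 by metis
    then have "mat_mult S \<psi> g = mat_mult S \<psi> ?g" by (simp add: fun_eq_iff)
    then have "mat_mult S' \<phi> (mat_mult S \<psi> g) = mat_mult S' \<phi> (mat_mult S \<psi> ?g)" by simp
    then show ?thesis
      unfolding mat_mult_assoc[symmetric] \<psi>(3) idl[OF g(1)] using idl[OF sg]
      by (simp add: mat_mult_assoc)
  qed
  show ?thesis using uniq ok sg by blast
qed

section \<open>Change of letters in contractions\<close>

text \<open>The change of letters acts on both ends of every chord.\<close>

lemma sum_words_pair_prod:
  assumes "even (length u)"
  shows "(\<Sum>v\<in>words S' (length u). (\<Prod>i<length u. \<phi> (u ! i) (v ! i)) * pair_prod g v) =
    pair_prod (mat_mult S' \<phi> (mat_mult S' g (mat_transpose \<phi>))) u"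
  using assms
proof (induction u rule: induct_list012)
  case (3 x y u)
  let ?P = "\<lambda>v. (\<Prod>i<length u. \<phi> (u ! i) (v ! i)) * pair_prod g v"
  have "(\<Sum>v\<in>words S' (length (x # y # u)). (\<Prod>i<length (x # y # u). \<phi> ((x # y # u) ! i) (v ! i)) *
      pair_prod g v) =
    (\<Sum>c\<in>S'. \<Sum>d\<in>S'. \<Sum>v\<in>words S' (length u). (\<phi> x c * (g c d * \<phi> y d)) * ?P v)"
    by (simp add: sum_words_Suc prod.lessThan_Suc_shift mult_ac del: prod.lessThan_Suc)
  also have "\<dots> = (\<Sum>c\<in>S'. \<Sum>d\<in>S'. \<phi> x c * (g c d * \<phi> y d)) * (\<Sum>v\<in>words S' (length u). ?P v)"
    by (simp only: sum_distrib_left[symmetric] sum_distrib_right[symmetric])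
  also have "(\<Sum>c\<in>S'. \<Sum>d\<in>S'. \<phi> x c * (g c d * \<phi> y d)) = mat_mult S' \<phi> (mat_mult S' g (mat_transpose \<phi>)) x y"
    by (simp add: mat_mult_def mat_transpose_def sum_distrib_left)
  finally show ?case using 3 by simp
qed auto

lemma kappa_alg_map:
  assumes fin: "finite S" "finite S'" and \<phi>: "supported S S' \<phi>"
    and f: "\<And>u. f u \<noteq> 0 \<Longrightarrow> u \<in> words S L" and L: "even L"
  shows "kappa g (alg_map S \<phi> f) = kappa (mat_mult S' \<phi> (mat_mult S' g (mat_transpose \<phi>))) f"
proof -
  have "kappa g (alg_map S \<phi> f) = (\<Sum>v\<in>words S' L. alg_map S \<phi> f v * pair_prod g v)"
  proof (rule kappa_finite)
    fix v assume "alg_map S \<phi> f v \<noteq> 0"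
    then obtain u where u: "u \<in> words S (length v)" "f u * (\<Prod>i<length v. \<phi> (u ! i) (v ! i)) \<noteq> 0"
      unfolding alg_map_words by (meson sum.neutral)
    then have "length v = L" using f[of u] by (auto simp: words_def)
    moreover have "v ! i \<in> S'" if "i < length v" for i
      using u(2) that \<phi> by (auto simp: prod_zero_iff supported_def)
    ultimately show "v \<in> words S' L" by (auto simp: words_def in_set_conv_nth)
  qed (use fin in simp)
  also have "\<dots> = (\<Sum>v\<in>words S' L. \<Sum>u\<in>words S L. f u * ((\<Prod>i<L. \<phi> (u ! i) (v ! i)) * pair_prod g v))"
    by (rule sum.cong) (auto simp: alg_map_words words_def sum_distrib_right mult.assoc)
  also have "\<dots> = (\<Sum>u\<in>words S L. \<Sum>v\<in>words S' L. f u * ((\<Prod>i<L. \<phi> (u ! i) (v ! i)) * pair_prod g v))"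
    by (rule sum.swap)
  also have "\<dots> = (\<Sum>u\<in>words S L. f u * pair_prod (mat_mult S' \<phi> (mat_mult S' g (mat_transpose \<phi>))) u)"
  proof (rule sum.cong)
    fix u assume "u \<in> words S L"
    then have "length u = L" by (simp add: words_def)
    then show "(\<Sum>v\<in>words S' L. f u * ((\<Prod>i<L. \<phi> (u ! i) (v ! i)) * pair_prod g v)) =
        f u * pair_prod (mat_mult S' \<phi> (mat_mult S' g (mat_transpose \<phi>))) u"
      using sum_words_pair_prod[where u = u and S' = S' and \<phi> = \<phi> and g = g] L by (simp add: sum_distrib_left[symmetric])
  qed simp
  also have "\<dots> = kappa (mat_mult S' \<phi> (mat_mult S' g (mat_transpose \<phi>))) f"
    by (rule kappa_finite[symmetric]) (use fin f in auto)
  finally show ?thesis .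
qed

section \<open>Cyclic sums of noncommutative forms\<close>

lemma cspan_zero: "(\<lambda>_. 0) \<in> cspan G"
  unfolding cspan_def by (intro CollectI exI[of _ "{}"]) auto

lemma cspan_diff:
  assumes "f \<in> cspan G" "g \<in> cspan G"
  shows "(\<lambda>x. f x - g x) \<in> cspan G"
proof -
  obtain s a where f: "finite s" "s \<subseteq> G" "f = (\<lambda>x. \<Sum>h\<in>s. a h * h x)"
    using assms(1) by (auto simp: cspan_def)
  obtain t b where g: "finite t" "t \<subseteq> G" "g = (\<lambda>x. \<Sum>h\<in>t. b h * h x)"
    using assms(2) by (auto simp: cspan_def)
  let ?a = "\<lambda>h. if h \<in> s then a h else 0" and ?b = "\<lambda>h. if h \<in> t then b h else 0"
  have "f x - g x = (\<Sum>h\<in>s \<union> t. (?a h - ?b h) * h x)" for x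
  proof -
    have "f x = (\<Sum>h\<in>s \<union> t. ?a h * h x)"
      unfolding f(3) by (rule sum.mono_neutral_cong_left) (use f g in auto)
    moreover have "g x = (\<Sum>h\<in>s \<union> t. ?b h * h x)"
      unfolding g(3) by (rule sum.mono_neutral_cong_left) (use f g in auto)
    ultimately show ?thesis by (simp add: sum_subtractf left_diff_distrib)
  qed
  then show ?thesis unfolding cspan_def
    using f g by (intro CollectI exI[of _ "s \<union> t"] exI[of _ "\<lambda>h. ?a h - ?b h"]) auto
qed

lemma comm_closure_zero: "(\<lambda>_. 0) \<in> comm_closure p S"
  by (simp add: comm_closure_def cspan_zero)

lemma comm_closure_diff:
  assumes "f \<in> comm_closure p S" "g \<in> comm_closure p S"
  shows "(\<lambda>x. f x - g x) \<in> comm_closure p S"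
  unfolding comm_closure_def
proof (intro CollectI allI)
  fix n
  have "(\<lambda>w. if length w = n then f w - g w else 0) =
      (\<lambda>w. (if length w = n then f w else 0) - (if length w = n then g w else 0))"
    by auto
  moreover have "(\<lambda>w. if length w = n then f w else 0) \<in> cspan (commutators p S n)"
    "(\<lambda>w. if length w = n then g w else 0) \<in> cspan (commutators p S n)"
    using assms by (simp_all add: comm_closure_def)
  ultimately show "(\<lambda>w. if length w = n then f w - g w else 0) \<in> cspan (commutators p S n)"
    using cspan_diff by (simp only:)
qed

lemma dr_class_self: "f \<in> forms S n \<Longrightarrow> f \<in> dr_class p S n f"
  by (simp add: dr_class_def comm_closure_zero)

lemma dr_class_eq:
  assumes "f \<in> dr_class p S n g"
  shows "dr_class p S n f = dr_class p S n g"
proof -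
  have fg: "(\<lambda>w. f w - g w) \<in> comm_closure (fpar p) (S <+> S)" using assms by (simp add: dr_class_def)
  have gf: "(\<lambda>w. g w - f w) \<in> comm_closure (fpar p) (S <+> S)"
    using comm_closure_diff[OF comm_closure_zero fg] by simp
  have "(\<lambda>w. h w - f w) \<in> comm_closure (fpar p) (S <+> S) \<longleftrightarrow>
      (\<lambda>w. h w - g w) \<in> comm_closure (fpar p) (S <+> S)" for h
    using comm_closure_diff[of "\<lambda>w. h w - f w" _ _ "\<lambda>w. g w - f w"]
      comm_closure_diff[of "\<lambda>w. h w - g w" _ _ "\<lambda>w. f w - g w"] fg gf by auto
  then show ?thesis by (simp add: dr_class_def)
qed

lemma dr_class_Ncyc: "f \<in> dr_class p S n g \<Longrightarrow> Ncyc (fpar p) f = Ncyc (fpar p) g"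
  unfolding dr_class_def by (blast intro: Ncyc_class_cong)

lemma cyc_class_Ncyc: "f \<in> cyc_class p S g \<Longrightarrow> Ncyc p f = Ncyc p g"
  unfolding cyc_class_def by (blast intro: Ncyc_class_cong)

lemma fpar_simps [simp]: "fpar p (Inl a) = p a" "fpar p (Inr a) = (\<not> p a)"
  by (simp_all add: fpar_def)

lemma wpar_map_Inl [simp]: "wpar (fpar p) (map Inl y) = wpar p y"
  by (induction y) auto

lemma emb_map_Inl [simp]: "emb f (map Inl w) = f w"
  by (simp add: emb_def list_all_iff o_def)

lemma emb_nonzero: "emb f u \<noteq> 0 \<Longrightarrow> \<exists>w. u = map Inl w \<and> f w \<noteq> 0"
proof -
  assume e: "emb f u \<noteq> 0"
  then have "list_all isl u" "f (map projl u) \<noteq> 0" by (auto simp: emb_def split: if_splits)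
  moreover have "list_all isl u \<Longrightarrow> u = map Inl (map projl u)"
    by (induction u) auto
  ultimately show ?thesis by blast
qed

lemma Ncyc_pair: "Ncyc p f [x, y] = f [x, y] + psign (p x \<and> p y) * f [y, x]"
  by (simp add: Ncyc_rotations lessThan_Suc numeral_2_eq_2)

text \<open>The differential of a generator is a single letter, so only factors of length 1 contribute to the
  derivation.\<close>

lemma dform_alt:
  assumes S: "finite S"
  shows "dform p S f u = (\<Sum>j<length u. case u ! j of Inl _ \<Rightarrow> 0 | Inr b \<Rightarrow>
    if b \<in> S then psign (wpar (fpar p) (take j u)) * f (take j u @ Inl b # drop (Suc j) u) else 0)"
    (is "_ = (\<Sum>j<length u. ?R j)")
proof -
  let ?n = "length u"
  let ?Y = "case_sum (\<lambda>b. single [Inr b]) (\<lambda>b u. 0)"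
  let ?T = "\<lambda>i j. \<Sum>c\<in>S <+> S. (let v = take (j - i) (drop i u) in
        psign ((fpar p c \<noteq> wpar (fpar p) v) \<and> wpar (fpar p) (take i u)) * ?Y c v *
          f (take i u @ [c] @ drop j u))"
  have T: "?T i j = (if j = Suc i then ?R i else 0)" if ij: "i \<le> ?n" "j \<in> {i..?n}" for i j
  proof -
    let ?v = "take (j - i) (drop i u)"
    have lv: "length ?v = j - i" using ij by auto
    have "?T i j = (\<Sum>b\<in>S. psign ((p b \<noteq> wpar (fpar p) ?v) \<and> wpar (fpar p) (take i u)) *
        single [Inr b] ?v * f (take i u @ Inl b # drop j u))"
      unfolding Let_def using S by (simp add: sum.Plus)
    also have "\<dots> = (if j = Suc i then ?R i else 0)"
    proof (cases "j = Suc i")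
      case True
      then have v: "?v = [u ! i]" using ij by (auto simp: take_Suc_conv_app_nth hd_drop_conv_nth take_Suc)
      show ?thesis
      proof (cases "u ! i")
        case (Inl b)
        then show ?thesis using True v by (simp add: single_def)
      next
        case (Inr b)
        have "(\<Sum>b'\<in>S. psign ((p b' \<noteq> wpar (fpar p) ?v) \<and> wpar (fpar p) (take i u)) *
          single [Inr b'] ?v * f (take i u @ Inl b' # drop j u)) =
          (\<Sum>b'\<in>S. if b' = b then psign (wpar (fpar p) (take i u)) * f (take i u @ Inl b # drop j u) else 0)"
          unfolding v Inr by (intro sum.cong refl) (auto simp: single_def)
        then show ?thesis using True Inr S by simp
      qed
    next
      case False
      then have "length ?v \<noteq> 1" using lv ij by auto
      then have "?v \<noteq> [x]" for x by (metis length_Cons list.size(3) One_nat_def)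
      then show ?thesis using False by (simp add: single_def)
    qed
    finally show ?thesis .
  qed
  have "dform p S f u = (\<Sum>i\<le>?n. \<Sum>j\<in>{i..?n}. ?T i j)"
    by (simp add: dform_def derivation_ext_def)
  also have "\<dots> = (\<Sum>i\<le>?n. \<Sum>j\<in>{i..?n}. if j = Suc i then ?R i else 0)"
    using T by (intro sum.cong refl) simp
  also have "\<dots> = (\<Sum>i\<le>?n. if Suc i \<le> ?n then ?R i else 0)"
    by (intro sum.cong refl) simp
  also have "\<dots> = (\<Sum>i<?n. ?R i)"
    by (rule sum.mono_neutral_cong_right) auto
  finally show ?thesis .
qed

text \<open>A word with the only letter \<open>da\<close> comes from differentiating the letter \<open>a\<close> in this place.\<close>

lemma dform_emb_word:
  assumes S: "finite S" and a: "a \<in> S"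
  shows "dform p S (emb f) (map Inl y @ Inr a # map Inl x) = psign (wpar p y) * f (y @ a # x)"
proof -
  let ?u = "map Inl y @ Inr a # map Inl x"
  let ?R = "\<lambda>j. case ?u ! j of Inl _ \<Rightarrow> 0 | Inr b \<Rightarrow>
    if b \<in> S then psign (wpar (fpar p) (take j ?u)) * emb f (take j ?u @ Inl b # drop (Suc j) ?u) else 0"
  have "dform p S (emb f) ?u = (\<Sum>j<length ?u. ?R j)" by (rule dform_alt[OF S])
  also have "\<dots> = (\<Sum>j\<in>{length y}. ?R j)"
  proof (rule sum.mono_neutral_right)
    show "\<forall>j\<in>{..<length ?u} - {length y}. ?R j = 0"
    proof
      fix j assume j: "j \<in> {..<length ?u} - {length y}"
      have "\<exists>b. ?u ! j = Inl b"
      proof (cases "j < length y")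
        case False
        then have "j - length y \<noteq> 0" using j by auto
        then obtain k where k: "j - length y = Suc k" using not0_implies_Suc by blast
        moreover have "k < length x" using j k by auto
        ultimately show ?thesis using j False by (simp add: nth_append)
      qed (simp add: nth_append)
      then show "?R j = 0" by auto
    qed
  qed auto
  also have "\<dots> = psign (wpar p y) * emb f (map Inl (y @ a # x))"
    using a by (simp add: nth_append)
  finally show ?thesis by (simp only: emb_map_Inl)
qed

text \<open>The map \<open>\<Theta>\<^sup>-\<^sup>1 \<circ> d\<close> is the cyclic sum: the sign of \<open>d\<close> passing the letters in front of \<open>a\<close> is
  the one by which \<open>da\<close> and \<open>a\<close> differ when they are rotated to the front.\<close>

lemma Ncyc_dform_emb:
  assumes S: "finite S" and a: "a \<in> S"
  shows "Ncyc (fpar p) (dform p S (emb f)) (Inr a # map Inl v) = Ncyc p f (a # v)"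
proof -
  have "dform p S (emb f) (Inr a # map Inl v) = f (a # v)"
    using dform_emb_word[OF S a, of p f "[]" v] by simp
  moreover have "psign (wpar (fpar p) (take (Suc t) (Inr a # map Inl v)) \<and>
        wpar (fpar p) (drop (Suc t) (Inr a # map Inl v))) *
      dform p S (emb f) (drop (Suc t) (Inr a # map Inl v) @ take (Suc t) (Inr a # map Inl v)) =
    psign (wpar p (take (Suc t) (a # v)) \<and> wpar p (drop (Suc t) (a # v))) *
      f (drop (Suc t) (a # v) @ take (Suc t) (a # v))" for t
  proof -
    have w: "drop (Suc t) (Inr a # map Inl v) @ take (Suc t) (Inr a # map Inl v) =
        map Inl (drop t v) @ Inr a # map Inl (take t v)"
      by (simp add: drop_map take_map)
    have pt: "wpar (fpar p) (take (Suc t) (Inr a # map Inl v)) = ((\<not> p a) \<noteq> wpar p (take t v))"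
      by (simp add: take_map)
    have pd: "wpar (fpar p) (drop (Suc t) (Inr a # map Inl v)) = wpar p (drop t v)"
      by (simp add: drop_map)
    show ?thesis unfolding w pt pd dform_emb_word[OF S a] by (simp add: psign_def)
  qed
  ultimately show ?thesis
    by (simp add: Ncyc_rotations sum.lessThan_Suc_shift del: sum.lessThan_Suc take_Suc_Cons drop_Suc_Cons)
qed

text \<open>For an odd vector field the contraction is an even derivation, which explains the absence of
  signs; on a word of length 2 it replaces either the first or the second letter.\<close>

lemma contraction_length_two:
  assumes S: "finite S" and f: "\<And>w. f w \<noteq> 0 \<Longrightarrow> length w = 2"
    and par: "\<And>b w. b \<in> S \<Longrightarrow> emb (\<xi> (single [b])) w \<noteq> 0 \<Longrightarrow> wpar (fpar p) w = (\<not> p b)"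
    and u: "u \<noteq> []"
  shows "contraction p S \<xi> f u =
    (\<Sum>b\<in>S. emb (\<xi> (single [b])) (butlast u) * f [Inr b, last u]) +
    (\<Sum>b\<in>S. emb (\<xi> (single [b])) (tl u) * f [hd u, Inr b])"
proof -
  let ?n = "length u"
  let ?Y = "case_sum (\<lambda>b u. 0) (\<lambda>b. emb (\<xi> (single [b])))"
  let ?T = "\<lambda>i j. \<Sum>c\<in>S <+> S. (let v = take (j - i) (drop i u) in
        psign ((fpar p c \<noteq> wpar (fpar p) v) \<and> wpar (fpar p) (take i u)) * ?Y c v *
          f (take i u @ [c] @ drop j u))"
  have n: "?n \<ge> 1" using u by (cases u) auto
  have T0: "?T i j = 0" if "i \<le> ?n" "j \<in> {i..?n}" "(i, j) \<noteq> (0, ?n - 1)" "(i, j) \<noteq> (1, ?n)" for i j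
  proof -
    have "length (take i u @ [c] @ drop j u) \<noteq> 2" for c using that n by auto
    then have "f (take i u @ [c] @ drop j u) = 0" for c using f by blast
    then show ?thesis by simp
  qed
  have "contraction p S \<xi> f u = (\<Sum>i\<le>?n. \<Sum>j\<in>{i..?n}. ?T i j)"
    by (simp add: contraction_def derivation_ext_def)
  also have "\<dots> = (\<Sum>(i, j)\<in>Sigma {..?n} (\<lambda>i. {i..?n}). ?T i j)"
    by (rule sum.Sigma) auto
  also have "\<dots> = (\<Sum>(i, j)\<in>{(0, ?n - 1), (1, ?n)}. ?T i j)"
  proof (rule sum.mono_neutral_right)
    show "\<forall>x\<in>Sigma {..?n} (\<lambda>i. {i..?n}) - {(0, ?n - 1), (1, ?n)}. (case x of (i, j) \<Rightarrow> ?T i j) = 0"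
    proof
      fix x assume x: "x \<in> Sigma {..?n} (\<lambda>i. {i..?n}) - {(0, ?n - 1), (1, ?n)}"
      obtain i j where ij: "x = (i, j)" by fastforce
      have "?T i j = 0" by (rule T0) (use x ij in auto)
      then show "(case x of (i, j) \<Rightarrow> ?T i j) = 0" unfolding ij by simp
    qed
  qed (use n in auto)
  also have "\<dots> = ?T 0 (?n - 1) + ?T 1 ?n" using n by simp
  also have "?T 0 (?n - 1) = (\<Sum>b\<in>S. emb (\<xi> (single [b])) (butlast u) * f [Inr b, last u])"
  proof -
    have "drop (?n - 1) u = [last u]" using u
      by (metis append_butlast_last_id append_eq_conv_conj length_butlast)
    then show ?thesis unfolding Let_def using S
      by (simp add: sum.Plus butlast_conv_take)
  qed
  also have "?T 1 ?n = (\<Sum>b\<in>S. emb (\<xi> (single [b])) (tl u) * f [hd u, Inr b])"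
  proof -
    have t: "take (?n - 1) (drop 1 u) = tl u" "take 1 u = [hd u]" using u by (cases u; simp)+
    have "?T 1 ?n = (\<Sum>b\<in>S. psign (((\<not> p b) \<noteq> wpar (fpar p) (tl u)) \<and> wpar (fpar p) [hd u]) *
        emb (\<xi> (single [b])) (tl u) * f [hd u, Inr b])"
      unfolding Let_def t using S by (simp add: sum.Plus)
    also have "\<dots> = (\<Sum>b\<in>S. emb (\<xi> (single [b])) (tl u) * f [hd u, Inr b])"
    proof (intro sum.cong refl)
      fix b assume "b \<in> S"
      then show "psign (((\<not> p b) \<noteq> wpar (fpar p) (tl u)) \<and> wpar (fpar p) [hd u]) *
        emb (\<xi> (single [b])) (tl u) * f [hd u, Inr b] =
        emb (\<xi> (single [b])) (tl u) * f [hd u, Inr b]"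
        using par[of b "tl u"] by (cases "emb (\<xi> (single [b])) (tl u) = 0") auto
    qed
    finally show ?thesis .
  qed
  finally show ?thesis .
qed

definition quadratic :: "'b set \<Rightarrow> 'b form \<Rightarrow> bool" where
  "quadratic S f \<longleftrightarrow> (\<forall>w. f w \<noteq> 0 \<longrightarrow> (\<exists>a\<in>S. \<exists>b\<in>S. w = [Inr a, Inr b]))"

text \<open>The part of being an odd super derivation that is visible in the values on the generators.\<close>

definition odd_field :: "('b \<Rightarrow> bool) \<Rightarrow> 'b set \<Rightarrow> ('b tensor \<Rightarrow> 'b tensor) \<Rightarrow> bool" where
  "odd_field p S \<xi> \<longleftrightarrow> (\<forall>b\<in>S. \<forall>w. \<xi> (single [b]) w \<noteq> 0 \<longrightarrow> set w \<subseteq> S \<and> wpar p w = (\<not> p b))"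

lemma contraction_quadratic:
  assumes S: "finite S" and f: "quadratic S f" and \<xi>: "odd_field p S \<xi>" and u: "u \<noteq> []"
  shows "contraction p S \<xi> f u =
    (\<Sum>b\<in>S. emb (\<xi> (single [b])) (butlast u) * f [Inr b, last u]) +
    (\<Sum>b\<in>S. emb (\<xi> (single [b])) (tl u) * f [hd u, Inr b])"
proof (rule contraction_length_two[OF S _ _ u])
  show "length w = 2" if "f w \<noteq> 0" for w using that f by (auto simp: quadratic_def)
  show "wpar (fpar p) w = (\<not> p b)" if "b \<in> S" "emb (\<xi> (single [b])) w \<noteq> 0" for b w
    using emb_nonzero[OF that(2)] \<xi> that(1) by (auto simp: odd_field_def)
qed

lemma contraction_forms:
  assumes S: "finite S" and f: "quadratic S f" and \<xi>: "odd_field p S \<xi>"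
  shows "contraction p S \<xi> f \<in> forms S 1"
proof -
  have *: "set u \<subseteq> S <+> S \<and> length (filter (\<lambda>c. \<not> isl c) u) = 1"
    if c: "contraction p S \<xi> f u \<noteq> 0" for u
  proof (cases "u = []")
    case True
    have "f [c] = 0" for c using f by (auto simp: quadratic_def)
    then have "contraction p S \<xi> f u = 0"
      by (simp add: True contraction_def derivation_ext_def)
    then show ?thesis using c by simp
  next
    case False
    have fl: "filter (\<lambda>c. \<not> isl c) (map Inl w) = []" for w :: "'a list" by (induction w) auto
    consider b where "b \<in> S" "emb (\<xi> (single [b])) (butlast u) * f [Inr b, last u] \<noteq> 0"
      | b where "b \<in> S" "emb (\<xi> (single [b])) (tl u) * f [hd u, Inr b] \<noteq> 0"
      using c unfolding contraction_quadratic[OF S f \<xi> False]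
      by (metis (no_types, lifting) add_0 sum.neutral)
    then show ?thesis
    proof cases
      case 1
      then obtain w y where "butlast u = map Inl w" "set w \<subseteq> S" "last u = Inr y" "y \<in> S"
        using emb_nonzero[of "\<xi> (single [b])" "butlast u"] f \<xi>
        by (fastforce simp: quadratic_def odd_field_def)
      then have "u = map Inl w @ [Inr y]" using False by (metis append_butlast_last_id)
      then show ?thesis using \<open>set w \<subseteq> S\<close> \<open>y \<in> S\<close> by (auto simp: fl)
    next
      case 2
      then obtain w y where "tl u = map Inl w" "set w \<subseteq> S" "hd u = Inr y" "y \<in> S"
        using emb_nonzero[of "\<xi> (single [b])" "tl u"] f \<xi>
        by (fastforce simp: quadratic_def odd_field_def)
      then have "u = Inr y # map Inl w" using False by (metis list.collapse)
      then show ?thesis using \<open>set w \<subseteq> S\<close> \<open>y \<in> S\<close> by (auto simp: fl)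
    qed
  qed
  then show ?thesis by (auto simp: forms_def tensors_def lists_eq_set)
qed

text \<open>Only two rotations of a word \<open>da v\<close> carry \<open>da\<close> at one end, as the contraction of \<open>db dc\<close> requires.
  They pick up the two entries of \<open>f\<close> that make up its Gram matrix.\<close>

lemma Ncyc_contraction:
  assumes S: "finite S" and f: "quadratic S f" and \<xi>: "odd_field p S \<xi>"
    and a: "a \<in> S" and v: "v \<noteq> []"
  shows "Ncyc (fpar p) (contraction p S \<xi> f) (Inr a # map Inl v) =
    (\<Sum>b\<in>S. \<xi> (single [b]) v * Ncyc (fpar p) f [Inr a, Inr b])"
proof -
  let ?C = "contraction p S \<xi> f" and ?u = "Inr a # map Inl v :: ('a + 'a) list"
  let ?g = "\<lambda>s. psign (wpar (fpar p) (take s ?u) \<and> wpar (fpar p) (drop s ?u)) * ?C (drop s ?u @ take s ?u)"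
  have fz: "f [c, Inl x] = 0" "f [Inl x, c] = 0" for c x using f by (auto simp: quadratic_def)
  have g0: "?g 0 = (\<Sum>b\<in>S. \<xi> (single [b]) v * f [Inr a, Inr b])"
    using v by (simp add: contraction_quadratic[OF S f \<xi>] last_map fz)
  have g1: "?g (Suc 0) = psign (\<not> p a \<and> wpar p v) * (\<Sum>b\<in>S. \<xi> (single [b]) v * f [Inr b, Inr a])"
    using v by (simp add: contraction_quadratic[OF S f \<xi>] hd_append hd_map fz)
  have gS: "?g (Suc (Suc t)) = 0" if t: "Suc t < length v" for t
  proof -
    have w: "drop (Suc (Suc t)) ?u @ take (Suc (Suc t)) ?u =
        map Inl (drop (Suc t) v) @ Inr a # map Inl (take (Suc t) v)"
      by (simp add: drop_map take_map)
    have ne: "drop (Suc t) v \<noteq> []" "take (Suc t) v \<noteq> []" using t by auto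
    show ?thesis unfolding w using ne
      by (simp add: contraction_quadratic[OF S f \<xi>] hd_append hd_map last_map fz)
  qed
  obtain k where k: "length v = Suc k" using v by (cases v) auto
  have "Ncyc (fpar p) ?C ?u = (\<Sum>s<Suc (Suc k). ?g s)" by (simp add: Ncyc_rotations k)
  also have "\<dots> = ?g 0 + (?g (Suc 0) + (\<Sum>t<k. ?g (Suc (Suc t))))"
    by (simp only: sum.lessThan_Suc_shift)
  also have "(\<Sum>t<k. ?g (Suc (Suc t))) = 0" using gS k by (intro sum.neutral) simp
  finally have "Ncyc (fpar p) ?C ?u = (\<Sum>b\<in>S. \<xi> (single [b]) v * f [Inr a, Inr b] +
      psign (\<not> p a \<and> wpar p v) * (\<xi> (single [b]) v * f [Inr b, Inr a]))"
    unfolding g0 g1 by (simp add: sum.distrib sum_distrib_left)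
  also have "\<dots> = (\<Sum>b\<in>S. \<xi> (single [b]) v * Ncyc (fpar p) f [Inr a, Inr b])"
  proof (intro sum.cong refl)
    fix b assume "b \<in> S"
    then show "\<xi> (single [b]) v * f [Inr a, Inr b] +
      psign (\<not> p a \<and> wpar p v) * (\<xi> (single [b]) v * f [Inr b, Inr a]) =
      \<xi> (single [b]) v * Ncyc (fpar p) f [Inr a, Inr b]"
      using \<xi> by (cases "\<xi> (single [b]) v = 0") (auto simp: Ncyc_pair odd_field_def algebra_simps)
  qed
  finally show ?thesis .
qed

lemma dform_Theta_pair:
  assumes "finite S" "a \<in> S" "b \<in> S"
  shows "dform p S (Theta y) [Inr a, Inr b] = - psign (p a) * y [a, b]"
  using assms by (simp add: dform_alt lessThan_Suc numeral_2_eq_2 Theta_def psign_def)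

text \<open>The form \<open>\<Upsilon> \<omega>\<close> is defined through an arbitrary potential \<open>y\<close> with \<open>d (\<Theta> y) = \<omega>\<close>, and the cyclic
  sum does not see the choice.  The tensor \<open>y0\<close> in the proof shows that a potential exists.\<close>

lemma Upsilon_pair:
  assumes S: "finite S" and f: "quadratic S f" and ab: "a \<in> S" "b \<in> S"
  shows "Ncyc (fpar p) f [Inr a, Inr b] = - psign (p a) * Upsilon p S (dr_class p S 2 f) [a, b]"
proof -
  let ?\<omega> = "dr_class p S 2 f"
  let ?Q = "\<lambda>y. y \<in> tensors S \<and> y [] = 0 \<and> dr_class p S 2 (dform p S (Theta y)) = ?\<omega>"
  have ff: "f \<in> forms S 2" using f by (fastforce simp: forms_def tensors_def quadratic_def)
  define y where "y = (SOME y. ?Q y)"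
  \<comment> \<open>the sign is that of \<open>d (da \<cdot> b) = - (-1)\<^bsup>|a|\<^esup> da db\<close>\<close>
  define y0 where "y0 w = (case w of [a, b] \<Rightarrow> - psign (p a) * f [Inr a, Inr b] | _ \<Rightarrow> 0)" for w
  have y0z: "y0 w = 0" if "length w \<noteq> 2" for w
    using that by (auto simp: y0_def split: list.splits)
  have "dform p S (Theta y0) = f"
  proof
    fix u
    show "dform p S (Theta y0) u = f u"
    proof (cases "length u = 2")
      case True
      then obtain c d where u: "u = [c, d]" by (metis (no_types) length_0_conv length_Suc_conv numeral_2_eq_2)
      have fz: "f [c, Inl x] = 0" "f [Inl x, c] = 0" for c x using f by (auto simp: quadratic_def)
      have fS: "f [Inr a, Inr b] = 0" if "a \<notin> S \<or> b \<notin> S" for a b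
        using that f by (auto simp: quadratic_def)
      show ?thesis unfolding u
        by (cases c; cases d) (auto simp: dform_alt[OF S] lessThan_Suc numeral_2_eq_2 Theta_def y0_def fz fS psign_def)
    next
      case False
      have "Theta y0 w = 0" if "length w = length u" for w
      proof -
        have "y0 (projr (hd w) # map projl (tl w)) = 0" if "w \<noteq> []"
          by (rule y0z) (use that False \<open>length w = length u\<close> in \<open>cases w; auto\<close>)
        then show ?thesis by (cases w) (auto simp: Theta_def)
      qed
      moreover have "length (take j u @ Inl b # drop (Suc j) u) = length u" if "j < length u" for j b
        using that by simp
      ultimately have "dform p S (Theta y0) u = 0"
        unfolding dform_alt[OF S] by (intro sum.neutral) (auto split: sum.splits)
      moreover have "f u = 0" using f False by (auto simp: quadratic_def)
      ultimately show ?thesis by simp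
    qed
  qed
  moreover have "y0 \<in> tensors S"
    using f by (auto simp: y0_def tensors_def quadratic_def split: list.splits)
  ultimately have "?Q y0" by (simp add: y0z)
  then have y: "?Q y" unfolding y_def by (rule someI[of ?Q])
  have "Ncyc (fpar p) f = Ncyc (fpar p) (dform p S (Theta y))"
    using dr_class_Ncyc[of f p S 2] dr_class_self[OF ff, of p] y by metis
  then have "Ncyc (fpar p) f [Inr a, Inr b] =
      - psign (p a) * y [a, b] - psign (\<not> p a \<and> \<not> p b) * psign (p b) * y [b, a]"
    using dform_Theta_pair[OF S] ab by (simp add: Ncyc_pair)
  also have "\<dots> = - psign (p a) * one_minus_z p y [a, b]"
    using act_zperm[of 1 "[a, b]" p y] by (auto simp: one_minus_z_def psign_def)
  also have "one_minus_z p y [a, b] = Upsilon p S ?\<omega> [a, b]"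
    by (simp add: Upsilon_def y_def)
  finally show ?thesis .
qed

lemma evsign_snoc: "evsign p (v @ [a]) = psign (p a \<and> wpar p v) * evsign p v"
proof -
  have e: "evsign p w = (\<Prod>j<length w. \<Prod>i<j. psign (p (w ! i) \<and> p (w ! j)))" for w
  proof -
    have "evsign p w = (\<Prod>(j, i)\<in>Sigma {..<length w} (\<lambda>j. {..<j}). psign (p (w ! i) \<and> p (w ! j)))"
      unfolding evsign_def
      by (rule prod.reindex_bij_witness[where i = prod.swap and j = prod.swap]) auto
    then show ?thesis by (simp add: prod.Sigma)
  qed
  have "(\<Prod>i<length v. psign (p (v ! i) \<and> p a)) = psign (p a \<and> wpar p v)"
    using psign_wpar_prod[of "p a" p v] by (simp add: conj_commute)
  then show ?thesis unfolding e by (simp add: nth_append mult.commute)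
qed

lemma evsign_pair: "evsign p [a, b] = psign (p a \<and> p b)"
  using evsign_snoc[of p "[a]" b] evsign_snoc[of p "[]" a]
  by (simp add: evsign_def conj_commute)

section \<open>The standard form\<close>

lemma quadratic_forms: "quadratic S f \<Longrightarrow> f \<in> forms S 2"
  by (fastforce simp: forms_def tensors_def quadratic_def)

lemma forms_quadratic:
  assumes "f \<in> forms S 2" "\<And>u. f u \<noteq> 0 \<Longrightarrow> length u = 2"
  shows "quadratic S f"
  unfolding quadratic_def
proof (intro allI impI)
  fix w assume w: "f w \<noteq> 0"
  then obtain x y where xy: "w = [x, y]"
    using assms(2)[OF w] by (metis (no_types) length_0_conv length_Suc_conv numeral_2_eq_2)
  have "[x, y] \<in> lists (S <+> S)" "length (filter (\<lambda>c. \<not> isl c) [x, y]) = 2"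
    using assms(1) w unfolding forms_def tensors_def xy by blast+
  then show "\<exists>a\<in>S. \<exists>b\<in>S. w = [Inr a, Inr b]"
    unfolding xy by (cases x; cases y) (auto split: if_splits)
qed

lemma canonical_form_pair:
  assumes "c \<in> letters n k" "d \<in> letters n k"
  shows "canonical_form n k [Inr c, Inr d] = (case (c, d) of (P i, Q j) \<Rightarrow> if i = j then 1 else 0
    | (X i, X j) \<Rightarrow> if i = j then 1 / 2 else 0 | _ \<Rightarrow> 0)"
proof -
  have 1: "(\<Sum>i<n. if a = i \<and> b = i then 1 else 0) = (if a = b \<and> a < n then 1 else 0 :: complex)" for a b n :: nat
  proof -
    have "(\<Sum>i<n. if a = i \<and> b = i then 1 else 0) = (\<Sum>i<n. if i = a then (if a = b then 1 else 0) else 0 :: complex)"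
      by (intro sum.cong) auto
    then show ?thesis by simp
  qed
  show ?thesis using assms
    by (cases c; cases d) (auto simp: canonical_form_def single_def 1 letters_def)
qed

lemma quadratic_canonical_form: "quadratic (letters n k) (canonical_form n k)"
  unfolding quadratic_def
proof (intro allI impI)
  fix w assume w: "canonical_form n k w \<noteq> 0"
  have "(\<exists>i<n. w = [Inr (P i), Inr (Q i)]) \<or> (\<exists>i<k. w = [Inr (X i), Inr (X i)])"
  proof (rule ccontr)
    assume "\<not> ?thesis"
    then have "canonical_form n k w = 0" by (auto simp: canonical_form_def single_def)
    then show False using w by simp
  qed
  then show "\<exists>a\<in>letters n k. \<exists>b\<in>letters n k. w = [Inr a, Inr b]"
    by (auto simp: letters_def)
qed

lemma Ncyc_canonical_form:
  assumes "c \<in> letters n k" "d \<in> letters n k"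
  shows "Ncyc (fpar lpar) (canonical_form n k) [Inr c, Inr d] = lform c d"
  using assms by (cases c; cases d) (auto simp: Ncyc_pair canonical_form_pair lpar_def psign_def)

fun conj_letter :: "letter \<Rightarrow> letter" where
  "conj_letter (P i) = Q i" | "conj_letter (Q i) = P i" | "conj_letter (X i) = X i"

lemma lform_nonzero: "lform c d \<noteq> 0 \<Longrightarrow> d = conj_letter c"
  by (cases c; cases d) (auto split: if_splits)

text \<open>The Gram matrix of the standard form, cut off to a finite set of letters.\<close>

definition darboux_gram :: "nat \<Rightarrow> nat \<Rightarrow> letter \<Rightarrow> letter \<Rightarrow> complex" where
  "darboux_gram n k c d = (if c \<in> letters n k \<and> d \<in> letters n k then lform c d else 0)"

text \<open>The form pairs each letter with exactly one letter.\<close>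

lemma darboux_gram_square: "mat_mult (letters n k) (darboux_gram n k) (darboux_gram n k) = diag_mat (letters n k) (\<lambda>d. - psign (lpar d))"
proof (intro ext)
  fix c e
  have "mat_mult (letters n k) (darboux_gram n k) (darboux_gram n k) c e =
      (\<Sum>d\<in>letters n k. if d = conj_letter c then darboux_gram n k c d * darboux_gram n k d e else 0)"
    unfolding mat_mult_def using lform_nonzero[of c] by (intro sum.cong) (auto simp: darboux_gram_def)
  also have "\<dots> = (if conj_letter c \<in> letters n k then darboux_gram n k c (conj_letter c) * darboux_gram n k (conj_letter c) e else 0)"
    by simp
  also have "\<dots> = diag_mat (letters n k) (\<lambda>d. - psign (lpar d)) c e"
    by (cases c; cases e) (auto simp: darboux_gram_def letters_def diag_mat_def lpar_def psign_def)
  finally show "mat_mult (letters n k) (darboux_gram n k) (darboux_gram n k) c e = diag_mat (letters n k) (\<lambda>d. - psign (lpar d)) c e" .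
qed

lemma alg_map_form_matrix_pair:
  assumes "finite S"
  shows "alg_map (S <+> S) (form_matrix \<phi>) f [Inr c, Inr d] =
    (\<Sum>a\<in>S. \<Sum>b\<in>S. f [Inr a, Inr b] * (\<phi> a c * \<phi> b d))"
  using assms
  by (simp add: alg_map_words numeral_2_eq_2 sum_words_Suc sum.Plus lessThan_Suc form_matrix_def mult_ac)

section \<open>The Hamiltonian and the inverse form of an algebra\<close>

context
  fixes A :: "'b ainf" and p S m \<omega>
  assumes p: "p = wparity A" and SA: "S = basis A" and m: "m = mfield A" and \<omega>: "\<omega> = omega A"
    and A: "symplectic_ainf A"
    and ev: "even_form (wparity A) (omega A)" and oz: "order_zero 2 (omega A)"
begin

lemma finite_basis: "finite S"
  using A by (simp add: symplectic_ainf_def Let_def SA)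

lemma odd_mfield: "odd_field p S m"
  unfolding odd_field_def
proof (intro ballI allI impI)
  fix b w assume b: "b \<in> S" and w: "m (single [b]) w \<noteq> 0"
  have d: "super_derivation p S True m"
    using A by (simp add: symplectic_ainf_def Let_def SA p m)
  have t: "single [b] \<in> tensors S" using b by (auto simp: tensors_def single_def)
  have "m (single [b]) \<in> tensors S" using d t by (simp add: super_derivation_def)
  then have "set w \<subseteq> S" using w by (auto simp: tensors_def)
  have "parity_aut p True (single [b]) = (\<lambda>u. psign (p b) * single [b] u)"
    by (auto simp: fun_eq_iff parity_aut_def single_def)
  moreover have "m (\<lambda>u. psign (p b) * single [b] u) = (\<lambda>u. psign (p b) * m (single [b]) u)"
    using d t by (simp add: super_derivation_def)
  moreover have "m (parity_aut p True (single [b])) = (\<lambda>u. psign True * parity_aut p True (m (single [b])) u)"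
    using d t unfolding super_derivation_def by blast
  ultimately have "(\<lambda>u. psign (p b) * m (single [b]) u) =
      (\<lambda>u. psign True * parity_aut p True (m (single [b])) u)"
    by (simp only:)
  then have "psign (p b) * m (single [b]) w = psign True * parity_aut p True (m (single [b])) w"
    by (rule fun_cong)
  then have "psign (p b) * m (single [b]) w = psign True * (psign (wpar p w) * m (single [b]) w)"
    by (simp add: parity_aut_def)
  then have "psign (p b) = - psign (wpar p w)" using w by (simp add: psign_def split: if_splits)
  then show "set w \<subseteq> S \<and> wpar p w = (\<not> p b)" using \<open>set w \<subseteq> S\<close>
    by (auto simp: psign_def split: if_splits)
qed

lemma ex_quadratic: "\<exists>f. quadratic S f \<and> \<omega> = dr_class p S 2 f"
proof -
  have "\<omega> \<in> DR p S 2" using A by (simp add: symplectic_ainf_def symplectic_form_def Let_def SA p \<omega>)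
  then obtain f1 where f1: "\<omega> = dr_class p S 2 f1" by (auto simp: DR_def)
  obtain f where f: "f \<in> \<omega>" "\<And>u. f u \<noteq> 0 \<Longrightarrow> length u = 2"
    using oz by (auto simp: order_zero_def \<omega>)
  have "f \<in> forms S 2" using f(1) by (simp add: f1 dr_class_def)
  then have "quadratic S f" using f(2) by (rule forms_quadratic)
  moreover have "\<omega> = dr_class p S 2 f" using f(1) dr_class_eq f1 by metis
  ultimately show ?thesis by blast
qed

text \<open>A representative of the symplectic form of the shape \<open>\<Sum> f\<^sub>a\<^sub>b da db\<close>.\<close>

definition omega_rep where "omega_rep = (SOME f. quadratic S f \<and> \<omega> = dr_class p S 2 f)"

lemma omega_rep: "quadratic S omega_rep" "\<omega> = dr_class p S 2 omega_rep"
  using someI_ex[OF ex_quadratic] by (simp_all add: omega_rep_def)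

definition gram where
  "gram a b = (if a \<in> S \<and> b \<in> S then Ncyc (fpar p) omega_rep [Inr a, Inr b] else 0)"

text \<open>Evenness is a property of some representative, which may differ from \<open>omega_rep\<close>; the Gram matrix
  is common to all representatives.\<close>

lemma gram_parity: "gram a b \<noteq> 0 \<Longrightarrow> p a = p b"
proof -
  assume g: "gram a b \<noteq> 0"
  obtain f where f: "f \<in> \<omega>" "\<And>u. f u \<noteq> 0 \<Longrightarrow> \<not> wpar (fpar p) u"
    using ev by (auto simp: even_form_def \<omega> p)
  have "Ncyc (fpar p) f = Ncyc (fpar p) omega_rep" using dr_class_Ncyc f(1) omega_rep(2) by metis
  then have "Ncyc (fpar p) f [Inr a, Inr b] \<noteq> 0" using g by (auto simp: gram_def split: if_splits)
  then have "f [Inr a, Inr b] \<noteq> 0 \<or> f [Inr b, Inr a] \<noteq> 0" unfolding Ncyc_pair by auto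
  then show ?thesis using f(2)[of "[Inr a, Inr b]"] f(2)[of "[Inr b, Inr a]"] by auto
qed

lemma gram_swap: "gram b a = psign (\<not> p a \<and> \<not> p b) * gram a b"
  using Ncyc_rotate[of "fpar p" omega_rep "[Inr b]" "[Inr a]"] by (simp add: gram_def)

lemma bform_gram: "a \<in> S \<Longrightarrow> b \<in> S \<Longrightarrow> bform A a b = - gram a b"
proof -
  assume ab: "a \<in> S" "b \<in> S"
  have "bform A a b = psign (p a \<and> p b) * Upsilon p S \<omega> [a, b]"
    by (simp add: bform_def evsign_pair p SA \<omega>)
  moreover have "gram a b = - psign (p a) * Upsilon p S \<omega> [a, b]"
    using Upsilon_pair[OF finite_basis omega_rep(1) ab, of p] omega_rep(2) ab by (simp add: gram_def)
  ultimately show ?thesis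
  proof (cases "gram a b = 0")
    case False
    then have "p a = p b" by (rule gram_parity)
    then show ?thesis using \<open>bform A a b = _\<close> \<open>gram a b = _\<close> by simp
  qed simp
qed

text \<open>The cyclic sum of \<open>dh = i\<^sub>m \<omega>\<close>, evaluated at \<open>da v\<close>, gives
  \<open>(N h) (a v) = \<Sum>b. m\<^sub>b(v) G\<^sub>a\<^sub>b\<close>.  The tensor \<open>h\<^sub>k\<close> has the letter \<open>a\<close> in the last place instead, which
  cyclic invariance of \<open>N h\<close> compensates.  The parity follows, because \<open>m\<close> is odd and \<open>G\<close> is even.\<close>

lemma hamiltonian_tensor:
  assumes h: "is_hamiltonian A h" and f: "f \<in> h" and u: "length u \<ge> 2"
  shows "Ncyc p f u = h_tensor A (length u) u \<and> (Ncyc p f u \<noteq> 0 \<longrightarrow> wpar p u)"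
proof -
  have hc: "\<exists>f\<in>tensors S. h = cyc_class p S f"
    and ham: "on_classes (dr_class p S 1) (\<lambda>f. dform p S (emb f)) h =
      on_classes (dr_class p S 1) (contraction p S m) \<omega>"
    using h by (auto simp: is_hamiltonian_def Let_def p SA m \<omega>)
  have "omega_rep \<in> \<omega>" using omega_rep dr_class_self[OF quadratic_forms[OF omega_rep(1)]] by metis
  then have "contraction p S m omega_rep \<in> on_classes (dr_class p S 1) (contraction p S m) \<omega>"
    unfolding on_classes_def using dr_class_self[OF contraction_forms[OF finite_basis omega_rep(1) odd_mfield]] by blast
  then have "contraction p S m omega_rep \<in> on_classes (dr_class p S 1) (\<lambda>f. dform p S (emb f)) h"
    unfolding ham .
  then obtain f1 where f1: "f1 \<in> h" "contraction p S m omega_rep \<in> dr_class p S 1 (dform p S (emb f1))"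
    unfolding on_classes_def by blast
  \<comment> \<open>the contraction of \<open>omega_rep\<close> is the differential of some representative \<open>f1\<close> of \<open>h\<close>, which
    need not be \<open>f\<close>\<close>
  have ff1: "Ncyc p f = Ncyc p f1" using hc f f1(1) cyc_class_Ncyc by metis
  have main: "Ncyc p f (a # v) = (\<Sum>b\<in>S. m (single [b]) v * gram a b)" if "a \<in> S" "v \<noteq> []" for a v
    using Ncyc_dform_emb[OF finite_basis that(1), of p f1 v] Ncyc_contraction[OF finite_basis omega_rep(1) odd_mfield that]
      dr_class_Ncyc[OF f1(2)] that(1) by (simp add: ff1 gram_def cong: sum.cong)
  have ft: "f \<in> tensors S" using f hc by (auto simp: cyc_class_def)
  have supp: "set u \<subseteq> S" if nz: "Ncyc p f u \<noteq> 0"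
  proof -
    obtain w where w: "f w \<noteq> 0" "mset w = mset u" using Ncyc_nonzero[OF nz] by blast
    then have "w \<in> lists S" using ft unfolding tensors_def by blast
    then show ?thesis using mset_eq_setD[OF w(2)] by auto
  qed
  show ?thesis
  proof (cases "set u \<subseteq> S")
    case False
    then show ?thesis using supp by (auto simp: h_tensor_def SA)
  next
    case uS: True
    define v a where "v = butlast u" and "a = last u"
    have uv: "u = v @ [a]" using u unfolding v_def a_def by (intro append_butlast_last_id[symmetric]) auto
    have a: "a \<in> S" and v: "v \<noteq> []" using uS u by (auto simp: uv)
    have N: "Ncyc p f u = psign (p a \<and> wpar p v) * (\<Sum>b\<in>S. m (single [b]) v * gram a b)"
      using Ncyc_rotate[of p f v "[a]"] main[OF a v] by (simp add: uv)
    have "h_tensor A (length u) u = psign (p a \<and> wpar p v) *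
        (evsign p v * (\<Sum>b\<in>S. psign (p b) * evsign p v * m (single [b]) v * bform A b a))"
      using uS by (simp add: h_tensor_def h_value_def m_component_def uv evsign_snoc p[symmetric] SA[symmetric]
          m[symmetric] lists_eq_set)
    also have "evsign p v * (\<Sum>b\<in>S. psign (p b) * evsign p v * m (single [b]) v * bform A b a) =
        (\<Sum>b\<in>S. m (single [b]) v * gram a b)"
      unfolding sum_distrib_left
    proof (intro sum.cong refl)
      fix b assume b: "b \<in> S"
      have e: "evsign p v * evsign p v = 1"
        by (simp add: evsign_def prod.distrib[symmetric] case_prod_unfold)
      have "bform A b a = psign (p b) * gram a b"
        using bform_gram[OF b a] gram_swap[of b a] gram_parity[of a b]
        by (cases "gram a b = 0") (auto simp: psign_def)
      then show "evsign p v * (psign (p b) * evsign p v * m (single [b]) v * bform A b a) =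
          m (single [b]) v * gram a b"
        using e by (simp add: mult_ac)
    qed
    finally have eq: "Ncyc p f u = h_tensor A (length u) u" using N by simp
    have "wpar p u" if "Ncyc p f u \<noteq> 0"
    proof -
      have "(\<Sum>b\<in>S. m (single [b]) v * gram a b) \<noteq> 0" using N that by auto
      then obtain b where b: "b \<in> S" "m (single [b]) v * gram a b \<noteq> 0" by (meson sum.neutral)
      then have "wpar p v = (\<not> p b)" "p a = p b"
        using odd_mfield gram_parity by (auto simp: odd_field_def)
      then show ?thesis by (auto simp: uv)
    qed
    then show ?thesis using eq by blast
  qed
qed

text \<open>Evaluating the cyclic sum of \<open>\<phi>\<^sup>* \<omega>\<close> at \<open>dc dd\<close> gives the pullback identity between Gram matrices
  needed for \<open>inverse_pulled_back_form\<close>.\<close>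

lemma inv_bform_chart:
  assumes chart: "darboux_chart A n k \<phi>"
  shows "inv_bform A = mat_mult (letters n k) \<phi> (mat_mult (letters n k) lform (mat_transpose \<phi>))"
proof -
  let ?S' = "letters n k" and ?L = "darboux_gram n k"
  have iso: "linear_iso p S lpar ?S' \<phi>"
    and cl: "on_classes (dr_class lpar ?S' 2) (alg_map (S <+> S) (form_matrix \<phi>)) \<omega> =
      dr_class lpar ?S' 2 (canonical_form n k)"
    using chart by (simp_all add: darboux_chart_def p SA \<omega>)
  have sup: "supported S ?S' \<phi>" and par: "\<And>c d. \<phi> c d \<noteq> 0 \<Longrightarrow> p c = lpar d"
    using iso by (auto simp: linear_iso_def supported_def)
  have "canonical_form n k \<in> on_classes (dr_class lpar ?S' 2) (alg_map (S <+> S) (form_matrix \<phi>)) \<omega>"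
    unfolding cl by (rule dr_class_self[OF quadratic_forms[OF quadratic_canonical_form]])
  then obtain g where g: "g \<in> \<omega>"
    "canonical_form n k \<in> dr_class lpar ?S' 2 (alg_map (S <+> S) (form_matrix \<phi>) g)"
    unfolding on_classes_def by blast
  have gN: "Ncyc (fpar p) g = Ncyc (fpar p) omega_rep" using g(1) omega_rep(2) dr_class_Ncyc by metis
  have fpar: "fpar p x = fpar lpar y" if "form_matrix \<phi> x y \<noteq> 0" for x y
    using that par by (cases x; cases y) (auto simp: form_matrix_def)
  have pull: "?L = mat_mult S (mat_transpose \<phi>) (mat_mult S gram \<phi>)"
  proof (intro ext)
    fix c d
    have rhs: "mat_mult S (mat_transpose \<phi>) (mat_mult S gram \<phi>) c d = (\<Sum>a\<in>S. \<Sum>b\<in>S. gram a b * (\<phi> a c * \<phi> b d))"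
      by (simp add: mat_mult_def mat_transpose_def sum_distrib_left mult_ac)
    show "?L c d = mat_mult S (mat_transpose \<phi>) (mat_mult S gram \<phi>) c d"
    proof (cases "c \<in> ?S' \<and> d \<in> ?S'")
      case True
      have "?L c d = Ncyc (fpar lpar) (canonical_form n k) [Inr c, Inr d]"
        using True by (simp add: darboux_gram_def Ncyc_canonical_form)
      also have "\<dots> = alg_map (S <+> S) (form_matrix \<phi>) (Ncyc (fpar p) omega_rep) [Inr c, Inr d]"
        unfolding dr_class_Ncyc[OF g(2)] gN[symmetric] by (rule Ncyc_alg_map[OF fpar])
      also have "\<dots> = (\<Sum>a\<in>S. \<Sum>b\<in>S. gram a b * (\<phi> a c * \<phi> b d))"
        by (simp add: alg_map_form_matrix_pair[OF finite_basis] gram_def)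
      finally show ?thesis using rhs by simp
    next
      case False
      then have "\<phi> a c * \<phi> b d = 0" for a b using sup by (auto simp: supported_def)
      then have "mat_mult S (mat_transpose \<phi>) (mat_mult S gram \<phi>) c d = 0" unfolding rhs by (simp only: mult_zero_right sum.neutral_const)
      then show ?thesis using False by (auto simp: darboux_gram_def)
    qed
  qed
  have sG: "supported S S gram" and sL: "supported ?S' ?S' ?L"
    by (auto simp: supported_def gram_def darboux_gram_def)
  have "(\<forall>a b. g a b \<noteq> 0 \<longrightarrow> a \<in> S \<and> b \<in> S) \<and>
     (\<forall>a\<in>S. \<forall>c\<in>S. (\<Sum>b\<in>S. bform A a b * g b c) = (if a = c then psign (p a) else 0)) \<longleftrightarrow>
     supported S S g \<and> mat_mult S gram g = diag_mat S (\<lambda>a. - psign (p a))" for g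
  proof -
    have b: "(\<Sum>b\<in>S. bform A a b * g b c) = - mat_mult S gram g a c" if "a \<in> S" for a c
      using that by (simp add: mat_mult_def bform_gram sum_negf)
    have "mat_mult S gram g = diag_mat S (\<lambda>a. - psign (p a)) \<longleftrightarrow>
        (\<forall>a\<in>S. \<forall>c\<in>S. (\<Sum>b\<in>S. bform A a b * g b c) = (if a = c then psign (p a) else 0))"
      if s: "supported S S g"
    proof
      assume eq: "mat_mult S gram g = diag_mat S (\<lambda>a. - psign (p a))"
      show "\<forall>a\<in>S. \<forall>c\<in>S. (\<Sum>b\<in>S. bform A a b * g b c) = (if a = c then psign (p a) else 0)"
        by (simp add: b eq diag_mat_def)
    next
      assume eq: "\<forall>a\<in>S. \<forall>c\<in>S. (\<Sum>b\<in>S. bform A a b * g b c) = (if a = c then psign (p a) else 0)"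
      show "mat_mult S gram g = diag_mat S (\<lambda>a. - psign (p a))"
      proof (intro ext)
        fix a c
        show "mat_mult S gram g a c = diag_mat S (\<lambda>a. - psign (p a)) a c"
        proof (cases "a \<in> S \<and> c \<in> S")
          case True
          then have "- mat_mult S gram g a c = (if a = c then psign (p a) else 0)" using eq b by metis
          then show ?thesis using True by (auto simp: diag_mat_def minus_equation_iff split: if_splits)
        next
          case False
          then show ?thesis using supported_mat_mult[OF sG s] by (auto simp: supported_def diag_mat_def)
        qed
      qed
    qed
    then show ?thesis unfolding supported_def[symmetric] by blast
  qed
  then have "inv_bform A = (THE g. supported S S g \<and> mat_mult S gram g = diag_mat S (\<lambda>a. - psign (p a)))"
    unfolding inv_bform_def p[symmetric] SA[symmetric] by simp
  also have "\<dots> = mat_mult ?S' \<phi> (mat_mult ?S' ?L (mat_transpose \<phi>))"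
    unfolding inverse_pulled_back_form[OF iso finite_basis finite_letters sG sL pull darboux_gram_square] by simp
  also have "\<dots> = mat_mult ?S' \<phi> (mat_mult ?S' lform (mat_transpose \<phi>))"
    by (auto simp: fun_eq_iff mat_mult_def darboux_gram_def intro!: sum.cong)
  finally show ?thesis .
qed

end

section \<open>The amplitude of the exponential\<close>

lemma Nblocks_cong:
  "(\<And>vs. map length vs = map length ws \<Longrightarrow> x vs = y vs) \<Longrightarrow> Nblocks p x ws = Nblocks p y ws"
proof (induction ws arbitrary: x y)
  case (Cons w ws)
  show ?case unfolding Nblocks.simps
    by (rule Ncyc_cong_length, rule Cons.IH) (simp add: Cons.prems)
qed simp

lemma Nblocks_prod: "Nblocks p (\<lambda>ws. prod_list (map h ws)) ws = prod_list (map (Ncyc p h) ws)"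
proof (induction ws)
  case (Cons w ws)
  have "Nblocks p (\<lambda>ws. prod_list (map h ws)) (w # ws) =
      Ncyc p (\<lambda>v. prod_list (map (Ncyc p h) ws) * h v) w"
    by (simp add: linear_op_scale[OF linear_op_Nblocks] Cons.IH mult.commute)
  then show ?case by (simp add: linear_op_scale[OF linear_op_Ncyc])
qed simp

lemma Nblocks_exp_part:
  "Nblocks p (exp_part h i l) ws = (if length ws = i \<and> sum_list (map length ws) = l
     then prod_list (map (Ncyc p h) ws) / fact i else 0)"
proof -
  let ?c = "if length ws = i \<and> sum_list (map length ws) = l then 1 / fact i else 0 :: complex"
  have "Nblocks p (exp_part h i l) ws = Nblocks p (\<lambda>vs. ?c * prod_list (map h vs)) ws"
  proof (rule Nblocks_cong)
    fix vs :: "letter list list" assume "map length vs = map length ws"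
    then have "length vs = length ws" "sum_list (map length vs) = sum_list (map length ws)"
      using map_eq_imp_length_eq by auto
    then show "exp_part h i l vs = ?c * prod_list (map h vs)" by (simp add: exp_part_def)
  qed
  then show ?thesis by (simp add: linear_op_scale[OF linear_op_Nblocks] Nblocks_prod)
qed

text \<open>For odd blocks the Koszul sign equals the signature, so all \<open>i!\<close> terms agree.\<close>

lemma antisym_prod:
  assumes odd: "\<And>w. H w \<noteq> 0 \<Longrightarrow> wpar lpar w"
  shows "antisym (\<lambda>ws. if length ws = i \<and> sum_list (map length ws) = l
       then prod_list (map H ws) / fact i else 0) ws =
    (if length ws = i \<and> sum_list (map length ws) = l then prod_list (map H ws) else 0)"
proof -
  let ?x = "\<lambda>ws. if length ws = i \<and> sum_list (map length ws) = l
       then prod_list (map H ws) / fact i else 0"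
  have "of_int (sign \<sigma>) * act (wpar lpar) \<sigma> ?x ws = ?x ws" if s: "\<sigma> permutes {..<length ws}" for \<sigma>
  proof -
    have ms: "mset (permute_list \<sigma> ws) = mset ws" using s by simp
    have "sum_list (map length (permute_list \<sigma> ws)) = sum_list (map length ws)"
      "prod_list (map H (permute_list \<sigma> ws)) = prod_list (map H ws)"
      using ms by (metis mset_map sum_mset_sum_list, metis mset_map prod_mset_prod_list)
    then have x: "?x (permute_list \<sigma> ws) = ?x ws" by simp
    show ?thesis
    proof (cases "?x ws = 0")
      case False
      then have "prod_list (map H ws) \<noteq> 0" by (auto split: if_splits)
      then have "\<forall>w\<in>set ws. H w \<noteq> 0" by (auto simp: prod_list_zero_iff)
      then have "\<forall>w\<in>set ws. wpar lpar w" using odd by blast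
      then have "koszul (wpar lpar) \<sigma> (permute_list \<sigma> ws) = of_int (sign \<sigma>)"
        using s by (intro koszul_all_odd) auto
      moreover have "of_int (sign \<sigma>) * (of_int (sign \<sigma>) :: complex) = 1"
        by (metis of_int_1 of_int_mult sign_idempotent)
      ultimately show ?thesis unfolding act_def x by (simp only: mult.assoc[symmetric] mult_1)
    qed (simp only: act_def x mult_zero_right)
  qed
  then have "antisym ?x ws = (\<Sum>\<sigma> | \<sigma> permutes {..<length ws}. ?x ws)"
    unfolding antisym_def by (intro sum.cong) auto
  also have "\<dots> = fact (length ws) * ?x ws"
    by (simp add: card_permutations[of "{..<length ws}" "length ws"])
  finally show ?thesis by simp
qed

text \<open>Only one bidegree of the exponential meets a given chord diagram.\<close>

lemma chord_amplitude_exp_part: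
  assumes odd: "\<And>w. Ncyc lpar h w \<noteq> 0 \<Longrightarrow> wpar lpar w"
  shows "chord_amplitude ks \<sigma> (exp_part h i l) = (if i = length ks \<and> l = sum_list ks then
    kappa lform (act lpar \<sigma> (\<lambda>u. if length u = sum_list ks
      then prod_list (map (Ncyc lpar h) (split_word ks u)) else 0)) else 0)"
proof -
  have a: "antisym (Nblocks lpar (exp_part h i l)) = (\<lambda>ws. if length ws = i \<and> sum_list (map length ws) = l
       then prod_list (map (Ncyc lpar h) ws) else 0)"
    unfolding Nblocks_exp_part[abs_def] by (rule ext, rule antisym_prod[OF odd])
  have "type_part ks (antisym (Nblocks lpar (exp_part h i l))) =
      (\<lambda>u. if i = length ks \<and> l = sum_list ks then (if length u = sum_list ks
        then prod_list (map (Ncyc lpar h) (split_word ks u)) else 0) else 0)"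
    unfolding a by (auto simp: type_part_def map_length_split_word fun_eq_iff)
  then show ?thesis by (auto simp: chord_amplitude_def act_def kappa_def)
qed

lemma foldr_tmult:
  assumes "\<And>k w. T k w \<noteq> 0 \<Longrightarrow> length w = k"
  shows "foldr tmult (map T ks) (single []) = (\<lambda>u. if length u = sum_list ks
    then prod_list (map2 T ks (split_word ks u)) else 0)"
proof (induction ks)
  case Nil
  then show ?case by (auto simp: single_def fun_eq_iff)
next
  case (Cons k ks)
  show ?case
  proof
    fix u
    let ?F = "foldr tmult (map T ks) (single [])"
    have "foldr tmult (map T (k # ks)) (single []) u = (\<Sum>i\<le>length u. T k (take i u) * ?F (drop i u))"
      by (simp add: tmult_def)
    also have "\<dots> = (\<Sum>i\<le>length u. if i = k then T k (take k u) * ?F (drop k u) else 0)"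
    proof (intro sum.cong refl)
      fix i assume "i \<in> {..length u}"
      then have "length (take i u) = i" by simp
      then show "T k (take i u) * ?F (drop i u) = (if i = k then T k (take k u) * ?F (drop k u) else 0)"
        using assms[of k "take i u"] by auto
    qed
    also have "\<dots> = (if length u = sum_list (k # ks)
        then prod_list (map2 T (k # ks) (split_word (k # ks) u)) else 0)"
      by (auto simp: Cons.IH)
    finally show "foldr tmult (map T (k # ks)) (single []) u = (if length u = sum_list (k # ks)
        then prod_list (map2 T (k # ks) (split_word (k # ks) u)) else 0)" .
  qed
qed


section \<open>Comparison with the partition function\<close>

lemma chain_class_nonempty:
  assumes "x \<in> chains i l"
  shows "x \<in> chain_class i l x"
proof -
  have "(\<lambda>_. 0) \<in> chain_relations i l" unfolding chain_relations_def using cspan_zero by blast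
  then show ?thesis using assms by (simp add: chain_class_def)
qed

lemma exp_part_chains:
  assumes "h \<in> tensors (letters n k)" "\<And>u. length u < 3 \<Longrightarrow> h u = 0"
  shows "exp_part h i l \<in> chains i l"
proof -
  have "ws \<in> chain_words n k i l" if e: "exp_part h i l ws \<noteq> 0" for ws
  proof -
    have l: "length ws = i" "sum_list (map length ws) = l" and "prod_list (map h ws) \<noteq> 0"
      using e by (auto simp: exp_part_def split: if_splits)
    then have "\<forall>w\<in>set ws. h w \<noteq> 0" by (auto simp: prod_list_zero_iff)
    moreover have "length w \<ge> 3 \<and> w \<in> lists (letters n k)" if "h w \<noteq> 0" for w
    proof -
      have "\<not> length w < 3" using assms(2) that by blast
      moreover have "w \<in> lists (letters n k)" using assms(1) that unfolding tensors_def by blast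
      ultimately show ?thesis by simp
    qed
    ultimately show ?thesis using l by (simp add: chain_words_def)
  qed
  then show ?thesis unfolding chains_def by blast
qed

lemma wpar_alg_map:
  assumes "alg_map S M f w \<noteq> 0" "\<And>c d. M c d \<noteq> 0 \<Longrightarrow> p c = p' d"
  shows "\<exists>u. f u \<noteq> 0 \<and> length u = length w \<and> wpar p u = wpar p' w"
proof -
  obtain u where u: "u \<in> words S (length w)" "f u * (\<Prod>i<length w. M (u ! i) (w ! i)) \<noteq> 0"
    using assms(1) unfolding alg_map_words by (meson sum.neutral)
  have l: "length u = length w" using u(1) by (simp add: words_def)
  have "p (u ! i) = p' (w ! i)" if "i < length w" for i
    using u(2) that by (intro assms(2)) (auto simp: prod_zero_iff)
  then have "{i. i < length u \<and> p (u ! i)} = {i. i < length w \<and> p' (w ! i)}" using l by auto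
  then have "wpar p u = wpar p' w" by (simp add: wpar_alt)
  then show ?thesis using u(2) l by auto
qed

lemma pairing_eq_partition_function:
  fixes A :: "'b ainf" and c :: completed_chain and \<Gamma> :: "'h graph"
  assumes A: "symplectic_ainf A" and ev: "even_form (wparity A) (omega A)"
    and oz: "order_zero 2 (omega A)" and c: "characteristic_class A c"
    and \<Gamma>: "oriented_ribbon_graph \<Gamma>"
  shows "pairing c \<Gamma> = partition_function A \<Gamma>"
proof -
  obtain n k \<phi> h h' where chart: "darboux_chart A n k \<phi>" and h: "is_hamiltonian A h"
    and h't: "h' \<in> tensors (letters n k)" and h'3: "\<And>u. length u < 3 \<Longrightarrow> h' u = 0"
    and hh': "cyc_class lpar (letters n k) h' =
       on_classes (cyc_class lpar (letters n k)) (alg_map (basis A) \<phi>) h"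
    and cc: "c = (\<lambda>i l. chain_class i l (exp_part h' i l))"
    using c unfolding characteristic_class_def by blast
  define p S S' H where "p = wparity A" and "S = basis A" and "S' = letters n k" and "H = Ncyc lpar h'"
  have iso: "linear_iso p S lpar S' \<phi>" using chart by (simp add: darboux_chart_def p_def S_def S'_def)
  have sup: "supported S S' \<phi>" and par: "\<And>c d. \<phi> c d \<noteq> 0 \<Longrightarrow> p c = lpar d"
    using iso by (auto simp: linear_iso_def supported_def)
  have fin: "finite S" "finite S'" using A by (simp_all add: S'_def S_def symplectic_ainf_def Let_def)
  have "h' \<in> on_classes (cyc_class lpar S') (alg_map S \<phi>) h"
    unfolding S_def S'_def hh'[symmetric] using h't by (simp add: cyc_class_def comm_closure_zero)
  then obtain f where f: "f \<in> h" "h' \<in> cyc_class lpar S' (alg_map S \<phi> f)"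
    unfolding on_classes_def by blast
  have H: "H w = alg_map S \<phi> (Ncyc p f) w" for w
    unfolding H_def cyc_class_Ncyc[OF f(2)] by (rule Ncyc_alg_map) (rule par)
  have ham: "Ncyc p f u = h_tensor A (length u) u \<and> (Ncyc p f u \<noteq> 0 \<longrightarrow> wpar p u)" if "length u \<ge> 2" for u
    using hamiltonian_tensor[OF p_def refl refl refl A ev oz h f(1) that] .
  have odd: "wpar lpar w" if Hw: "H w \<noteq> 0" for w
  proof -
    have "length w \<ge> 3"
    proof (rule ccontr)
      assume "\<not> length w \<ge> 3"
      then have "H w = 0" unfolding H_def Ncyc_rotations by (intro sum.neutral) (simp add: h'3)
      then show False using Hw by simp
    qed
    moreover obtain u where "Ncyc p f u \<noteq> 0" "length u = length w" "wpar p u = wpar lpar w"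
      using wpar_alg_map[of S \<phi> "Ncyc p f" w p lpar, OF Hw[unfolded H]] par by blast
    ultimately show ?thesis using ham[of u] by auto
  qed
  define \<G> where "\<G> = representative \<Gamma>"
  define ks \<sigma> L where "ks = graph_type \<G>" and "\<sigma> = chord_perm (chord_diagram \<G>)" and "L = sum_list ks"
  have \<sigma>: "\<sigma> permutes {..<L}" and L: "even L" and ks3: "\<forall>k\<in>set ks. k \<ge> 3"
    using represented_graph_chords[OF \<Gamma> represents_representative[OF \<Gamma>]]
    unfolding \<G>_def \<sigma>_def ks_def L_def by blast+
  define T where "T = foldr tmult (map (h_tensor A) ks) (single [])"
  have T: "T = (\<lambda>u. if length u = L then prod_list (map2 (h_tensor A) ks (split_word ks u)) else 0)"
    unfolding T_def L_def by (rule foldr_tmult) (auto simp: h_tensor_def split: if_splits)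
  have TS: "u \<in> words S L" if "act p \<sigma> T u \<noteq> 0" for u
  proof -
    define v where "v = permute_list \<sigma> u"
    have "T v \<noteq> 0" using that by (auto simp: act_def v_def)
    then have l: "length v = L" and nz: "prod_list (map2 (h_tensor A) ks (split_word ks v)) \<noteq> 0"
      by (auto simp: T split: if_splits)
    have "set w \<subseteq> S" if "w \<in> set (split_word ks v)" for w
    proof -
      obtain j where j: "j < length ks" "w = split_word ks v ! j"
        using \<open>w \<in> set (split_word ks v)\<close> by (auto simp: in_set_conv_nth)
      then have "h_tensor A (ks ! j) w \<in> set (map2 (h_tensor A) ks (split_word ks v))"
        using nth_mem[of j "map2 (h_tensor A) ks (split_word ks v)"] by simp
      then have "h_tensor A (ks ! j) w \<noteq> 0" using nz by (metis prod_list_zero_iff)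
      then show ?thesis by (auto simp: h_tensor_def S_def split: if_splits)
    qed
    then have "set (concat (split_word ks v)) \<subseteq> S" by auto
    then have "set v \<subseteq> S" using concat_split_word[of v ks] l by (simp add: L_def)
    moreover have "length u = L" using l by (simp add: v_def)
    ultimately show ?thesis using \<sigma> by (simp add: words_def v_def)
  qed
  have HT: "(\<lambda>u. if length u = L then prod_list (map H (split_word ks u)) else 0) = alg_map S \<phi> T"
  proof
    fix u
    show "(if length u = L then prod_list (map H (split_word ks u)) else 0) = alg_map S \<phi> T u"
    proof (cases "length u = L")
      case True
      let ?xs = "split_word ks u"
      have len: "map length ?xs = ks" using True by (simp add: L_def map_length_split_word)
      have m2: "map2 g (map length xs) xs = map (\<lambda>x. g (length x) x) xs" for g :: "nat \<Rightarrow> letter list \<Rightarrow> complex" and xs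
        by (induction xs) auto
      have "H w = alg_map S \<phi> (h_tensor A (length w)) w" if "w \<in> set ?xs" for w
      proof -
        have "length w \<in> set ks" using that len by (metis length_map list.set_map image_eqI)
        then have "length w \<ge> 2" using ks3 by auto
        then show ?thesis unfolding H alg_map_words
          by (intro sum.cong refl) (use ham in \<open>auto simp: words_def\<close>)
      qed
      then have "map H ?xs = map2 (\<lambda>k. alg_map S \<phi> (h_tensor A k)) (map length ?xs) ?xs"
        unfolding m2 by simp
      then have "prod_list (map H ?xs) = alg_map S \<phi> (\<lambda>u. prod_list (map2 (h_tensor A) ks (split_word ks u))) u"
        using alg_map_split_word[of u ks S \<phi> "h_tensor A"] True by (simp add: len L_def)
      also have "\<dots> = alg_map S \<phi> T u"
        unfolding alg_map_words by (intro sum.cong refl) (simp add: T words_def True)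
      finally show ?thesis using True by simp
    next
      case False
      then show ?thesis unfolding alg_map_words by (simp add: T words_def)
    qed
  qed
  have act_T: "act lpar \<sigma> (alg_map S \<phi> T) = alg_map S \<phi> (act p \<sigma> T)"
  proof
    fix v
    show "act lpar \<sigma> (alg_map S \<phi> T) v = alg_map S \<phi> (act p \<sigma> T) v"
    proof (cases "length v = L")
      case True
      then show ?thesis using \<sigma> by (intro act_alg_map par) simp_all
    next
      case False
      then show ?thesis by (simp add: act_def alg_map_words T words_def)
    qed
  qed
  define K where "K = kappa (inv_bform A) (act p \<sigma> T)"
  have "K = kappa lform (alg_map S \<phi> (act p \<sigma> T))"
    unfolding K_def S'_def
    using kappa_alg_map[OF fin sup, of "act p \<sigma> T" L lform] TS L S'_def inv_bform_chart[OF p_def S_def refl refl A ev oz chart] by simp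
  then have chord_amplitude: "chord_amplitude ks \<sigma> (exp_part h' i l) = (if i = length ks \<and> l = L then K else 0)" for i l
    using chord_amplitude_exp_part[of h' ks \<sigma> i l, OF odd[unfolded H_def]]
    unfolding H_def[symmetric] L_def[symmetric] HT act_T by simp
  have ac: "amplitude_class \<Gamma> (c i l) = (if i = length ks \<and> l = L then K else 0)" for i l
  proof -
    have e: "exp_part h' i l \<in> chains i l" by (rule exp_part_chains[OF h't h'3])
    have "(SOME x. x \<in> chain_class i l (exp_part h' i l)) \<in> chain_class i l (exp_part h' i l)"
      by (rule someI[of "\<lambda>x. x \<in> chain_class i l (exp_part h' i l)"], rule chain_class_nonempty[OF e])
    then have "chord_amplitude ks \<sigma> (SOME x. x \<in> chain_class i l (exp_part h' i l)) = chord_amplitude ks \<sigma> (exp_part h' i l)"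
      using chord_amplitude_chain_class[OF e] \<sigma> L unfolding L_def by blast
    moreover have "amplitude \<Gamma> x = chord_amplitude ks \<sigma> x" for x
      unfolding amplitude_def amplitude_ordered_def beta_def chord_amplitude_def ks_def \<sigma>_def \<G>_def ..
    ultimately show ?thesis unfolding amplitude_class_def cc by (simp only: chord_amplitude)
  qed
  have "(\<Sum>(i, l) | amplitude_class \<Gamma> (c i l) \<noteq> 0. amplitude_class \<Gamma> (c i l)) = K"
  proof -
    have "(\<Sum>(i, l) | amplitude_class \<Gamma> (c i l) \<noteq> 0. amplitude_class \<Gamma> (c i l)) =
        (\<Sum>(i, l)\<in>{(length ks, L)}. amplitude_class \<Gamma> (c i l))"
      by (rule sum.mono_neutral_left) (auto simp: ac split: if_splits)
    then show ?thesis by (simp add: ac)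
  qed
  then show ?thesis
    by (simp add: pairing_def partition_function_def Let_def K_def T_def p_def ks_def \<sigma>_def \<G>_def)
qed

text \<open>The functional is evaluated on a representative in \<open>graph_chains\<close>, which involves oriented ribbon
  graphs only.\<close>

lemma graph_functional_cong:
  assumes "\<And>\<Gamma>. oriented_ribbon_graph \<Gamma> \<Longrightarrow> F \<Gamma> = F' \<Gamma>" "G \<in> graph_space"
  shows "graph_functional F G = graph_functional F' G"
proof -
  obtain g where g: "g \<in> graph_chains" "G = graph_class g" using assms(2) by (auto simp: graph_space_def)
  have "g \<in> G" unfolding g(2) graph_class_def using g(1) cspan_zero by simp
  then have "(SOME g. g \<in> G) \<in> G" by (rule someI[of "\<lambda>g. g \<in> G"])
  then have "(SOME g. g \<in> G) \<in> graph_chains" unfolding g(2) graph_class_def by blast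
  then have "oriented_ribbon_graph \<Gamma>" if "(SOME g. g \<in> G) \<Gamma> \<noteq> 0" for \<Gamma>
    using that unfolding graph_chains_def by blast
  then show ?thesis unfolding graph_functional_def Let_def
    using assms(1) by (intro sum.cong) auto
qed

theorem theorem6p11:
  fixes A :: "'b ainf" and c :: completed_chain
  assumes "symplectic_ainf A"
    and "minimal_ainf A"
    and "even_form (wparity A) (omega A)"
    and "order_zero 2 (omega A)"
    and "characteristic_class A c"
  shows "(\<forall>\<Gamma> :: 'h graph. oriented_ribbon_graph \<Gamma> \<longrightarrow> pairing c \<Gamma> = partition_function A \<Gamma>) \<and>
    (\<forall>G \<in> (graph_space :: ('h graph \<Rightarrow> complex) set set).
       graph_functional (pairing c) G = graph_functional (partition_function A) G)"
proof -
  have eq: "pairing c \<Gamma> = partition_function A \<Gamma>" if "oriented_ribbon_graph \<Gamma>" for \<Gamma> :: "'h graph"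
    by (rule pairing_eq_partition_function[OF assms(1,3-5) that])
  then show ?thesis using graph_functional_cong by blast
qed

end
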